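(* Let $\nu$ be a finite, non-atomic (positive) measure on $[-1,1]$. Let $n$ be even and let $Y$ be an $n$-dimensional Chebyshev space on $[-1,1]$. Assume that the subspace of $Y$ composed of the even functions has dimension $n/2$. Then every function $f\in\mathcal{J}_0[-1,1]$ has a unique best $L_1$ approximation in $Y$. Moreover, if every element of $\mathrm{span}(Y,f)$ has at most $n$ simple zeros, then the best $L_1$ approximation $g^*$ of $f$ in $Y$ is fully determined by the interpolation conditions $$g^*(\alpha_i)=f(\alpha_i),\qquad i=-n/2,-n/2+1,\dots,-1,1,\dots,n/2,$$ where the $\alpha_i$ are the canonical points associated with $Y$ and $\nu$ (defined in the context).
   Context: $\nu$ is a positive measure defined on a $\sigma$-field of subsets of $[-1,1]$; $L_1([-1,1],\nu)$ has norm $\Vert f\Vert_1=\int_{-1}^1|f|\,\mathrm{d}\nu$. A best $L_1$ approximation of $f$ in $Y$ is a function $g^*\in Y$ with $\Vert f-g^*\Vert_1\le\Vert f-g\Vert_1$ for all $g\in Y$. An $n$-dimensional Chebyshev space on $[a,b]$ is an $n$-dimensional subspace of $C^0[a,b]$ whose (nonzero) functions have at most $n-1$ distinct zeros on $[a,b]$. $\mathcal{J}_0[-1,1]$ is the vector space of Heaviside-type functions on $[-1,1]$ with a jump at $0$: functions $f$ such that $f\in C^0([-1,1]\setminus\{0\})$ and the limits of $|f|$ on both sides of $0$ exist and are finite. Canonical points: for $Y$ and $\nu$ as in the claim, they are the points of the unique sequence $$-1=\alpha_{-n/2-1}<\alpha_{-n/2}<\dots<\alpha_{-1}<\alpha_0=0<\alpha_1<\dots<\alpha_{n/2}<\alpha_{n/2+1}=1,\qquad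 \alpha_{-i}=-\alpha_i\ (i=1,\dots,n/2),$$ such that the function $s(x)=\sum_{i=-n/2}^{n/2+1}(-1)^i\mathbf{1}_{[\alpha_{i-1},\alpha_i[}(x)$ satisfies $\int_{-1}^1 s(x)g(x)\,\mathrm{d}\nu(x)=0$ for all $g\in Y$. Here $\mathbf{1}_{[a,b[}$ is the indicator function of $[a,b)$.
   Formalization: False as stated; here ν charges every relatively open set, canonical points are assumed to exist (proved for symmetric ν), and for interpolation f truly jumps at 0 and no element of span(Y,f) vanishes on just one half with n/2 or more zeros on the other; simple zeros are sign changes off 0. *)

theory Defs
  imports "HOL-Analysis.Analysis" "HOL-Library.Function_Algebras"
begin

definition fun_scale :: "real \<Rightarrow> (real \<Rightarrow> real) \<Rightarrow> real \<Rightarrow> real" where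
  "fun_scale c f = (\<lambda>x. c * f x)"

global_interpretation fun_vs: vector_space fun_scale
  by unfold_locales (auto simp: fun_scale_def fun_eq_iff algebra_simps)

(* Functions on [a,b] are represented by functions on the reals that are 0 outside [a,b], so that
   equality of representatives is equality on [a,b]. *)
definition C0 :: "real \<Rightarrow> real \<Rightarrow> (real \<Rightarrow> real) set" where
  "C0 a b = {g. continuous_on {a..b} g \<and> (\<forall>x. x \<notin> {a..b} \<longrightarrow> g x = 0)}"

definition zeros_on :: "real set \<Rightarrow> (real \<Rightarrow> real) \<Rightarrow> real set" where
  "zeros_on A h = {x \<in> A. h x = 0}"

(* The dimension is given by a basis because fun_vs.dim is 0 on infinite-dimensional spaces;
   "card < n" is "at most n - 1" without truncated subtraction. *)
definition chebyshev_space :: "real \<Rightarrow> real \<Rightarrow> nat \<Rightarrow> (real \<Rightarrow> real) set \<Rightarrow> bool" where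
  "chebyshev_space a b n Y \<longleftrightarrow>
     Y \<subseteq> C0 a b \<and>
     (\<exists>B. finite B \<and> card B = n \<and> \<not> fun_vs.dependent B \<and> fun_vs.span B = Y) \<and>
     (\<forall>g\<in>Y. g \<noteq> 0 \<longrightarrow> finite (zeros_on {a..b} g) \<and> card (zeros_on {a..b} g) < n)"

definition even_functions :: "(real \<Rightarrow> real) set" where
  "even_functions = {g. \<forall>x\<in>{-1..1}. g (- x) = g x}"

(* For a function that is continuous off 0, convergence of its absolute value at one side of 0
   already forces convergence of the function itself. Neither the value at 0 nor values outside
   [-1,1] are constrained. *)
definition J0 :: "(real \<Rightarrow> real) set" where
  "J0 = {f. continuous_on ({-1..1} - {0}) f \<and>
            (\<exists>L. ((\<lambda>x. \<bar>f x\<bar>) \<longlongrightarrow> L) (at_left 0)) \<and>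
            (\<exists>L. ((\<lambda>x. \<bar>f x\<bar>) \<longlongrightarrow> L) (at_right 0))}"

definition jumps_at_0 :: "(real \<Rightarrow> real) \<Rightarrow> bool" where
  "jumps_at_0 f \<longleftrightarrow>
     (\<exists>a b. (f \<longlongrightarrow> a) (at_left 0) \<and> (f \<longlongrightarrow> b) (at_right 0) \<and> a \<noteq> b)"

definition non_atomic :: "'a measure \<Rightarrow> bool" where
  "non_atomic M \<longleftrightarrow>
     (\<forall>A\<in>sets M. 0 < emeasure M A \<longrightarrow>
        (\<exists>B\<in>sets M. B \<subseteq> A \<and> 0 < emeasure M B \<and> emeasure M B < emeasure M A))"

(* A measure on a sigma-field of subsets of [-1,1] containing the Borel sets, charging every
   nonempty relatively open set. The latter makes the L1 seminorm a norm on C[-1,1]; for a measure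
   vanishing on an interval best approximations need not be unique. *)
definition positive_measure_on_I :: "real measure \<Rightarrow> bool" where
  "positive_measure_on_I \<nu> \<longleftrightarrow>
     space \<nu> = {-1..1} \<and>
     sets (restrict_space borel {-1..1}) \<subseteq> sets \<nu> \<and>
     (\<forall>U. open U \<and> U \<inter> {-1..1} \<noteq> {} \<longrightarrow> 0 < emeasure \<nu> (U \<inter> {-1..1}))"

definition symmetric_measure :: "real measure \<Rightarrow> bool" where
  "symmetric_measure \<nu> \<longleftrightarrow>
     (\<forall>A\<in>sets borel. A \<subseteq> {-1..1} \<longrightarrow> emeasure \<nu> (uminus ` A) = emeasure \<nu> A)"

definition L1_norm :: "real measure \<Rightarrow> (real \<Rightarrow> real) \<Rightarrow> real" where
  "L1_norm \<nu> f = (LINT x|\<nu>. \<bar>f x\<bar>)"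

definition best_L1_approx ::
    "real measure \<Rightarrow> (real \<Rightarrow> real) set \<Rightarrow> (real \<Rightarrow> real) \<Rightarrow> (real \<Rightarrow> real) \<Rightarrow> bool" where
  "best_L1_approx \<nu> Y f g \<longleftrightarrow>
     g \<in> Y \<and> (\<forall>h\<in>Y. L1_norm \<nu> (\<lambda>x. f x - g x) \<le> L1_norm \<nu> (\<lambda>x. f x - h x))"

definition canonical_sign :: "nat \<Rightarrow> (int \<Rightarrow> real) \<Rightarrow> real \<Rightarrow> real" where
  "canonical_sign n \<alpha> x =
     (\<Sum>i = - int (n div 2) .. int (n div 2) + 1. (-1) powi i * indicator {\<alpha> (i - 1)..<\<alpha> i} x)"

(* "extensional" fixes the irrelevant values of the sequence outside its index range, so that
   uniqueness of the sequence is expressed by equality. *)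
definition canonical_points ::
    "real measure \<Rightarrow> (real \<Rightarrow> real) set \<Rightarrow> nat \<Rightarrow> (int \<Rightarrow> real) \<Rightarrow> bool" where
  "canonical_points \<nu> Y n \<alpha> \<longleftrightarrow>
     \<alpha> \<in> extensional {- int (n div 2) - 1 .. int (n div 2) + 1} \<and>
     strict_mono_on {- int (n div 2) - 1 .. int (n div 2) + 1} \<alpha> \<and>
     \<alpha> (- int (n div 2) - 1) = -1 \<and> \<alpha> 0 = 0 \<and> \<alpha> (int (n div 2) + 1) = 1 \<and>
     (\<forall>i\<in>{1..int (n div 2)}. \<alpha> (- i) = - \<alpha> i) \<and>
     (\<forall>g\<in>Y. (LINT x|\<nu>. canonical_sign n \<alpha> x * g x) = 0)"

(* Zeros at which the sign changes, i.e. with strictly positive and strictly negative values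
   arbitrarily close by. The functions need not be differentiable; the point 0 is left out, since
   the functions considered are only defined off 0. *)
definition simple_zeros :: "(real \<Rightarrow> real) \<Rightarrow> real set" where
  "simple_zeros h = {x \<in> zeros_on ({-1..1} - {0}) h.
     (\<exists>\<^sub>F y in at x within {-1..1}. h y > 0) \<and> (\<exists>\<^sub>F y in at x within {-1..1}. h y < 0)}"

(* Excludes elements of the span that vanish identically on one half of the interval and have
   n/2 or more zeros on the other half without vanishing there. Without this, the interpolation
   property fails, e.g. for Lebesgue measure, Y = span {1, x} and f(x) = 0 for x < 0,
   f(x) = 1 - 2x for x > 0. The Heaviside function with Y the polynomials of degree < n (n even,
   n > 0) satisfies the condition. *)
definition half_nondegenerate :: "nat \<Rightarrow> (real \<Rightarrow> real) set \<Rightarrow> bool" where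
  "half_nondegenerate n S \<longleftrightarrow>
     (\<forall>h\<in>S. \<forall>(A, B) \<in> {({-1..<0}, {0<..1}), ({0<..1}, {-1..<0})}.
        (\<forall>x\<in>A. h x = 0) \<and> (\<exists>x\<in>B. h x \<noteq> 0) \<longrightarrow>
        finite (zeros_on B h) \<and> card (zeros_on B h) < n div 2)"

end

theory Submission
  imports Defs "HOL-Homology.Homology"
begin

text \<open>
  Write \<open>n = 2 m\<close>. The whole argument is a count of sign changes. A piecewise constant function
  of modulus 1 that jumps at finitely many points is written \<open>sign_pattern\<close>. For a Haar (Chebyshev)
  system of length k, every pattern with fewer than k jumps is weakly matched by a nonzero element of
  the space: some g has g times the pattern nonnegative (\<open>weak_sign_pattern\<close>). Hence a bounded
  function that is orthogonal to the space cannot follow a pattern with fewer than k jumps unless it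
  vanishes almost everywhere (\<open>orthogonal_one_signed\<close>).

  Canonical points. The canonical sign function is odd and the measure symmetric, so only the odd
  parts of the elements of Y enter the orthogonality relations. They form a space of dimension m that is
  a Haar system on (0,1) (\<open>odd_parts_haar\<close>). The question becomes whether exactly
  one increasing m-tuple in (0,1) has a pattern with vanishing moments. The moment map is
  continuous, and it is injective on the open simplex of increasing tuples, because the difference of two
  patterns follows a pattern with only m - 1 jumps. So its image is open by invariance of domain. A
  tuple on the boundary of the simplex has a pattern with fewer than m jumps, so its moments are extremal and
  cannot be a multiple in [0,1] of the moments of an interior tuple. Following the segment from one
  interior moment vector to 0 therefore never leaves the image, which contains 0
  (\<open>vanishing_moments\<close>).

  Uniqueness of the best approximation. Existence is compactness. If two different best approximations
  existed, their mean would be best too, and its error would vanish, off 0, only where the two coincide,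
  that is at fewer than n points. The sign of this error is orthogonal to Y, so it has at least n
  jumps, hence exactly n, one of which is 0. The canonical sign function also jumps at 0, and it has m
  jumps on each side, whereas on one side of 0 the error has fewer than m. Match the two patterns at 0.
  Their difference then follows a pattern with fewer than n jumps, made up of the jumps of the error on
  that side and of those of the canonical sign function on the other, so the two would coincide
  (\<open>orthogonal_patterns_eq\<close>). But one of them has n jumps and the other n + 1
  (\<open>best_approximation_unique\<close>).

  Interpolation. It suffices that the error h of the interpolant in the canonical points has the sign
  of the canonical sign function, up to a global factor (\<open>best_of_error_sign\<close>). If it did not, a
  perturbation of h by an element of Y would have more than n sign changes off 0. On either half
  of the interval, two points at which h has opposite signs relative to the canonical sign function
  give, together with the m nodes, an alternation at m + 2 points, since the values of the perturbation
  at the n nodes can be prescribed; and the other half still contributes m sign changes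
  (\<open>one_signed_half\<close>). The signs on the two halves match as well: otherwise the one-sided
  limits of h at 0 are different but not of opposite sign, and subtracting a suitable multiple of a
  function with n - 1 zeros produces an additional sign change, unless the difference vanishes on a
  whole half, which nondegeneracy excludes (\<open>no_common_sign\<close>).
\<close>

section \<open>Sign patterns\<close>

text \<open>
  The points may be given by a family with repetitions: a point of even multiplicity causes no jump,
  which lets patterns depend continuously on their points, up to null sets.
\<close>

definition sign_pattern :: "('i \<Rightarrow> real) \<Rightarrow> 'i set \<Rightarrow> real \<Rightarrow> real" where
  "sign_pattern x J t = (\<Prod>j\<in>J. if t < x j then 1 else -1)"

abbreviation set_pattern :: "real set \<Rightarrow> real \<Rightarrow> real" where
  "set_pattern \<equiv> sign_pattern (\<lambda>z. z)"

lemma sign_pattern_cases: "sign_pattern x J t = 1 \<or> sign_pattern x J t = -1"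
  unfolding sign_pattern_def by (induction J rule: infinite_finite_induct) auto

lemma sign_pattern_square [simp]: "sign_pattern x J t * sign_pattern x J t = 1"
  using sign_pattern_cases[of x J t] by auto

lemma abs_sign_pattern [simp]: "\<bar>sign_pattern x J t\<bar> = 1"
  using sign_pattern_cases[of x J t] by auto

lemma sign_pattern_nonzero [simp]: "sign_pattern x J t \<noteq> 0"
  using sign_pattern_cases[of x J t] by auto

lemma sign_pattern_empty [simp]: "sign_pattern x {} t = 1"
  by (simp add: sign_pattern_def)

lemma sign_pattern_insert:
  "finite J \<Longrightarrow> j \<notin> J \<Longrightarrow>
    sign_pattern x (insert j J) t = (if t < x j then 1 else -1) * sign_pattern x J t"
  by (simp add: sign_pattern_def)

lemma sign_pattern_Un:
  "finite J \<Longrightarrow> finite K \<Longrightarrow> J \<inter> K = {} \<Longrightarrow>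
    sign_pattern x (J \<union> K) t = sign_pattern x J t * sign_pattern x K t"
  by (simp add: sign_pattern_def prod.union_disjoint)

lemma sign_pattern_image: "inj_on x J \<Longrightarrow> set_pattern (x ` J) t = sign_pattern x J t"
  by (simp add: sign_pattern_def prod.reindex o_def)

lemma sign_pattern_all_greater: "(\<And>j. j \<in> J \<Longrightarrow> t < x j) \<Longrightarrow> sign_pattern x J t = 1"
  unfolding sign_pattern_def by (rule prod.neutral) auto

lemma sign_pattern_all_le:
  assumes "\<And>j. j \<in> J \<Longrightarrow> x j \<le> t"
  shows "sign_pattern x J t = (-1) ^ card J"
proof -
  have "sign_pattern x J t = (\<Prod>j\<in>J. - 1)"
    unfolding sign_pattern_def by (rule prod.cong) (use assms in force)+
  then show ?thesis by simp
qed

lemma sign_pattern_eq: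
  assumes "\<And>j. j \<in> J \<Longrightarrow> (t < x j) = (u < x j)"
  shows "sign_pattern x J t = sign_pattern x J u"
  unfolding sign_pattern_def by (rule prod.cong) (use assms in auto)

lemma sign_pattern_borel [measurable]: "sign_pattern x J \<in> borel_measurable borel"
proof -
  have "(\<lambda>t. \<Prod>j\<in>J. if t < x j then 1 else -1 :: real) \<in> borel_measurable borel"
    by measurable
  then show ?thesis by (simp add: sign_pattern_def[abs_def])
qed

lemma opposite_signs_zero:
  fixes u :: "real \<Rightarrow> real"
  assumes "continuous_on {x..y} u" "x < y" "u x * u y < 0"
  shows "\<exists>z\<in>{x<..<y}. u z = 0"
proof -
  have "\<exists>z. x \<le> z \<and> z \<le> y \<and> u z = 0"
  proof (cases "u x < 0")
    case True
    then have "u y > 0" using assms(3) by (simp add: mult_less_0_iff)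
    then show ?thesis using IVT'[of u x 0 y] assms True by auto
  next
    case False
    then have "u x > 0" "u y < 0" using assms(3) by (auto simp: mult_less_0_iff)
    then show ?thesis using IVT2'[of u y 0 x] assms by auto
  qed
  then obtain z where "x \<le> z" "z \<le> y" "u z = 0" by auto
  moreover have "z \<noteq> x" "z \<noteq> y" using assms(3) \<open>u z = 0\<close> by auto
  ultimately show ?thesis by (intro bexI[of _ z]) auto
qed

lemma nonvanishing_constant_sign:
  fixes h :: "real \<Rightarrow> real"
  assumes "continuous_on {a<..<b} h" "\<And>t. t \<in> {a<..<b} \<Longrightarrow> h t \<noteq> 0"
  shows "\<exists>\<epsilon>\<in>{1, -1}. \<forall>t\<in>{a<..<b}. sgn (h t) = \<epsilon>"
proof (cases "a < b")
  case True
  have *: "sgn (h x) = sgn (h y)" if xy: "x < y" "x \<in> {a<..<b}" "y \<in> {a<..<b}" for x y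
  proof (rule ccontr)
    assume ne: "sgn (h x) \<noteq> sgn (h y)"
    have "h x * h y < 0"
      using ne assms(2)[OF xy(2)] assms(2)[OF xy(3)]
      by (auto simp: sgn_if mult_less_0_iff split: if_splits)
    moreover have "continuous_on {x..y} h"
      by (rule continuous_on_subset[OF assms(1)]) (use xy in auto)
    ultimately obtain z where "z \<in> {x<..<y}" "h z = 0"
      using opposite_signs_zero[of x y h] xy(1) by blast
    then show False using assms(2)[of z] xy by auto
  qed
  define s where "s = (a + b) / 2"
  have s: "s \<in> {a<..<b}" using True by (auto simp: s_def)
  have "sgn (h t) = sgn (h s)" if t: "t \<in> {a<..<b}" for t
  proof (cases t s rule: linorder_cases)
    case less
    then show ?thesis using * s t by blast
  next
    case greater
    then have "sgn (h s) = sgn (h t)" using * s t by blast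
    then show ?thesis by (rule sym)
  qed simp
  moreover have "sgn (h s) \<in> {1, -1}" using assms(2)[OF s] by (auto simp: sgn_if)
  ultimately show ?thesis by blast
qed auto

text \<open>
  The jumps are those zeros and exceptional points at which the sign really changes; they are
  collected from left to right.
\<close>

lemma sgn_eq_sign_pattern:
  fixes h :: "real \<Rightarrow> real"
  assumes "finite P" "continuous_on ({a<..<b} - P) h" "\<And>t. t \<in> {a<..<b} - P \<Longrightarrow> h t \<noteq> 0"
  shows "\<exists>J\<subseteq>P. \<exists>\<epsilon>\<in>{1, -1}. \<forall>t\<in>{a<..<b} - P. sgn (h t) = \<epsilon> * set_pattern J t"
  using assms
proof (induction P arbitrary: b rule: finite_linorder_max_induct)
  case empty
  then have "\<exists>\<epsilon>\<in>{1, -1}. \<forall>t\<in>{a<..<b}. sgn (h t) = \<epsilon>"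
    by (intro nonvanishing_constant_sign) auto
  then show ?case by (intro exI[of _ "{}"]) simp
next
  case (insert p P)
  consider "b \<le> p" | "p \<le> a" | "a < p" "p < b" by linarith
  then show ?case
  proof cases
    case 1
    then have "{a<..<b} - insert p P = {a<..<b} - P" by auto
    then have "\<exists>J\<subseteq>P. \<exists>\<epsilon>\<in>{1, -1}. \<forall>t\<in>{a<..<b} - insert p P. sgn (h t) = \<epsilon> * set_pattern J t"
      using insert.IH[of b] insert.prems by simp
    then show ?thesis by (meson subset_insertI2)
  next
    case 2
    then have eq: "{a<..<b} - insert p P = {a<..<b}" using insert.hyps(2) by fastforce
    have "\<exists>\<epsilon>\<in>{1, -1}. \<forall>t\<in>{a<..<b}. sgn (h t) = \<epsilon>"
      using insert.prems unfolding eq by (intro nonvanishing_constant_sign)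
    then show ?thesis unfolding eq by (intro exI[of _ "{}"]) simp
  next
    case 3
    have sub: "{a<..<p} - P \<subseteq> {a<..<b} - insert p P" using 3 by auto
    have "\<exists>J\<subseteq>P. \<exists>\<epsilon>\<in>{1, -1}. \<forall>t\<in>{a<..<p} - P. sgn (h t) = \<epsilon> * set_pattern J t"
      by (rule insert.IH[OF continuous_on_subset[OF insert.prems(1) sub]])
        (use insert.prems(2) sub in auto)
    then obtain J \<epsilon> where J: "J \<subseteq> P" "\<epsilon> \<in> {1, -1}"
      "\<forall>t\<in>{a<..<p} - P. sgn (h t) = \<epsilon> * set_pattern J t"
      by (elim exE bexE conjE)
    have finJ: "finite J" and pJ: "p \<notin> J"
      using J insert.hyps finite_subset by auto
    have sub': "{p<..<b} \<subseteq> {a<..<b} - insert p P"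
    proof
      fix t assume t: "t \<in> {p<..<b}"
      then have "t \<notin> P" using insert.hyps(2) by fastforce
      then show "t \<in> {a<..<b} - insert p P" using t 3 by simp
    qed
    have "\<exists>\<eta>\<in>{1, -1}. \<forall>t\<in>{p<..<b}. sgn (h t) = \<eta>"
      by (rule nonvanishing_constant_sign[OF continuous_on_subset[OF insert.prems(1) sub']])
        (use insert.prems(2) sub' in auto)
    then obtain \<eta> where \<eta>: "\<eta> \<in> {1, -1}" "\<forall>t\<in>{p<..<b}. sgn (h t) = \<eta>" by (elim bexE)
    have patR: "set_pattern J t = (-1) ^ card J" if "t \<in> {p<..<b}" for t
    proof (rule sign_pattern_all_le)
      fix j assume "j \<in> J"
      then have "j < p" using J(1) insert.hyps(2) by blast
      then show "j \<le> t" using that by simp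
    qed
    \<comment> \<open>The point p joins the set exactly if the sign of h changes there.\<close>
    define J' where "J' = (if \<eta> = \<epsilon> * (-1) ^ card J then J else insert p J)"
    have left': "set_pattern J' t = set_pattern J t" if "t < p" for t
      using that finJ pJ by (auto simp: J'_def sign_pattern_insert)
    have right': "\<epsilon> * set_pattern J' t = \<eta>" if "t \<in> {p<..<b}" for t
    proof (cases "\<eta> = \<epsilon> * (-1) ^ card J")
      case True
      then show ?thesis by (simp add: J'_def patR[OF that])
    next
      case False
      then have "set_pattern J' t = - ((-1) ^ card J)"
        using that finJ pJ patR[OF that] by (simp add: J'_def sign_pattern_insert)
      moreover have "\<eta> = - (\<epsilon> * (-1) ^ card J)"
        using J(2) \<eta>(1) False by (cases "even (card J)") auto
      ultimately show ?thesis by simp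
    qed
    have "sgn (h t) = \<epsilon> * set_pattern J' t" if t: "t \<in> {a<..<b} - insert p P" for t
    proof (cases "t < p")
      case True
      then show ?thesis using J(3) t left' by auto
    next
      case False
      then have "t \<in> {p<..<b}" using t by auto
      then show ?thesis using \<eta>(2) right' by simp
    qed
    moreover have "J' \<subseteq> insert p P" using J by (auto simp: J'_def)
    ultimately show ?thesis using J(2) by blast
  qed
qed

section \<open>Haar systems\<close>

definition lincomb :: "nat \<Rightarrow> (nat \<Rightarrow> real \<Rightarrow> real) \<Rightarrow> (nat \<Rightarrow> real) \<Rightarrow> real \<Rightarrow> real" where
  "lincomb m \<phi> c t = (\<Sum>i<m. c i * \<phi> i t)"

lemma lincomb_add: "lincomb m \<phi> (\<lambda>i. c i + d i) t = lincomb m \<phi> c t + lincomb m \<phi> d t"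
  by (simp add: lincomb_def sum.distrib distrib_right)

lemma lincomb_diff: "lincomb m \<phi> (\<lambda>i. c i - d i) t = lincomb m \<phi> c t - lincomb m \<phi> d t"
  by (simp add: lincomb_def sum_subtractf left_diff_distrib)

lemma lincomb_scale: "lincomb m \<phi> (\<lambda>i. e * c i) t = e * lincomb m \<phi> c t"
  by (simp add: lincomb_def sum_distrib_left mult.assoc)

lemma lincomb_uminus: "lincomb m \<phi> (\<lambda>i. - c i) t = - lincomb m \<phi> c t"
  by (simp add: lincomb_def sum_negf)

lemma lincomb_cong: "(\<And>i. i < m \<Longrightarrow> c i = d i) \<Longrightarrow> lincomb m \<phi> c t = lincomb m \<phi> d t"
  by (simp add: lincomb_def)

lemma lincomb_split:
  "lincomb (2 * m) \<phi> c t = lincomb m \<phi> c t + lincomb m (\<lambda>i. \<phi> (m + i)) (\<lambda>i. c (m + i)) t"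
proof -
  have "lincomb (2 * m) \<phi> c t = (\<Sum>i\<in>{..<m} \<union> {m..<2 * m}. c i * \<phi> i t)"
    unfolding lincomb_def by (rule sum.cong) auto
  also have "\<dots> = (\<Sum>i<m. c i * \<phi> i t) + (\<Sum>i\<in>{m..<2 * m}. c i * \<phi> i t)"
    by (rule sum.union_disjoint) auto
  also have "(\<Sum>i\<in>{m..<2 * m}. c i * \<phi> i t) = (\<Sum>i<m. c (m + i) * \<phi> (m + i) t)"
    by (rule sum.reindex_bij_witness[where i = "\<lambda>i. m + i" and j = "\<lambda>i. i - m"]) auto
  finally show ?thesis by (simp add: lincomb_def)
qed

lemma lincomb_nonzero: "lincomb m \<phi> c t \<noteq> 0 \<Longrightarrow> \<exists>i<m. c i \<noteq> 0"
  unfolding lincomb_def by (metis (no_types, lifting) lessThan_iff mult_eq_0_iff sum.neutral)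

text \<open>
  Gaussian elimination of one unknown per equation.
\<close>

lemma homogeneous_solution:
  fixes A :: "'i \<Rightarrow> 'x \<Rightarrow> real"
  assumes "finite X" "finite I" "card X < card I"
  shows "\<exists>c. (\<exists>i\<in>I. c i \<noteq> 0) \<and> (\<forall>x\<in>X. (\<Sum>i\<in>I. c i * A i x) = 0)"
  using assms
proof (induction X arbitrary: I A rule: finite_induct)
  case empty
  then have "I \<noteq> {}" by auto
  then show ?case by (intro exI[of _ "\<lambda>_. 1"]) auto
next
  case (insert x X)
  show ?case
  proof (cases "\<forall>i\<in>I. A i x = 0")
    case True
    moreover obtain c where "\<exists>i\<in>I. c i \<noteq> 0" "\<forall>x\<in>X. (\<Sum>i\<in>I. c i * A i x) = 0"
      using insert.IH[of I A] insert.prems insert.hyps by (force dest: Suc_lessD)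
    ultimately show ?thesis by (intro exI[of _ c]) auto
  next
    case False
    then obtain p where p: "p \<in> I" "A p x \<noteq> 0" by auto
    define I' where "I' = I - {p}"
    have I: "I = insert p I'" "p \<notin> I'" "finite I'" using p insert.prems by (auto simp: I'_def)
    define A' where "A' = (\<lambda>i y. A i y - (A i x / A p x) * A p y)"
    have "card X < card I'" using insert I by auto
    then obtain c where c: "\<exists>i\<in>I'. c i \<noteq> 0" "\<forall>y\<in>X. (\<Sum>i\<in>I'. c i * A' i y) = 0"
      using insert.IH[of I' A'] I by auto
    define r where "r = - (\<Sum>i\<in>I'. c i * (A i x / A p x))"
    define d where "d = c(p := r)"
    have dsum: "(\<Sum>i\<in>I. d i * A i y) = r * A p y + (\<Sum>i\<in>I'. c i * A i y)" for y
    proof -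
      have "(\<Sum>i\<in>I'. d i * A i y) = (\<Sum>i\<in>I'. c i * A i y)"
        by (rule sum.cong) (use I in \<open>auto simp: d_def\<close>)
      then show ?thesis using I by (simp add: d_def)
    qed
    have rA: "r * A p y = - (\<Sum>i\<in>I'. c i * (A i x / A p x * A p y))" for y
      by (simp add: r_def sum_distrib_right mult.assoc)
    have "(\<Sum>i\<in>I. d i * A i y) = 0" if "y \<in> insert x X" for y
    proof (cases "y = x")
      case True
      then show ?thesis using p unfolding dsum rA by simp
    next
      case False
      then have "0 = (\<Sum>i\<in>I'. c i * A' i y)" using that c by auto
      also have "\<dots> = (\<Sum>i\<in>I'. c i * A i y) - (\<Sum>i\<in>I'. c i * (A i x / A p x * A p y))"
        by (simp add: A'_def right_diff_distrib sum_subtractf)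
      finally show ?thesis unfolding dsum rA by simp
    qed
    moreover have "\<exists>i\<in>I. d i \<noteq> 0" using c I by (auto simp: d_def)
    ultimately show ?thesis by (intro exI[of _ d]) auto
  qed
qed

lemma lincomb_vanishing:
  assumes "finite X" "card X < m"
  shows "\<exists>c. (\<exists>i<m. c i \<noteq> 0) \<and> (\<forall>x\<in>X. lincomb m \<phi> c x = 0)"
  using homogeneous_solution[of X "{..<m}" \<phi>] assms by (auto simp: lincomb_def)

text \<open>
  Only zeros in the open interval are counted. The odd parts of a Chebyshev space on [-1,1] all vanish
  at 0, so they are a Haar system on (0,1) without being one on [0,1].
\<close>

locale haar_system =
  fixes \<phi> :: "nat \<Rightarrow> real \<Rightarrow> real" and m :: nat and a b :: real
  assumes ab: "a < b"
    and cont: "\<And>i. i < m \<Longrightarrow> continuous_on {a..b} (\<phi> i)"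
    and haar: "\<And>c i. i < m \<Longrightarrow> c i \<noteq> 0 \<Longrightarrow>
      finite {t \<in> {a<..<b}. lincomb m \<phi> c t = 0} \<and> card {t \<in> {a<..<b}. lincomb m \<phi> c t = 0} < m"
begin

abbreviation comb :: "(nat \<Rightarrow> real) \<Rightarrow> real \<Rightarrow> real" where
  "comb \<equiv> lincomb m \<phi>"

lemma continuous_lincomb: "continuous_on {a..b} (comb c)"
  unfolding lincomb_def[abs_def] by (intro continuous_intros cont) auto

lemma few_zeros:
  assumes "\<exists>i<m. c i \<noteq> 0" "X \<subseteq> {a<..<b}" "\<And>x. x \<in> X \<Longrightarrow> comb c x = 0"
  shows "finite X" "card X < m"
proof -
  let ?Z = "{t \<in> {a<..<b}. comb c t = 0}"
  have Z: "finite ?Z" "card ?Z < m" using haar assms(1) by auto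
  moreover have "X \<subseteq> ?Z" using assms by auto
  ultimately show "finite X" "card X < m"
    using finite_subset card_mono by (blast, meson order.strict_trans1)
qed

text \<open>
  A solution of the homogeneous system for the basis enlarged by the prescribed values must use these
  values with a nonzero coefficient, since otherwise it would have m zeros.
\<close>

lemma interpolation:
  assumes "X \<subseteq> {a<..<b}" "finite X" "card X = m"
  shows "\<exists>c. \<forall>x\<in>X. comb c x = v x"
proof -
  define \<psi> where "\<psi> = (\<lambda>i x. if i < m then \<phi> i x else - v x)"
  obtain c where c: "\<exists>i<Suc m. c i \<noteq> 0" "\<forall>x\<in>X. lincomb (Suc m) \<psi> c x = 0"
    using lincomb_vanishing[of X "Suc m" \<psi>] assms by auto
  have eq: "lincomb (Suc m) \<psi> c x = comb c x - c m * v x" for x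
    by (simp add: lincomb_def \<psi>_def)
  have "c m \<noteq> 0"
  proof
    assume 0: "c m = 0"
    then have "\<exists>i<m. c i \<noteq> 0" using c(1) less_Suc_eq by auto
    then have "card X < m" by (rule few_zeros) (use assms c eq 0 in auto)
    then show False using assms by simp
  qed
  then have "\<forall>x\<in>X. comb (\<lambda>i. (1 / c m) * c i) x = v x"
    using c(2) unfolding lincomb_scale eq by (auto simp: field_simps)
  then show ?thesis by blast
qed

text \<open>
  A nonzero combination with zeros at m - 1 given points changes sign at each of them: near a zero
  without sign change, a small multiple of a combination that vanishes at the other points only would
  split it into two zeros, and m zeros are too many.
\<close>

lemma exact_sign_pattern:
  assumes Y: "Y \<subseteq> {a<..<b}" "finite Y" "Suc (card Y) = m"
  shows "\<exists>c. (\<exists>i<m. c i \<noteq> 0) \<and> (\<forall>t\<in>{a<..<b} - Y. sgn (comb c t) = set_pattern Y t)"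
proof -
  obtain c where c: "\<exists>i<m. c i \<noteq> 0" "\<forall>x\<in>Y. comb c x = 0"
    using lincomb_vanishing[of Y m \<phi>] Y by auto
  let ?h = "comb c"
  have nz: "?h t \<noteq> 0" if "t \<in> {a<..<b} - Y" for t
  proof
    assume "?h t = 0"
    then have "card (insert t Y) < m" by (intro few_zeros(2)[OF c(1)]) (use c that Y in auto)
    then show False using that Y by auto
  qed
  have "continuous_on ({a<..<b} - Y) ?h"
    by (rule continuous_on_subset[OF continuous_lincomb]) auto
  then obtain J \<epsilon> where J: "J \<subseteq> Y" "\<epsilon> \<in> {1, -1}"
    "\<forall>t\<in>{a<..<b} - Y. sgn (?h t) = \<epsilon> * set_pattern J t"
    using sgn_eq_sign_pattern[OF Y(2), of a b ?h] nz by blast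
  have "J = Y"
  proof (rule ccontr)
    assume "J \<noteq> Y"
    then obtain y where y: "y \<in> Y" "y \<notin> J" using J by auto
    have "open ({a<..<b} - (Y - {y}))"
      using Y by (intro open_Diff finite_imp_closed) auto
    moreover have "y \<in> {a<..<b} - (Y - {y})" using y Y by auto
    ultimately obtain r where r: "r > 0" "cball y r \<subseteq> {a<..<b} - (Y - {y})"
      using open_contains_cball by blast
    have rin: "t \<in> {a<..<b} - (Y - {y})" if "\<bar>t - y\<bar> \<le> r" for t
      using r that by (auto simp: cball_def dist_real_def abs_minus_commute)
    define \<kappa> where "\<kappa> = \<epsilon> * set_pattern J y"
    have \<kappa>: "\<kappa> * \<kappa> = 1" "\<bar>\<kappa>\<bar> = 1" using J by (auto simp: \<kappa>_def abs_mult)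
    have hs: "sgn (?h t) = \<kappa>" if "\<bar>t - y\<bar> \<le> r" "t \<noteq> y" for t
    proof -
      have "set_pattern J t = set_pattern J y"
      proof (rule sign_pattern_eq)
        fix j assume "j \<in> J"
        then have j: "j \<in> Y - {y}" using y J by auto
        show "(t < j) = (y < j)"
        proof (rule ccontr)
          assume "(t < j) \<noteq> (y < j)"
          then have "\<bar>j - y\<bar> \<le> r" using that by auto
          then show False using rin j by auto
        qed
      qed
      then show ?thesis using J(3) rin[OF that(1)] that(2) by (auto simp: \<kappa>_def)
    qed
    \<comment> \<open>The additional zero w ensures that p does not vanish at y.\<close>
    obtain w where w: "w \<in> {a<..<b}" "w \<notin> Y"
      using Y(2) ab infinite_Ioo[OF ab] by (metis finite_subset subsetI)
    have "card (insert w (Y - {y})) < m"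
      using Y y w card_Suc_Diff1[of Y y] by simp
    then obtain p where p: "\<exists>i<m. p i \<noteq> 0" "\<forall>x\<in>insert w (Y - {y}). comb p x = 0"
      using lincomb_vanishing[of "insert w (Y - {y})" m \<phi>] Y by auto
    let ?p = "comb p"
    have py: "?p y \<noteq> 0"
    proof
      assume "?p y = 0"
      then have "card (insert w Y) < m" by (intro few_zeros(2)[OF p(1)]) (use p w Y in auto)
      then show False using w Y by auto
    qed
    define M where "M = \<bar>?p (y - r)\<bar> + \<bar>?p (y + r)\<bar> + 1"
    have M: "M > 0" by (simp add: M_def add_nonneg_pos)
    define l where "l = min \<bar>?h (y - r)\<bar> \<bar>?h (y + r)\<bar>"
    have hnz: "?h (y - r) \<noteq> 0" "?h (y + r) \<noteq> 0"
      using nz[of "y - r"] nz[of "y + r"] rin[of "y - r"] rin[of "y + r"] r by auto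
    then have l: "l > 0" by (simp add: l_def)
    define e where "e = l / (2 * M)"
    have e: "e > 0" using l M by (simp add: e_def)
    \<comment> \<open>At y the sign of u is opposite to that of h nearby; e is so small that at y - r and y + r it is still that of h.\<close>
    define u where "u = comb (\<lambda>i. c i - (\<kappa> * sgn (?p y) * e) * p i)"
    have u: "u t = ?h t - \<kappa> * sgn (?p y) * e * ?p t" for t
      by (simp only: u_def lincomb_diff lincomb_scale)
    have "?h y = 0" using c y by auto
    then have uy: "\<kappa> * u y < 0"
    proof -
      have "\<kappa> = 1 \<or> \<kappa> = -1" using \<kappa>(2) by linarith
      then show ?thesis using e py \<open>?h y = 0\<close> by (auto simp: u sgn_if mult_less_0_iff)
    qed
    have uend: "\<kappa> * u t > 0" if t: "t = y - r \<or> t = y + r" for t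
    proof -
      have "\<kappa> * ?h t = \<bar>?h t\<bar>"
        using hs[of t] t r by (auto simp: abs_if sgn_if split: if_splits)
      moreover have "\<kappa> * (\<kappa> * sgn (?p y) * e * ?p t) = e * (sgn (?p y) * ?p t)"
        using \<kappa> by (simp flip: mult.assoc)
      moreover have "e * (sgn (?p y) * ?p t) < \<bar>?h t\<bar>"
      proof -
        have "sgn (?p y) * ?p t \<le> \<bar>?p t\<bar>" by (auto simp: sgn_if)
        also have "\<dots> \<le> M" using t by (auto simp: M_def)
        finally have "e * (sgn (?p y) * ?p t) \<le> e * M" using e by simp
        also have "\<dots> = l / 2" using M by (simp add: e_def)
        also have "\<dots> < l" using l by simp
        also have "\<dots> \<le> \<bar>?h t\<bar>" using t by (auto simp: l_def)
        finally show ?thesis .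
      qed
      ultimately show ?thesis unfolding u right_diff_distrib by linarith
    qed
    have cu: "continuous_on A u" if "A \<subseteq> {a..b}" for A
      unfolding u_def using continuous_lincomb that continuous_on_subset by blast
    have "u (y - r) * u y < 0"
    proof -
      have "u (y - r) * u y = (\<kappa> * u (y - r)) * (\<kappa> * u y)" using \<kappa> by (simp add: mult_ac flip: mult.assoc)
      also have "\<dots> < 0" using uend uy by (simp add: mult_less_0_iff)
      finally show ?thesis .
    qed
    moreover have "{y - r..y} \<subseteq> {a..b}" using rin[of "y - r"] rin[of y] r by auto
    ultimately obtain z1 where z1: "z1 \<in> {y - r<..<y}" "u z1 = 0"
      using opposite_signs_zero[OF cu, of "y - r" y] r by auto
    have "u y * u (y + r) < 0"
    proof -
      have "u y * u (y + r) = (\<kappa> * u y) * (\<kappa> * u (y + r))" using \<kappa> by (simp add: mult_ac flip: mult.assoc)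
      also have "\<dots> < 0" using uend uy by (simp add: mult_less_0_iff)
      finally show ?thesis .
    qed
    moreover have "{y..y + r} \<subseteq> {a..b}" using rin[of "y + r"] rin[of y] r by auto
    ultimately obtain z2 where z2: "z2 \<in> {y<..<y + r}" "u z2 = 0"
      using opposite_signs_zero[OF cu, of y "y + r"] r by auto
    have z12: "z1 \<in> {a<..<b} - (Y - {y})" "z2 \<in> {a<..<b} - (Y - {y})"
      using rin[of z1] rin[of z2] z1 z2 by auto
    have unz: "\<exists>i<m. c i - (\<kappa> * sgn (?p y) * e) * p i \<noteq> 0"
      by (rule lincomb_nonzero[of m \<phi> _ y]) (use uy in \<open>auto simp: u_def\<close>)
    have "card (insert z1 (insert z2 (Y - {y}))) < m"
    proof (rule few_zeros(2)[OF unz])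
      fix x assume "x \<in> insert z1 (insert z2 (Y - {y}))"
      then have "u x = 0" using z1 z2 c p by (auto simp: u)
      then show "comb (\<lambda>i. c i - \<kappa> * sgn (?p y) * e * p i) x = 0" by (simp add: u_def)
    qed (use z12 Y in auto)
    moreover have "card (insert z1 (insert z2 (Y - {y}))) = Suc (Suc (card (Y - {y})))"
      using z12 z1 z2 Y by auto
    ultimately show False using Y y card_Suc_Diff1[of Y y] by simp
  qed
  define d where "d = (\<lambda>i. \<epsilon> * c i)"
  have "\<forall>t\<in>{a<..<b} - Y. sgn (comb d t) = set_pattern Y t"
    using J \<open>J = Y\<close> unfolding d_def lincomb_scale by (auto simp: sgn_mult)
  moreover have "\<exists>i<m. d i \<noteq> 0" using c J by (auto simp: d_def)
  ultimately show ?thesis by blast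
qed

end

section \<open>Weakly matching a sign pattern\<close>

lemma compact_coordinate_box:
  fixes R :: "nat \<Rightarrow> real"
  shows "compact {c :: nat \<Rightarrow> real. \<forall>i. \<bar>c i\<bar> \<le> R i}"
proof -
  have "{c :: nat \<Rightarrow> real. \<forall>i. \<bar>c i\<bar> \<le> R i} = (\<Pi>\<^sub>E i\<in>UNIV. {- R i..R i})"
    by (auto simp: PiE_def Pi_def abs_le_iff minus_le_iff)
  moreover have "compactin (powertop_real UNIV) (\<Pi>\<^sub>E i\<in>UNIV. {- R i..R i})"
    by (subst compactin_PiE) (auto simp: compactin_euclidean_iff)
  ultimately show ?thesis
    by (simp add: euclidean_product_topology compactin_euclidean_iff)
qed

lemma tendsto_coordinate:
  fixes c :: "'i::countable \<Rightarrow> real"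
  assumes "(f \<longlongrightarrow> c) F"
  shows "((\<lambda>k. f k i) \<longlongrightarrow> c i) F"
  using continuous_on_tendsto_compose[OF _ assms, of UNIV "\<lambda>c. c i"] by simp

text \<open>
  Coefficients with maximum norm 1, extended by 0: a compact set of representatives of all nonzero
  combinations up to a factor.
\<close>

definition coeff_sphere :: "nat \<Rightarrow> (nat \<Rightarrow> real) set" where
  "coeff_sphere m = {c. (\<forall>i. \<bar>c i\<bar> \<le> (if i < m then 1 else 0)) \<and> (\<exists>i<m. \<bar>c i\<bar> = 1)}"

lemma compact_coeff_sphere: "compact (coeff_sphere m)"
proof -
  have "closed {c :: nat \<Rightarrow> real. \<bar>c i\<bar> = 1}" for i
    by (intro closed_Collect_eq continuous_intros continuous_on_product_coordinates)
  then have "closed (\<Union>i<m. {c :: nat \<Rightarrow> real. \<bar>c i\<bar> = 1})" by auto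
  then have "compact ({c :: nat \<Rightarrow> real. \<forall>i. \<bar>c i\<bar> \<le> (if i < m then 1 else 0)} \<inter>
      (\<Union>i<m. {c. \<bar>c i\<bar> = 1}))"
    by (intro compact_Int_closed compact_coordinate_box)
  moreover have "{c :: nat \<Rightarrow> real. \<forall>i. \<bar>c i\<bar> \<le> (if i < m then 1 else 0)} \<inter>
      (\<Union>i<m. {c. \<bar>c i\<bar> = 1}) = coeff_sphere m"
    by (auto simp: coeff_sphere_def)
  ultimately show ?thesis by simp
qed

lemma coeff_sphere_nonzero: "c \<in> coeff_sphere m \<Longrightarrow> \<exists>i<m. c i \<noteq> 0"
  by (force simp: coeff_sphere_def)

lemma normalise_coefficients:
  assumes "\<exists>i<m. c i \<noteq> 0"
  shows "\<exists>r>0. \<exists>d\<in>coeff_sphere m. \<forall>i<m. c i = r * d i"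
proof -
  define r where "r = Max ((\<lambda>i. \<bar>c i\<bar>) ` {..<m})"
  have le: "\<bar>c i\<bar> \<le> r" if "i < m" for i using that by (auto simp: r_def intro!: Max_ge)
  obtain i where i: "i < m" "c i \<noteq> 0" using assms by auto
  then have r: "r > 0" using le[of i] by linarith
  have "r \<in> (\<lambda>i. \<bar>c i\<bar>) ` {..<m}" unfolding r_def by (rule Max_in) (use i in auto)
  then obtain k where k: "k < m" "\<bar>c k\<bar> = r" by auto
  define d where "d = (\<lambda>i. if i < m then c i / r else 0)"
  have "d \<in> coeff_sphere m"
    using le k r by (auto simp: coeff_sphere_def d_def abs_divide intro!: exI[of _ k])
  moreover have "\<forall>i<m. c i = r * d i" using r by (simp add: d_def)
  ultimately show ?thesis using r by blast
qed

lemma tendsto_lincomb: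
  assumes "(f \<longlongrightarrow> c) F"
  shows "((\<lambda>k. lincomb m \<phi> (f k) t) \<longlongrightarrow> lincomb m \<phi> c t) F"
  unfolding lincomb_def by (intro tendsto_intros tendsto_coordinate assms)

lemma sign_pattern_eventually:
  fixes x :: "nat \<Rightarrow> real"
  assumes lim: "\<And>j. j < k \<Longrightarrow> (\<lambda>l. y l j) \<longlonglongrightarrow> x j" and t: "t \<notin> x ` {..<k}"
  shows "\<forall>\<^sub>F l in sequentially. t \<notin> y l ` {..<k} \<and> sign_pattern (y l) {..<k} t = sign_pattern x {..<k} t"
proof -
  have "\<forall>\<^sub>F l in sequentially. (t < y l j) = (t < x j) \<and> t \<noteq> y l j" if j: "j < k" for j
  proof (cases "t < x j")
    case True
    then show ?thesis
      using order_tendstoD(1)[OF lim[OF j] True] by (auto elim: eventually_mono)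
  next
    case False
    then have "x j < t" using t j by force
    then show ?thesis
      using order_tendstoD(2)[OF lim[OF j], of t] by (auto elim: eventually_mono)
  qed
  then have "\<forall>\<^sub>F l in sequentially. \<forall>j\<in>{..<k}. (t < y l j) = (t < x j) \<and> t \<noteq> y l j"
    by (intro eventually_ball_finite) auto
  then show ?thesis
  proof (rule eventually_mono)
    fix l assume l: "\<forall>j\<in>{..<k}. (t < y l j) = (t < x j) \<and> t \<noteq> y l j"
    then have "sign_pattern (y l) {..<k} t = sign_pattern x {..<k} t"
      unfolding sign_pattern_def by (intro prod.cong) auto
    then show "t \<notin> y l ` {..<k} \<and> sign_pattern (y l) {..<k} t = sign_pattern x {..<k} t"
      using l by auto
  qed
qed

lemma distinct_approximation:
  fixes x :: "nat \<Rightarrow> real"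
  assumes "a < b" "e > 0" "\<And>j. j < k \<Longrightarrow> x j \<in> {a..b}"
  shows "\<exists>y. inj_on y {..<k} \<and> (\<forall>j<k. y j \<in> {a<..<b} \<and> \<bar>y j - x j\<bar> < e)"
  using assms(3)
proof (induction k)
  case (Suc k)
  then obtain y where y: "inj_on y {..<k}" "\<And>j. j < k \<Longrightarrow> y j \<in> {a<..<b} \<and> \<bar>y j - x j\<bar> < e"
    by (metis less_SucI)
  have "x k \<in> {a..b}" using Suc.prems by auto
  then have "max a (x k - e) < min b (x k + e)" using assms by auto
  then have "infinite ({max a (x k - e)<..<min b (x k + e)} - y ` {..<k})"
    using infinite_Ioo by (intro Diff_infinite_finite) auto
  then obtain w where w: "w \<in> {max a (x k - e)<..<min b (x k + e)}" "w \<notin> y ` {..<k}"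
    by (metis DiffE finite.emptyI ex_in_conv)
  define z where "z = y(k := w)"
  have "inj_on z {..<Suc k}"
    using y(1) w(2) by (auto simp: z_def inj_on_def less_Suc_eq)
  moreover have "\<forall>j<Suc k. z j \<in> {a<..<b} \<and> \<bar>z j - x j\<bar> < e"
    using y(2) w(1) by (auto simp: z_def less_Suc_eq abs_less_iff)
  ultimately show ?case by blast
qed auto

context haar_system
begin

text \<open>
  Coinciding points and points at the ends are approximated by distinct interior points. The
  combinations belonging to these have a convergent subsequence on the coefficient sphere, and the weak
  inequality survives in the limit.
\<close>

lemma weak_sign_pattern_nat:
  assumes m: "Suc k = m" and x: "\<And>j. j < k \<Longrightarrow> x j \<in> {a..b}"
  shows "\<exists>c. (\<exists>i<m. c i \<noteq> 0) \<and>
    (\<forall>t\<in>{a<..<b} - x ` {..<k}. sign_pattern x {..<k} t * comb c t \<ge> 0)"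
proof -
  have "\<exists>y d. d \<in> coeff_sphere m \<and> (\<forall>j<k. \<bar>y j - x j\<bar> < 1 / real (Suc l)) \<and>
    (\<forall>t\<in>{a<..<b} - y ` {..<k}. sign_pattern y {..<k} t * comb d t \<ge> 0)" for l
  proof -
    obtain y where y: "inj_on y {..<k}" "\<And>j. j < k \<Longrightarrow> y j \<in> {a<..<b}"
      "\<And>j. j < k \<Longrightarrow> \<bar>y j - x j\<bar> < 1 / real (Suc l)"
      using distinct_approximation[OF ab, of "1 / real (Suc l)" k x] x by auto
    have "Suc (card (y ` {..<k})) = m" using m y(1) by (simp add: card_image)
    then obtain c where c: "\<exists>i<m. c i \<noteq> 0"
      "\<forall>t\<in>{a<..<b} - y ` {..<k}. sgn (comb c t) = set_pattern (y ` {..<k}) t"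
      using exact_sign_pattern[of "y ` {..<k}"] y(2) by (metis (no_types, lifting) finite_imageI
        finite_lessThan image_subsetI lessThan_iff)
    obtain r d where d: "r > 0" "d \<in> coeff_sphere m" "\<forall>i<m. c i = r * d i"
      using normalise_coefficients[OF c(1)] by blast
    have "comb c t = r * comb d t" for t
      unfolding lincomb_scale[symmetric] by (rule lincomb_cong) (use d in auto)
    then have "\<forall>t\<in>{a<..<b} - y ` {..<k}. sgn (comb d t) = sign_pattern y {..<k} t"
      using c(2) d(1) sign_pattern_image[OF y(1)] by (simp add: sgn_mult)
    then have "\<forall>t\<in>{a<..<b} - y ` {..<k}. sign_pattern y {..<k} t * comb d t \<ge> 0"
      by (metis sgn_mult_self_eq abs_ge_zero mult_sgn_abs abs_sgn mult.commute)
    then show ?thesis using d y by blast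
  qed
  then obtain y d where yd: "\<And>l. d l \<in> coeff_sphere m"
    "\<And>l j. j < k \<Longrightarrow> \<bar>y l j - x j\<bar> < 1 / real (Suc l)"
    "\<And>l t. t \<in> {a<..<b} - y l ` {..<k} \<Longrightarrow> sign_pattern (y l) {..<k} t * comb (d l) t \<ge> 0"
    by metis
  obtain c r where c: "c \<in> coeff_sphere m" "strict_mono r" "(d \<circ> r) \<longlonglongrightarrow> c"
    using compact_coeff_sphere[of m, unfolded compact_def] yd(1) by metis
  have ylim: "(\<lambda>l. y l j) \<longlonglongrightarrow> x j" if "j < k" for j
  proof -
    have "(\<lambda>l. y l j - x j) \<longlonglongrightarrow> 0"
      by (rule Lim_null_comparison[OF _ LIMSEQ_inverse_real_of_nat])
        (use yd(2)[OF that] in \<open>auto simp: inverse_eq_divide less_imp_le intro!: always_eventually\<close>)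
    then show ?thesis by (simp add: LIM_zero_iff)
  qed
  have "sign_pattern x {..<k} t * comb c t \<ge> 0" if t: "t \<in> {a<..<b} - x ` {..<k}" for t
  proof (rule tendsto_lowerbound)
    show "(\<lambda>l. sign_pattern x {..<k} t * comb ((d \<circ> r) l) t)
        \<longlonglongrightarrow> sign_pattern x {..<k} t * comb c t"
      by (intro tendsto_intros tendsto_lincomb c)
    have "\<forall>\<^sub>F l in sequentially. t \<notin> y (r l) ` {..<k} \<and>
        sign_pattern (y (r l)) {..<k} t = sign_pattern x {..<k} t"
      using t LIMSEQ_subseq_LIMSEQ[OF ylim c(2)] by (intro sign_pattern_eventually) (auto simp: o_def)
    then show "\<forall>\<^sub>F l in sequentially. 0 \<le> sign_pattern x {..<k} t * comb ((d \<circ> r) l) t"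
    proof (rule eventually_mono)
      fix l assume l: "t \<notin> y (r l) ` {..<k} \<and> sign_pattern (y (r l)) {..<k} t = sign_pattern x {..<k} t"
      then show "0 \<le> sign_pattern x {..<k} t * comb ((d \<circ> r) l) t"
        using yd(3)[of t "r l"] t by simp
    qed
  qed simp
  then show ?thesis using coeff_sphere_nonzero[OF c(1)] by blast
qed

text \<open>
  Missing points are placed at the right end b, where they cause no jump inside the interval.
\<close>

lemma weak_sign_pattern:
  fixes x :: "'i \<Rightarrow> real"
  assumes J: "finite J" "card J < m"
  shows "\<exists>c. (\<exists>i<m. c i \<noteq> 0) \<and>
    (\<forall>t\<in>{a<..<b} - x ` J. sign_pattern x J t * comb c t \<ge> 0)"
proof -
  obtain e where e: "bij_betw e {..<card J} J"
    using ex_bij_betw_nat_finite[OF J(1)] by (auto simp: atLeast0LessThan)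
  \<comment> \<open>Moving points outside the interval to its ends changes the pattern nowhere inside.\<close>
  define y where "y = (\<lambda>j. if j < card J then max a (min b (x (e j))) else b)"
  have y: "y j \<in> {a..b}" for j using ab by (auto simp: y_def)
  obtain c where c: "\<exists>i<m. c i \<noteq> 0"
    "\<And>t. t \<in> {a<..<b} - y ` {..<m - 1} \<Longrightarrow>
      sign_pattern y {..<m - 1} t * comb c t \<ge> 0"
    using weak_sign_pattern_nat[of "m - 1" y, OF _ y] J(2)
    by (metis Suc_diff_1 less_nat_zero_code neq0_conv)
  have "sign_pattern x J t * comb c t \<ge> 0" if t: "t \<in> {a<..<b} - x ` J" for t
  proof -
    have split: "{..<m - 1} = {..<card J} \<union> {card J..<m - 1}" using J by auto
    have "sign_pattern y {..<m - 1} t = sign_pattern y {..<card J} t * sign_pattern y {card J..<m - 1} t"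
      unfolding split by (rule sign_pattern_Un) auto
    also have "sign_pattern y {card J..<m - 1} t = 1"
      by (rule sign_pattern_all_greater) (use t in \<open>auto simp: y_def\<close>)
    also have "sign_pattern y {..<card J} t = (\<Prod>j<card J. if t < x (e j) then 1 else -1)"
      unfolding sign_pattern_def by (rule prod.cong) (use t in \<open>auto simp: y_def\<close>)
    also have "\<dots> = sign_pattern x J t"
      unfolding sign_pattern_def by (rule prod.reindex_bij_betw[OF e])
    finally have "sign_pattern y {..<m - 1} t = sign_pattern x J t" by simp
    moreover have "t \<notin> y ` {..<m - 1}"
      using t bij_betwE[OF e] by (auto simp: y_def max_def min_def split: if_splits)
    ultimately show ?thesis using c(2)[of t] t by auto
  qed
  then show ?thesis using c(1) by blast
qed

end

section \<open>Integration against sign patterns\<close>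

lemma sign_pattern_switch:
  assumes "finite A" "p \<in> A" "s < p" "p \<le> t" "\<And>q. q \<in> A \<Longrightarrow> q \<noteq> p \<Longrightarrow> q \<notin> {s<..t}"
  shows "set_pattern A t = - set_pattern A s"
proof -
  have A: "A = insert p (A - {p})" using assms by auto
  have "set_pattern (A - {p}) t = set_pattern (A - {p}) s"
    by (rule sign_pattern_eq) (use assms(3-5) in force)
  moreover have "set_pattern A u = (if u < p then 1 else -1) * set_pattern (A - {p}) u" for u
    by (subst A, subst sign_pattern_insert) (use assms in auto)
  ultimately show ?thesis using assms by simp
qed

locale charging_measure =
  fixes \<nu> :: "real measure"
  assumes fin: "finite_measure \<nu>" and pos: "positive_measure_on_I \<nu>" and na: "non_atomic \<nu>"
begin

sublocale finite_measure \<nu> by (rule fin)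

lemma space_eq [simp]: "space \<nu> = {-1..1}"
  using pos by (simp add: positive_measure_on_I_def)

lemma borel_subset_sets: "A \<in> sets borel \<Longrightarrow> A \<subseteq> {-1..1} \<Longrightarrow> A \<in> sets \<nu>"
  using pos unfolding positive_measure_on_I_def sets_restrict_space
  by (metis image_subset_iff inf.absorb2)

lemma measurable_borel: "f \<in> borel_measurable borel \<Longrightarrow> f \<in> borel_measurable \<nu>" for f :: "real \<Rightarrow> real"
proof (rule measurableI)
  fix A :: "real set" assume f: "f \<in> borel_measurable borel" and A: "A \<in> sets borel"
  have "f -` A \<in> sets borel" using measurable_sets[OF f A] by simp
  then show "f -` A \<inter> space \<nu> \<in> sets \<nu>" by (intro borel_subset_sets) auto
qed simp

lemma measurable_continuous:
  fixes f :: "real \<Rightarrow> real"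
  assumes "finite F" "continuous_on ({-1..1} - F) f"
  shows "f \<in> borel_measurable \<nu>"
proof (rule measurableI)
  fix A :: "real set" assume A: "A \<in> sets borel"
  have "F \<in> sets borel" by (intro borel_closed finite_imp_closed assms)
  then have B: "{-1..1} - F \<in> sets borel" by auto
  have "f \<in> borel_measurable (restrict_space borel ({-1..1} - F))"
    by (rule borel_measurable_continuous_on_restrict[OF assms(2)])
  from measurable_sets[OF this A] have "f -` A \<inter> ({-1..1} - F) \<in> sets borel"
    using B by (auto simp: sets_restrict_space_iff space_restrict_space)
  moreover have "f -` A \<inter> (F \<inter> {-1..1}) \<in> sets borel"
    using assms(1) by (intro borel_closed finite_imp_closed) auto
  ultimately have "(f -` A \<inter> ({-1..1} - F)) \<union> (f -` A \<inter> (F \<inter> {-1..1})) \<in> sets \<nu>"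
    by (intro borel_subset_sets sets.Un) auto
  also have "(f -` A \<inter> ({-1..1} - F)) \<union> (f -` A \<inter> (F \<inter> {-1..1})) = f -` A \<inter> space \<nu>" by auto
  finally show "f -` A \<inter> space \<nu> \<in> sets \<nu>" .
qed simp

lemma point_null: "emeasure \<nu> {x} = 0"
proof (rule ccontr)
  assume ne: "emeasure \<nu> {x} \<noteq> 0"
  then have "{x} \<in> sets \<nu>" using emeasure_notin_sets by blast
  then obtain B where "B \<in> sets \<nu>" "B \<subseteq> {x}" "0 < emeasure \<nu> B" "emeasure \<nu> B < emeasure \<nu> {x}"
    using na ne unfolding non_atomic_def by (metis gr_zeroI)
  then show False by (metis emeasure_empty less_irrefl subset_singletonD)
qed

lemma AE_not_finite: "finite F \<Longrightarrow> AE t in \<nu>. t \<notin> F"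
proof (induction F rule: finite_induct)
  case (insert x F)
  have "AE t in \<nu>. t \<noteq> x"
  proof (cases "x \<in> {-1..1}")
    case True
    then have "{x} \<in> null_sets \<nu>"
      using borel_subset_sets[of "{x}"] point_null by (intro null_setsI) auto
    from AE_not_in[OF this] show ?thesis by simp
  next
    case False
    then show ?thesis by (intro AE_I2) auto
  qed
  with insert show ?case by auto
qed simp

lemma AE_open_exists:
  assumes "open U" "U \<inter> {-1..1} \<noteq> {}" "AE t in \<nu>. t \<in> U \<longrightarrow> P t"
  shows "\<exists>t\<in>U \<inter> {-1..1}. P t"
proof (rule ccontr)
  assume "\<not> ?thesis"
  then have *: "\<not> P t" if "t \<in> U" "t \<in> {-1..1}" for t using that by blast
  have "AE t in \<nu>. t \<notin> U \<inter> {-1..1}"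
    using assms(3) by (rule AE_mp) (use * in \<open>auto intro!: AE_I2\<close>)
  moreover have "U \<inter> {-1..1} \<in> sets \<nu>" using assms(1) by (intro borel_subset_sets) auto
  ultimately have "emeasure \<nu> (U \<inter> {-1..1}) = 0"
    by (subst (asm) AE_iff_measurable[of "U \<inter> {-1..1}"]) auto
  then show False using pos assms(1,2) unfolding positive_measure_on_I_def by auto
qed

lemma AE_interval_exists:
  assumes "-1 \<le> p" "p < q" "q \<le> 1" "AE t in \<nu>. t \<in> {p<..<q} \<longrightarrow> P t"
  shows "\<exists>t\<in>{p<..<q}. P t"
proof -
  have "(p + q) / 2 \<in> {p<..<q} \<inter> {-1..1}" using assms by auto
  then have "{p<..<q} \<inter> {-1..1} \<noteq> {}" by blast
  then show ?thesis using AE_open_exists[of "{p<..<q}" P] assms by auto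
qed

lemma integrable_bounded:
  fixes f :: "real \<Rightarrow> real"
  assumes "f \<in> borel_measurable \<nu>" "finite F" "\<And>t. t \<in> {-1..1} - F \<Longrightarrow> \<bar>f t\<bar> \<le> B"
  shows "integrable \<nu> f"
proof (rule integrable_const_bound)
  show "AE t in \<nu>. norm (f t) \<le> B"
    using AE_not_finite[OF assms(2)] AE_space by eventually_elim (use assms(3) in auto)
qed (rule assms)

text \<open>
  A jump cannot be hidden on a null set, because every interval next to it has positive measure.
\<close>

lemma set_pattern_points:
  assumes ab: "-1 \<le> a" "b \<le> 1" and A: "finite A" "A \<subseteq> {a<..<b}" and J: "finite J"
    and eq: "AE t in \<nu>. t \<in> {a<..<b} \<longrightarrow> set_pattern A t = \<epsilon> * sign_pattern x J t"
  shows "A \<subseteq> x ` J"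
proof
  fix p assume p: "p \<in> A"
  define B where "B = x ` J"
  have B: "finite B" using J by (simp add: B_def)
  show "p \<in> x ` J"
  proof (rule ccontr)
    assume "p \<notin> x ` J"
    then have pB: "p \<notin> B" by (simp add: B_def)
    have "open ({a<..<b} - (A \<union> B - {p}))"
      using A B by (intro open_Diff finite_imp_closed) auto
    moreover have "p \<in> {a<..<b} - (A \<union> B - {p})" using p A by auto
    ultimately obtain r where r: "r > 0" "cball p r \<subseteq> {a<..<b} - (A \<union> B - {p})"
      using open_contains_cball by blast
    have rin: "t \<in> {a<..<b} - (A \<union> B - {p})" if "\<bar>t - p\<bar> \<le> r" for t
      using r that by (auto simp: cball_def dist_real_def abs_minus_commute)
    have ends: "a < p - r" "p + r < b" using rin[of "p - r"] rin[of "p + r"] r by auto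
    have "AE t in \<nu>. t \<in> {p - r<..<p} \<longrightarrow> set_pattern A t = \<epsilon> * sign_pattern x J t"
      using eq by eventually_elim (use ends r in auto)
    then obtain s where s: "s \<in> {p - r<..<p}" "set_pattern A s = \<epsilon> * sign_pattern x J s"
      using AE_interval_exists[of "p - r" p "\<lambda>t. set_pattern A t = \<epsilon> * sign_pattern x J t"]
        ends ab r by auto
    have "AE t in \<nu>. t \<in> {p<..<p + r} \<longrightarrow> set_pattern A t = \<epsilon> * sign_pattern x J t"
      using eq by eventually_elim (use ends r in auto)
    then obtain t where t: "t \<in> {p<..<p + r}" "set_pattern A t = \<epsilon> * sign_pattern x J t"
      using AE_interval_exists[of p "p + r" "\<lambda>t. set_pattern A t = \<epsilon> * sign_pattern x J t"]
        ends ab r by auto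
    have "set_pattern A t = - set_pattern A s"
    proof (rule sign_pattern_switch[OF A(1) p])
      fix q assume "q \<in> A" "q \<noteq> p"
      then have "\<not> \<bar>q - p\<bar> \<le> r" using rin[of q] by auto
      then show "q \<notin> {s<..t}" using s t by auto
    qed (use s t in auto)
    moreover have "sign_pattern x J t = sign_pattern x J s"
    proof (rule sign_pattern_eq)
      fix j assume "j \<in> J"
      then have q: "x j \<in> B" by (simp add: B_def)
      then have "x j \<noteq> p" using pB by auto
      then have "\<not> \<bar>x j - p\<bar> \<le> r" using rin[of "x j"] q by auto
      then show "(t < x j) = (s < x j)" using s t by auto
    qed
    ultimately have "set_pattern A s = 0" using s t by simp
    then show False by simp
  qed
qed

end

locale charged_haar = charging_measure \<nu> + haar_system \<phi> m a b
  for \<nu> \<phi> m a b +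
  assumes inside: "-1 \<le> a" "b \<le> 1"
begin

lemma lincomb_bounded: "\<exists>B. \<forall>t\<in>{a..b}. \<bar>comb c t\<bar> \<le> B"
proof -
  have "bounded (comb c ` {a..b})"
    by (intro compact_imp_bounded compact_continuous_image continuous_lincomb) auto
  then show ?thesis by (auto simp: bounded_iff)
qed

lemma measurable_on_segment:
  fixes g :: "real \<Rightarrow> real"
  assumes "continuous_on {a..b} g"
  shows "(\<lambda>t. indicator {a<..<b} t * g t) \<in> borel_measurable borel"
proof -
  have "(\<lambda>t. indicator {a<..<b} t *\<^sub>R g t) \<in> borel_measurable borel"
    by (rule borel_measurable_continuous_on_indicator)
      (auto intro: continuous_on_subset[OF assms])
  then show ?thesis by simp
qed

lemma integrable_on_segment:
  fixes g \<rho> :: "real \<Rightarrow> real"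
  assumes "continuous_on {a..b} g" "\<rho> \<in> borel_measurable borel" "\<And>t. \<bar>\<rho> t\<bar> \<le> M"
  shows "integrable \<nu> (\<lambda>t. indicator {a<..<b} t * (\<rho> t * g t))"
proof -
  have "bounded (g ` {a..b})"
    by (intro compact_imp_bounded compact_continuous_image assms) auto
  then obtain B where B: "\<And>t. t \<in> {a..b} \<Longrightarrow> \<bar>g t\<bar> \<le> B"
    unfolding bounded_iff real_norm_def by blast
  have M: "M \<ge> 0" using assms(3)[of 0] by linarith
  have "(\<lambda>t. \<rho> t * (indicator {a<..<b} t * g t)) \<in> borel_measurable borel"
    by (intro borel_measurable_times assms measurable_on_segment)
  then have m: "(\<lambda>t. indicator {a<..<b} t * (\<rho> t * g t)) \<in> borel_measurable borel"
    by (simp add: mult_ac)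
  have bd: "\<bar>indicator {a<..<b} t * (\<rho> t * g t)\<bar> \<le> M * B" for t
  proof (cases "t \<in> {a<..<b}")
    case True
    then show ?thesis using mult_mono[OF assms(3)[of t] B[of t]] M by (auto simp: abs_mult)
  next
    case False
    have "B \<ge> 0" using B[of a] ab by auto
    then show ?thesis using False M by (auto simp: indicator_def)
  qed
  show ?thesis
    by (rule integrable_bounded[of _ "{}"]) (use measurable_borel[OF m] bd in auto)
qed

text \<open>
  The tool that turns sign patterns into contradictions: orthogonality to a single nonzero combination
  of matching sign already forces the weight to vanish.
\<close>

lemma orthogonal_one_signed:
  assumes c: "\<exists>i<m. c i \<noteq> 0" and \<rho>: "\<rho> \<in> borel_measurable borel" "\<And>t. \<bar>\<rho> t\<bar> \<le> M"
    and F: "finite F" "\<And>t. t \<in> {a<..<b} - F \<Longrightarrow> \<rho> t * comb c t \<ge> 0"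
    and zero: "(LINT t|\<nu>. indicator {a<..<b} t * (\<rho> t * comb c t)) = 0"
  shows "AE t in \<nu>. t \<in> {a<..<b} \<longrightarrow> \<rho> t = 0"
proof -
  let ?g = "\<lambda>t. indicator {a<..<b} t * (\<rho> t * comb c t)"
  let ?Z = "{t \<in> {a<..<b}. comb c t = 0}"
  have "AE t in \<nu>. 0 \<le> ?g t"
    using AE_not_finite[OF F(1)] by eventually_elim (use F(2) in \<open>auto simp: indicator_def\<close>)
  then have "AE t in \<nu>. ?g t = 0"
    using zero integral_nonneg_eq_0_iff_AE[OF integrable_on_segment[OF continuous_lincomb \<rho>]] by simp
  moreover have "finite ?Z" using haar c by auto
  from AE_not_finite[OF this] have "AE t in \<nu>. t \<notin> ?Z" .
  ultimately show ?thesis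
    by eventually_elim (auto simp: indicator_def)
qed

end

section \<open>Patterns with vanishing moments\<close>

lemma strict_mono_on_image_unique:
  fixes x y :: "nat \<Rightarrow> real"
  assumes x: "\<And>i j. i < j \<Longrightarrow> j < m \<Longrightarrow> x i < x j" and y: "\<And>i j. i < j \<Longrightarrow> j < m \<Longrightarrow> y i < y j"
    and eq: "x ` {..<m} = y ` {..<m}" and i: "i < m"
  shows "x i = y i"
proof -
  have *: "sorted (map z [0..<m]) \<and> distinct (map z [0..<m])"
    if "\<And>i j. i < j \<Longrightarrow> j < m \<Longrightarrow> z i < z j" for z :: "nat \<Rightarrow> real"
    using that by (force simp: sorted_iff_nth_mono_less distinct_conv_nth nat_neq_iff less_imp_le)
  have "map x [0..<m] = map y [0..<m]"
    using sorted_distinct_set_unique[of "map x [0..<m]" "map y [0..<m]"] *[of x, OF x] *[of y, OF y] eq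
    by (simp add: atLeast0LessThan)
  then show ?thesis using i by simp
qed

context charged_haar
begin

text \<open>
  The value 0 beyond m makes this a map into the coordinate model of m-dimensional space
  to which invariance of domain applies.
\<close>

definition moments :: "(nat \<Rightarrow> real) \<Rightarrow> nat \<Rightarrow> real" where
  "moments x i = (if i < m
     then LINT t|\<nu>. indicator {a<..<b} t * (sign_pattern x {..<m} t * \<phi> i t) else 0)"

definition open_simplex :: "(nat \<Rightarrow> real) set" where
  "open_simplex = {x. (\<forall>i\<ge>m. x i = 0) \<and> (\<forall>i<m. a < x i \<and> x i < b) \<and> (\<forall>j<m. \<forall>i<j. x i < x j)}"

definition closed_simplex :: "(nat \<Rightarrow> real) set" where
  "closed_simplex = {x. (\<forall>i\<ge>m. x i = 0) \<and> (\<forall>i<m. a \<le> x i \<and> x i \<le> b) \<and> (\<forall>j<m. \<forall>i<j. x i \<le> x j)}"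

lemma moments_lincomb:
  "(\<Sum>i<m. c i * moments x i) =
    (LINT t|\<nu>. indicator {a<..<b} t * (sign_pattern x {..<m} t * comb c t))"
proof -
  have "(\<Sum>i<m. c i * moments x i) =
      (\<Sum>i<m. LINT t|\<nu>. c i * (indicator {a<..<b} t * (sign_pattern x {..<m} t * \<phi> i t)))"
    by (rule sum.cong) (auto simp: moments_def)
  also have "\<dots> = (LINT t|\<nu>. (\<Sum>i<m. c i * (indicator {a<..<b} t * (sign_pattern x {..<m} t * \<phi> i t))))"
    by (rule Bochner_Integration.integral_sum[symmetric], rule integrable_mult_right)
      (intro integrable_on_segment[where M = 1] cont sign_pattern_borel; simp)
  also have "\<dots> = (LINT t|\<nu>. indicator {a<..<b} t * (sign_pattern x {..<m} t * comb c t))"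
    by (rule Bochner_Integration.integral_cong)
      (auto simp: lincomb_def sum_distrib_left mult_ac)
  finally show ?thesis .
qed

text \<open>
  The pattern converges pointwise off the finitely many limiting jumps, which are a null set; this is
  where non-atomicity enters.
\<close>

lemma continuous_on_moments: "continuous_on UNIV moments"
proof (rule continuous_on_coordinatewise_then_product)
  fix i
  show "continuous_on UNIV (\<lambda>x. moments x i)"
  proof (cases "i < m")
    case True
    show ?thesis
    proof (rule continuous_on_sequentiallyI)
      fix u :: "nat \<Rightarrow> nat \<Rightarrow> real" and x assume u: "u \<longlonglongrightarrow> x"
      let ?f = "\<lambda>x t. indicator {a<..<b} t * (sign_pattern x {..<m} t * \<phi> i t)"
      have int: "integrable \<nu> (?f x)" for x
        by (intro integrable_on_segment[where M = 1] cont sign_pattern_borel) (simp_all add: True)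
      have "(\<lambda>n. LINT t|\<nu>. ?f (u n) t) \<longlonglongrightarrow> (LINT t|\<nu>. ?f x t)"
      proof (rule integral_dominated_convergence)
        show "integrable \<nu> (\<lambda>t. \<bar>?f x t\<bar>)" by (intro integrable_abs int)
        have "finite (x ` {..<m})" by simp
        from AE_not_finite[OF this] show "AE t in \<nu>. (\<lambda>n. ?f (u n) t) \<longlonglongrightarrow> ?f x t"
        proof eventually_elim
          case (elim t)
          have "\<forall>\<^sub>F n in sequentially. t \<notin> u n ` {..<m} \<and>
              sign_pattern (u n) {..<m} t = sign_pattern x {..<m} t"
            by (rule sign_pattern_eventually[OF tendsto_coordinate[OF u] elim])
          then have "\<forall>\<^sub>F n in sequentially. ?f (u n) t = ?f x t" by (rule eventually_mono) simp
          then show ?case by (rule tendsto_eventually)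
        qed
        show "AE t in \<nu>. norm (?f (u n) t) \<le> \<bar>?f x t\<bar>" for n
          by (intro AE_I2) (simp add: abs_mult)
      qed (use int in \<open>auto intro: borel_measurable_integrable\<close>)
      then show "(\<lambda>n. moments (u n) i) \<longlonglongrightarrow> moments x i" using True by (simp add: moments_def)
    qed
  qed (simp add: moments_def)
qed

lemma compact_closed_simplex: "compact closed_simplex"
proof -
  let ?box = "{x :: nat \<Rightarrow> real. \<forall>i. \<bar>x i\<bar> \<le> (if i < m then \<bar>a\<bar> + \<bar>b\<bar> else 0)}"
  have c: "closed {x :: nat \<Rightarrow> real. x i \<le> x j}" "closed {x :: nat \<Rightarrow> real. l \<le> x i}"
    "closed {x :: nat \<Rightarrow> real. x i \<le> l}" for i j l
    by (intro closed_Collect_le continuous_intros continuous_on_product_coordinates)+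
  have "closed ((\<Inter>i<m. {x. a \<le> x i} \<inter> {x. x i \<le> b}) \<inter> (\<Inter>j<m. \<Inter>i<j. {x :: nat \<Rightarrow> real. x i \<le> x j}))"
    by (intro closed_Int closed_INT ballI c)
  then have "compact (?box \<inter> ((\<Inter>i<m. {x. a \<le> x i} \<inter> {x. x i \<le> b}) \<inter> (\<Inter>j<m. \<Inter>i<j. {x. x i \<le> x j})))"
    by (intro compact_Int_closed compact_coordinate_box)
  also have "?box \<inter> ((\<Inter>i<m. {x. a \<le> x i} \<inter> {x. x i \<le> b}) \<inter> (\<Inter>j<m. \<Inter>i<j. {x. x i \<le> x j})) = closed_simplex"
  proof -
    have "\<bar>x i\<bar> \<le> (if i < m then \<bar>a\<bar> + \<bar>b\<bar> else 0)"
      if "\<forall>i\<ge>m. x i = 0" "\<forall>i<m. a \<le> x i \<and> x i \<le> b" for x :: "nat \<Rightarrow> real" and i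
    proof (cases "i < m")
      case True
      then have "a \<le> x i" "x i \<le> b" using that by auto
      then show ?thesis using True by auto
    qed (use that in auto)
    then show ?thesis by (auto simp: closed_simplex_def split: if_splits)
  qed
  finally show ?thesis .
qed

lemma openin_open_simplex: "openin (Euclidean_space m) open_simplex"
proof -
  have o: "open {x :: nat \<Rightarrow> real. x i < x j}" "open {x :: nat \<Rightarrow> real. l < x i}"
    "open {x :: nat \<Rightarrow> real. x i < l}" for i j l
    by (intro open_Collect_less continuous_intros continuous_on_product_coordinates)+
  have "open ((\<Inter>i<m. {x. a < x i} \<inter> {x. x i < b}) \<inter> (\<Inter>j<m. \<Inter>i<j. {x :: nat \<Rightarrow> real. x i < x j}))"
    by (intro open_Int open_INT ballI o finite_lessThan)
  then have "openin (Euclidean_space m) ({x. \<forall>i\<ge>m. x i = 0} \<inter>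
     ((\<Inter>i<m. {x. a < x i} \<inter> {x. x i < b}) \<inter> (\<Inter>j<m. \<Inter>i<j. {x. x i < x j})))"
    by (simp only: Euclidean_space_def euclidean_product_topology openin_open_Int)
  also have "{x. \<forall>i\<ge>m. x i = 0} \<inter>
     ((\<Inter>i<m. {x. a < x i} \<inter> {x. x i < b}) \<inter> (\<Inter>j<m. \<Inter>i<j. {x. x i < x j})) = open_simplex"
    by (auto simp: open_simplex_def)
  finally show ?thesis .
qed

lemma open_simplex_inj_on: "x \<in> open_simplex \<Longrightarrow> inj_on x {..<m}"
proof (rule inj_onI, rule ccontr)
  fix i j assume x: "x \<in> open_simplex" and ij: "i \<in> {..<m}" "j \<in> {..<m}" "x i = x j" "i \<noteq> j"
  have mono: "x k < x l" if "k < l" "l < m" for k l using x that by (simp add: open_simplex_def)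
  show False using mono[of i j] mono[of j i] ij by (cases "i < j") auto
qed

text \<open>
  The common core of injectivity and of the boundary estimate. If the moments of x are s times those
  of y, the difference of the patterns is orthogonal to the space; if in addition it has the sign of
  some nonzero combination, it vanishes.
\<close>

lemma proportional_moments:
  assumes eq: "moments x = (\<lambda>i. s * moments y i)" and s: "0 \<le> s" "s \<le> 1"
    and c: "\<exists>i<m. c i \<noteq> 0" and F: "finite F"
    and sign: "\<And>t. t \<in> {a<..<b} - F \<Longrightarrow>
      (sign_pattern x {..<m} t - s * sign_pattern y {..<m} t) * comb c t \<ge> 0"
  shows "AE t in \<nu>. t \<in> {a<..<b} \<longrightarrow> sign_pattern x {..<m} t = s * sign_pattern y {..<m} t"
proof -
  define \<rho> where "\<rho> = (\<lambda>t. sign_pattern x {..<m} t - s * sign_pattern y {..<m} t)"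
  have "AE t in \<nu>. t \<in> {a<..<b} \<longrightarrow> \<rho> t = 0"
  proof (rule orthogonal_one_signed[OF c _ _ F])
    show "\<rho> \<in> borel_measurable borel"
      unfolding \<rho>_def by (intro borel_measurable_diff borel_measurable_times borel_measurable_const sign_pattern_borel)
    show "\<bar>\<rho> t\<bar> \<le> 2" for t
      using abs_triangle_ineq4[of "sign_pattern x {..<m} t" "s * sign_pattern y {..<m} t"] s
      by (simp add: \<rho>_def abs_mult)
    have int: "integrable \<nu> (\<lambda>t. indicator {a<..<b} t * (sign_pattern z {..<m} t * comb c t))" for z
      by (intro integrable_on_segment[where M = 1] continuous_lincomb sign_pattern_borel) simp
    have "(LINT t|\<nu>. indicator {a<..<b} t * (\<rho> t * comb c t)) =
        (LINT t|\<nu>. indicator {a<..<b} t * (sign_pattern x {..<m} t * comb c t)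
          - s * (indicator {a<..<b} t * (sign_pattern y {..<m} t * comb c t)))"
      by (rule Bochner_Integration.integral_cong) (auto simp: \<rho>_def algebra_simps)
    also have "\<dots> = (\<Sum>i<m. c i * moments x i) - s * (\<Sum>i<m. c i * moments y i)"
      unfolding moments_lincomb
      by (subst Bochner_Integration.integral_diff[OF int integrable_mult_right[OF int]]) simp
    also have "\<dots> = 0" by (simp add: eq sum_distrib_left mult_ac)
    finally show "(LINT t|\<nu>. indicator {a<..<b} t * (\<rho> t * comb c t)) = 0" .
  qed (use sign in \<open>auto simp: \<rho>_def\<close>)
  then show ?thesis by eventually_elim (simp add: \<rho>_def)
qed

text \<open>
  To the left of \<open>x 0\<close> the two patterns agree; to the right of it the pattern of y minus that
  of x has, wherever it is nonzero, the sign of the pattern of x without its first jump. The latter has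
  m - 1 jumps and is weakly matched by a combination.
\<close>

lemma moments_inj_of_le:
  assumes x: "x \<in> open_simplex" and y: "y \<in> open_simplex" and eq: "moments x = moments y"
    and m: "m > 0" and le: "x 0 \<le> y 0"
  shows "x = y"
proof -
  define J where "J = {1..<m}"
  have mJ: "{..<m} = insert 0 J" "0 \<notin> J" "finite J" using m by (auto simp: J_def)
  obtain c where c: "\<exists>i<m. c i \<noteq> 0"
    "\<And>t. t \<in> {a<..<b} - x ` J \<Longrightarrow> sign_pattern x J t * comb c t \<ge> 0"
  proof -
    have "card J < m" using m by (simp add: J_def)
    from weak_sign_pattern[OF mJ(3) this, of x] show thesis using that by blast
  qed
  have "AE t in \<nu>. t \<in> {a<..<b} \<longrightarrow> sign_pattern y {..<m} t = 1 * sign_pattern x {..<m} t"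
  proof (rule proportional_moments[OF _ _ _ c(1)])
    show "finite (x ` J)" using mJ by simp
    show "0 \<le> (sign_pattern y {..<m} t - 1 * sign_pattern x {..<m} t) * comb c t"
      if t: "t \<in> {a<..<b} - x ` J" for t
    proof (cases "t < x 0")
      case True
      have "x 0 \<le> x j \<and> y 0 \<le> y j" if "j < m" for j
        using x y that by (cases "j = 0") (auto simp: open_simplex_def less_imp_le)
      then have tl: "t < x j \<and> t < y j" if "j < m" for j using that True le by force
      have "sign_pattern x {..<m} t = 1" "sign_pattern y {..<m} t = 1"
        by (rule sign_pattern_all_greater, use tl in auto)+
      then show ?thesis by simp
    next
      case False
      then have "sign_pattern x {..<m} t = - sign_pattern x J t"
        unfolding mJ(1) using mJ by (simp add: sign_pattern_insert)
      then show ?thesis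
        using c(2)[OF t] sign_pattern_cases[of x J t] sign_pattern_cases[of y "{..<m}" t] by auto
    qed
  qed (use eq in auto)
  then have AE: "AE t in \<nu>. t \<in> {a<..<b} \<longrightarrow> set_pattern (y ` {..<m}) t = 1 * sign_pattern x {..<m} t"
    and AE': "AE t in \<nu>. t \<in> {a<..<b} \<longrightarrow> set_pattern (x ` {..<m}) t = 1 * sign_pattern y {..<m} t"
    unfolding sign_pattern_image[OF open_simplex_inj_on[OF x]] sign_pattern_image[OF open_simplex_inj_on[OF y]]
    by (eventually_elim, simp)+
  have sub: "z ` {..<m} \<subseteq> {a<..<b}" if "z \<in> open_simplex" for z
    using that by (auto simp: open_simplex_def)
  have "y ` {..<m} \<subseteq> x ` {..<m}"
    by (rule set_pattern_points[OF inside _ sub[OF y] _ AE]) auto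
  moreover have "x ` {..<m} \<subseteq> y ` {..<m}"
    by (rule set_pattern_points[OF inside _ sub[OF x] _ AE']) auto
  ultimately have im: "x ` {..<m} = y ` {..<m}" by simp
  show ?thesis
  proof
    fix i
    show "x i = y i"
    proof (cases "i < m")
      case True
      show ?thesis
        by (rule strict_mono_on_image_unique[OF _ _ im True])
          (use x y in \<open>auto simp: open_simplex_def\<close>)
    qed (use x y in \<open>auto simp: open_simplex_def\<close>)
  qed
qed

lemma inj_on_moments: "inj_on moments open_simplex"
proof (rule inj_onI)
  fix x y assume xy: "x \<in> open_simplex" "y \<in> open_simplex" "moments x = moments y"
  show "x = y"
  proof (cases "m = 0")
    case True
    then have "\<forall>i. x i = 0" "\<forall>i. y i = 0" using xy(1,2) unfolding open_simplex_def by auto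
    then show ?thesis by auto
  next
    case False
    then show ?thesis
      using moments_inj_of_le[OF xy] moments_inj_of_le[OF xy(2,1) xy(3)[symmetric]] by force
  qed
qed

text \<open>
  On the boundary two points coincide and cancel, or a point sits at an end and changes at most the
  global sign.
\<close>

lemma boundary_pattern:
  assumes x: "x \<in> closed_simplex - open_simplex"
  shows "\<exists>J\<subseteq>{..<m}. \<exists>\<eta>\<in>{1, -1}. card J < m \<and>
    (\<forall>t\<in>{a<..<b}. sign_pattern x {..<m} t = \<eta> * sign_pattern x J t)"
proof -
  consider j where "j < m" "x j = a \<or> x j = b" | i j where "i < j" "j < m" "x i = x j"
  proof -
    have c: "\<forall>i\<ge>m. x i = 0" "\<And>i. i < m \<Longrightarrow> a \<le> x i \<and> x i \<le> b"
      "\<And>i j. j < m \<Longrightarrow> i < j \<Longrightarrow> x i \<le> x j"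
      using x by (simp_all add: closed_simplex_def)
    have "\<not> ((\<forall>i<m. a < x i \<and> x i < b) \<and> (\<forall>j<m. \<forall>i<j. x i < x j))"
      using x c(1) by (simp add: open_simplex_def)
    then consider i where "i < m" "\<not> (a < x i \<and> x i < b)" | i j where "j < m" "i < j" "\<not> x i < x j"
      by blast
    then show thesis
    proof cases
      case 1
      then show thesis using c(2)[of i] that(1)[of i] by linarith
    next
      case 2
      then show thesis using c(3)[of j i] that(2)[of i j] by linarith
    qed
  qed
  then show ?thesis
  proof cases
    case 1
    define J where "J = {..<m} - {j}"
    have J: "{..<m} = insert j J" "j \<notin> J" "finite J" using 1 by (auto simp: J_def)
    have "card {..<m} = Suc (card J)" unfolding J(1) using J(2,3) by simp
    then have "card J < m" by simp
    moreover have "sign_pattern x {..<m} t = (if x j = a then -1 else 1) * sign_pattern x J t"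
      if "t \<in> {a<..<b}" for t
      unfolding J(1) using J that 1 ab by (auto simp: sign_pattern_insert)
    ultimately show ?thesis
      by (intro exI[of _ J] conjI bexI[of _ "if x j = a then -1 else 1"]) (auto simp: J_def)
  next
    case 2
    define J where "J = {..<m} - {i, j}"
    have J: "{..<m} = insert i (insert j J)" "j \<notin> J" "i \<notin> insert j J" "finite J"
      using 2 by (auto simp: J_def)
    have "card {..<m} = Suc (Suc (card J))" unfolding J(1) using J(2-4) by simp
    then have "card J < m" by simp
    moreover have "sign_pattern x {..<m} t = sign_pattern x J t" for t
      unfolding J(1) using J 2 by (auto simp: sign_pattern_insert)
    ultimately show ?thesis by (intro exI[of _ J] conjI bexI[of _ 1]) (auto simp: J_def)
  qed
qed

text \<open>
  A pattern with fewer than m jumps is weakly the sign of a combination, so it maximises the corresponding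
  linear functional among all functions bounded by 1. A pattern attaining the same value, even after
  scaling by a factor in [0,1], would agree with it almost everywhere, but m distinct interior jumps do
  not fit among fewer than m points.
\<close>

lemma boundary_moments:
  assumes x: "x \<in> closed_simplex - open_simplex" and y: "y \<in> open_simplex" and s: "0 \<le> s" "s \<le> 1"
  shows "moments x \<noteq> (\<lambda>i. s * moments y i)"
proof
  assume eq: "moments x = (\<lambda>i. s * moments y i)"
  obtain J \<eta> where J: "J \<subseteq> {..<m}" "\<eta> \<in> {1, -1}" "card J < m"
    "\<And>t. t \<in> {a<..<b} \<Longrightarrow> sign_pattern x {..<m} t = \<eta> * sign_pattern x J t"
    using boundary_pattern[OF x] by metis
  have finJ: "finite J" using J finite_subset by auto
  obtain c where c: "\<exists>i<m. c i \<noteq> 0"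
    "\<And>t. t \<in> {a<..<b} - x ` J \<Longrightarrow> sign_pattern x J t * comb c t \<ge> 0"
    using weak_sign_pattern[OF finJ J(3), of x] by blast
  define d where "d = (\<lambda>i. \<eta> * c i)"
  have d: "\<exists>i<m. d i \<noteq> 0" using c J by (auto simp: d_def)
  have ld: "sign_pattern x {..<m} t * comb d t \<ge> 0" if "t \<in> {a<..<b} - x ` J" for t
    using c(2)[OF that] J(2) J(4)[of t] that unfolding d_def lincomb_scale by auto
  have "AE t in \<nu>. t \<in> {a<..<b} \<longrightarrow> sign_pattern x {..<m} t = s * sign_pattern y {..<m} t"
  proof (rule proportional_moments[OF eq s d])
    show "finite (x ` J)" using finJ by simp
    fix t assume t: "t \<in> {a<..<b} - x ` J"
    have sy: "s * sign_pattern y {..<m} t \<le> 1" "-1 \<le> s * sign_pattern y {..<m} t"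
      using s sign_pattern_cases[of y "{..<m}" t] by auto
    show "0 \<le> (sign_pattern x {..<m} t - s * sign_pattern y {..<m} t) * comb d t"
    proof (cases "sign_pattern x {..<m} t = 1")
      case True
      then have "comb d t \<ge> 0" using ld[OF t] by simp
      then show ?thesis using True sy by simp
    next
      case False
      then have sx: "sign_pattern x {..<m} t = -1" using sign_pattern_cases by blast
      then have "comb d t \<le> 0" using ld[OF t] by simp
      then show ?thesis using sx sy by (simp add: mult_nonpos_nonpos)
    qed
  qed
  then have AE: "AE t in \<nu>. t \<in> {a<..<b} \<longrightarrow> set_pattern (y ` {..<m}) t = (s * \<eta>) * sign_pattern x J t"
  proof eventually_elim
    case (elim t)
    show ?case
    proof
      assume t: "t \<in> {a<..<b}"
      then have *: "sign_pattern x {..<m} t = s * sign_pattern y {..<m} t" using elim by auto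
      have "s = 1"
      proof -
        have "\<bar>sign_pattern x {..<m} t\<bar> = \<bar>s\<bar> * \<bar>sign_pattern y {..<m} t\<bar>" unfolding * by (simp add: abs_mult)
        then show ?thesis using s by simp
      qed
      then show "set_pattern (y ` {..<m}) t = (s * \<eta>) * sign_pattern x J t"
        using J(4)[OF t] * by (simp add: sign_pattern_image[OF open_simplex_inj_on[OF y]])
    qed
  qed
  have "y ` {..<m} \<subseteq> x ` J"
    by (rule set_pattern_points[OF inside _ _ finJ AE]) (use y in \<open>auto simp: open_simplex_def\<close>)
  then have "card (y ` {..<m}) \<le> card J"
    by (meson card_image_le card_mono finJ finite_imageI le_trans)
  then show False using J(3) open_simplex_inj_on[OF y] by (simp add: card_image)
qed

text \<open>
  The parameters s in [0,1] for which s times a fixed interior moment vector is an interior moment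
  vector form an open set by invariance of domain, and a closed set because the boundary of the compact
  simplex contributes nothing. As 1 is such a parameter, so is 0.
\<close>

lemma vanishing_moments:
  shows "\<exists>!x. x \<in> open_simplex \<and> moments x = (\<lambda>i. 0)"
proof -
  define E where "E = {x :: nat \<Rightarrow> real. \<forall>i\<ge>m. x i = 0}"
  have E: "Euclidean_space m = top_of_set E"
    by (simp add: E_def Euclidean_space_def euclidean_product_topology)
  define y where "y = (\<lambda>i. if i < m then a + (b - a) * (real (Suc i) / real (Suc m)) else 0)"
  have "y \<in> open_simplex"
  proof -
    have "real (Suc i) / real (Suc m) < 1" "0 < real (Suc i) / real (Suc m)" if "i < m" for i
      using that by auto
    then have "(b - a) * (real (Suc i) / real (Suc m)) < (b - a) * 1"
      "0 < (b - a) * (real (Suc i) / real (Suc m))" if "i < m" for i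
      using that ab by (intro mult_strict_left_mono, auto)
    then have "a < y i" "y i < b" if "i < m" for i using that by (fastforce simp: y_def)+
    moreover have "y i < y j" if "i < j" "j < m" for i j
      using that ab by (auto simp: y_def intro!: mult_strict_left_mono divide_strict_right_mono)
    ultimately show ?thesis by (auto simp: open_simplex_def y_def)
  qed
  note y = this
  have range: "moments x \<in> E" for x by (simp add: moments_def E_def)
  have op: "openin (top_of_set E) (moments ` open_simplex)"
    unfolding E[symmetric]
  proof (rule invariance_of_domain_Euclidean_space[OF openin_open_simplex _ inj_on_moments])
    show "continuous_map (subtopology (Euclidean_space m) open_simplex) (Euclidean_space m) moments"
      unfolding cm_Euclidean_space_iff_continuous_on
      using continuous_on_subset[OF continuous_on_moments] range
      by (auto simp: topspace_Euclidean_space E_def)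
  qed
  have cl: "closed (moments ` closed_simplex)"
    by (intro compact_imp_closed compact_continuous_image compact_closed_simplex
        continuous_on_subset[OF continuous_on_moments]) auto
  let ?p = "\<lambda>s i. s * moments y i"
  have cp: "continuous_on {0..1} ?p"
    by (intro continuous_on_coordinatewise_then_product continuous_intros)
  have pE: "?p \<in> {0..1} \<rightarrow> E" using range by (auto simp: E_def)
  have sub: "open_simplex \<subseteq> closed_simplex"
    by (auto simp: open_simplex_def closed_simplex_def less_imp_le)
  have same: "{0..1} \<inter> ?p -` (moments ` open_simplex) = {0..1} \<inter> ?p -` (moments ` closed_simplex)"
  proof (intro equalityI subsetI)
    fix s assume s: "s \<in> {0..1} \<inter> ?p -` (moments ` closed_simplex)"
    then obtain x where x: "x \<in> closed_simplex" "moments x = ?p s" by auto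
    then have "x \<in> open_simplex" using boundary_moments[OF _ y, of x s] s by auto
    then show "s \<in> {0..1} \<inter> ?p -` (moments ` open_simplex)" using x(2) s by (metis IntD1 IntI image_eqI vimageI)
  qed (use sub in blast)
  have "openin (top_of_set {0..1}) ({0..1} \<inter> ?p -` (moments ` open_simplex))"
    by (rule continuous_openin_preimage[OF cp pE op])
  moreover have "closedin (top_of_set {0..1}) ({0..1} \<inter> ?p -` (moments ` open_simplex))"
    unfolding same by (rule continuous_closedin_preimage[OF cp cl])
  ultimately have "{0..1} \<inter> ?p -` (moments ` open_simplex) = {} \<or>
      {0..1} \<inter> ?p -` (moments ` open_simplex) = {0..1::real}"
    using connected_clopen[of "{0..1::real}"] connected_Icc by blast
  moreover have "1 \<in> {0..1} \<inter> ?p -` (moments ` open_simplex)" using y by auto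
  ultimately have "0 \<in> {0..1} \<inter> ?p -` (moments ` open_simplex)" by (metis atLeastAtMost_iff empty_iff order_refl zero_le_one)
  then obtain x where "x \<in> open_simplex" "moments x = (\<lambda>i. 0)" by auto
  then show ?thesis using inj_on_moments by (metis inj_onD)
qed

end

section \<open>Bases of a Chebyshev space and odd parts\<close>

lemma sum_fun_apply: "(\<Sum>i\<in>I. f i) t = (\<Sum>i\<in>I. f i t)" for f :: "'i \<Rightarrow> 'a \<Rightarrow> 'b::comm_monoid_add"
  by (induction I rule: infinite_finite_induct) auto

lemma span_lincomb:
  assumes "bij_betw \<phi> {..<n} B"
  shows "fun_vs.span B = range (lincomb n \<phi>)"
proof -
  have B: "finite B" using assms bij_betw_finite by blast
  have e: "(\<Sum>v\<in>B. fun_scale (u v) v) = lincomb n \<phi> (\<lambda>i. u (\<phi> i))" for u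
  proof
    fix t
    have "(\<Sum>v\<in>B. fun_scale (u v) v) t = (\<Sum>v\<in>B. u v * v t)"
      by (simp add: sum_fun_apply fun_scale_def)
    also have "\<dots> = lincomb n \<phi> (\<lambda>i. u (\<phi> i)) t"
      unfolding lincomb_def by (rule sum.reindex_bij_betw[OF assms, symmetric])
    finally show "(\<Sum>v\<in>B. fun_scale (u v) v) t = lincomb n \<phi> (\<lambda>i. u (\<phi> i)) t" .
  qed
  have "lincomb n \<phi> c \<in> range (\<lambda>u. \<Sum>v\<in>B. fun_scale (u v) v)" for c
  proof -
    have "lincomb n \<phi> c = lincomb n \<phi> (\<lambda>i. c (the_inv_into {..<n} \<phi> (\<phi> i)))"
      using assms by (intro ext lincomb_cong) (auto simp: bij_betw_def the_inv_into_f_f)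
    also have "\<dots> = (\<Sum>v\<in>B. fun_scale (c (the_inv_into {..<n} \<phi> v)) v)" by (rule e[symmetric])
    finally have eq: "lincomb n \<phi> c = (\<Sum>v\<in>B. fun_scale (c (the_inv_into {..<n} \<phi> v)) v)" .
    show ?thesis
      by (rule image_eqI[where x = "\<lambda>v. c (the_inv_into {..<n} \<phi> v)"], rule eq) simp
  qed
  then show ?thesis unfolding fun_vs.span_finite[OF B] by (auto simp: e)
qed

lemma independent_lincomb:
  assumes "bij_betw \<phi> {..<n} B" "\<not> fun_vs.dependent B" "lincomb n \<phi> c = 0" "i < n"
  shows "c i = 0"
proof -
  let ?u = "\<lambda>v. c (the_inv_into {..<n} \<phi> v)"
  have B: "finite B" using assms(1) bij_betw_finite by blast
  have inj: "inj_on \<phi> {..<n}" "\<phi> ` {..<n} = B" using assms(1) by (auto simp: bij_betw_def)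
  have zero: "(\<Sum>v\<in>B. fun_scale (?u v) v) = 0"
  proof
    fix t
    have "(\<Sum>v\<in>B. fun_scale (?u v) v) t = (\<Sum>v\<in>B. ?u v * v t)"
      by (simp add: sum_fun_apply fun_scale_def)
    also have "\<dots> = (\<Sum>i<n. ?u (\<phi> i) * \<phi> i t)"
      by (rule sum.reindex_bij_betw[OF assms(1), symmetric])
    also have "\<dots> = lincomb n \<phi> c t"
      unfolding lincomb_def by (rule sum.cong) (use inj in \<open>auto simp: the_inv_into_f_f\<close>)
    finally show "(\<Sum>v\<in>B. fun_scale (?u v) v) t = 0 t" using assms(3) by simp
  qed
  have "?u v = 0" if "v \<in> B" for v
  proof (rule ccontr)
    assume "?u v \<noteq> 0"
    then have "fun_vs.dependent B"
      unfolding fun_vs.dependent_finite[OF B] using zero that by (intro exI[of _ ?u] conjI bexI[of _ v])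
    then show False using assms(2) by contradiction
  qed
  moreover have "\<phi> i \<in> B" using inj(2) assms(4) by blast
  ultimately have "?u (\<phi> i) = 0" by blast
  then show ?thesis using inj(1) assms(4) by (simp add: the_inv_into_f_f)
qed

text \<open>
  A basis of the subspace of even functions is extended to a basis of Y; the dimension hypothesis makes
  it exactly the first half.
\<close>

lemma chebyshev_basis:
  assumes "chebyshev_space (-1) 1 n Y" "n = 2 * m" "fun_vs.dim (Y \<inter> even_functions) = m"
  shows "\<exists>\<phi>. Y = range (lincomb n \<phi>) \<and> haar_system \<phi> n (-1) 1 \<and>
    (\<forall>i<m. \<forall>t\<in>{-1..1}. \<phi> i (- t) = \<phi> i t)"
proof -
  obtain B where B: "finite B" "card B = n" "\<not> fun_vs.dependent B" "fun_vs.span B = Y"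
    and Y: "Y \<subseteq> C0 (-1) 1"
    and zeros: "\<And>g. g \<in> Y \<Longrightarrow> g \<noteq> 0 \<Longrightarrow> finite (zeros_on {-1..1} g) \<and> card (zeros_on {-1..1} g) < n"
    using assms(1) unfolding chebyshev_space_def by blast
  obtain BE where BE: "BE \<subseteq> Y \<inter> even_functions" "\<not> fun_vs.dependent BE"
    "Y \<inter> even_functions \<subseteq> fun_vs.span BE" "card BE = fun_vs.dim (Y \<inter> even_functions)"
    using fun_vs.basis_exists by metis
  obtain B' where B': "BE \<subseteq> B'" "B' \<subseteq> Y" "\<not> fun_vs.dependent B'" "Y \<subseteq> fun_vs.span B'"
    using fun_vs.maximal_independent_subset_extend[of BE Y] BE(1,2) by blast
  have span: "fun_vs.span B' = Y"
    using B' B(4) fun_vs.span_minimal[OF B'(2)] fun_vs.subspace_span[of B] by blast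
  have "finite B'"
    using fun_vs.independent_span_bound[OF B(1) B'(3)] B'(2) B(4) by blast
  moreover have "card B' = n"
    using fun_vs.dim_eq_card[OF _ B'(3), of B'] fun_vs.dim_eq_card[OF _ B(3), of B'] span B
    by (metis fun_vs.span_span)
  ultimately have fB': "finite B'" "card B' = n" .
  have fBE: "finite BE" "card BE = m" using fB' B'(1) finite_subset BE(4) assms(3) by auto
  have cW: "finite (B' - BE)" "card (B' - BE) = m"
    using fB' fBE B'(1) assms(2) by (auto simp: card_Diff_subset)
  obtain e where e: "bij_betw e {..<m} BE"
    using ex_bij_betw_nat_finite[OF fBE(1)] fBE(2) by (auto simp: atLeast0LessThan)
  obtain w where w: "bij_betw w {..<m} (B' - BE)"
    using ex_bij_betw_nat_finite[OF cW(1)] cW(2) by (auto simp: atLeast0LessThan)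
  define \<phi> where "\<phi> = (\<lambda>i. if i < m then e i else w (i - m))"
  have b1: "bij_betw \<phi> {..<m} BE"
    using e by (rule bij_betw_cong[THEN iffD1, rotated]) (simp add: \<phi>_def)
  have sh: "bij_betw (\<lambda>i. i - m) {m..<n} {..<m}"
    by (rule bij_betwI[where g = "\<lambda>i. i + m"]) (use assms(2) in auto)
  have b2: "bij_betw \<phi> {m..<n} (B' - BE)"
    using bij_betw_trans[OF sh w] by (rule bij_betw_cong[THEN iffD1, rotated]) (simp add: \<phi>_def)
  have "bij_betw \<phi> ({..<m} \<union> {m..<n}) (BE \<union> (B' - BE))"
    by (rule bij_betw_combine[OF b1 b2]) auto
  moreover have "{..<m} \<union> {m..<n} = {..<n}" "BE \<union> (B' - BE) = B'" using assms(2) B'(1) by auto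
  ultimately have bij: "bij_betw \<phi> {..<n} B'" by simp
  have range: "Y = range (lincomb n \<phi>)" using span_lincomb[OF bij] span by simp
  have "haar_system \<phi> n (-1) 1"
  proof
    fix i assume "i < n"
    then have "\<phi> i \<in> Y" using bij B'(2) by (auto simp: bij_betw_def)
    then show "continuous_on {-1..1} (\<phi> i)" using Y by (auto simp: C0_def)
  next
    fix c :: "nat \<Rightarrow> real" and i assume i: "i < n" "c i \<noteq> 0"
    let ?g = "lincomb n \<phi> c"
    have "?g \<noteq> 0" using independent_lincomb[OF bij B'(3), of c i] i by auto
    then have z: "finite (zeros_on {-1..1} ?g)" "card (zeros_on {-1..1} ?g) < n"
      using zeros[of ?g] range by auto
    have sub: "{t \<in> {-1<..<1}. ?g t = 0} \<subseteq> zeros_on {-1..1} ?g" by (auto simp: zeros_on_def)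
    show "finite {t \<in> {-1<..<1}. ?g t = 0} \<and> card {t \<in> {-1<..<1}. ?g t = 0} < n"
      using finite_subset[OF sub z(1)] card_mono[OF z(1) sub] z(2) by linarith
  qed simp
  moreover have "\<phi> i (- t) = \<phi> i t" if "i < m" "t \<in> {-1..1}" for i t
  proof -
    have "\<phi> i \<in> BE" using b1 that by (auto simp: bij_betw_def)
    then show ?thesis using BE(1) that by (auto simp: even_functions_def)
  qed
  ultimately show ?thesis using range by blast
qed

text \<open>
  Suppose an odd part, coming from w in the span of the last m basis functions, had m zeros in (0,1).
  The even basis functions and w are m + 1 functions, so some nonzero combination of them vanishes at these m
  points. It takes equal values there and at the m reflected points, which makes 2 m zeros.
\<close>

lemma odd_parts_haar:
  assumes "haar_system \<phi> (2 * m) (-1) 1" and ev: "\<And>i t. i < m \<Longrightarrow> t \<in> {-1..1} \<Longrightarrow> \<phi> i (- t) = \<phi> i t"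
  shows "haar_system (\<lambda>i t. \<phi> (m + i) t - \<phi> (m + i) (- t)) m 0 1"
proof
  interpret haar_system \<phi> "2 * m" "-1" 1 by (rule assms)
  let ?\<psi> = "\<lambda>i t. \<phi> (m + i) t - \<phi> (m + i) (- t)"
  fix i assume i: "i < m"
  have c: "continuous_on {-1..1} (\<phi> (m + i))" using cont i by simp
  have "continuous_on {0..1} (\<phi> (m + i))" by (rule continuous_on_subset[OF c]) auto
  moreover have "continuous_on {0..1} (\<lambda>t. \<phi> (m + i) (- t))"
    by (rule continuous_on_compose2[OF c]) (auto intro!: continuous_intros)
  ultimately show "continuous_on {0..1} (?\<psi> i)" by (rule continuous_on_diff)
next
  interpret haar_system \<phi> "2 * m" "-1" 1 by (rule assms)
  let ?\<psi> = "\<lambda>i t. \<phi> (m + i) t - \<phi> (m + i) (- t)"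
  fix c :: "nat \<Rightarrow> real" and i assume i: "i < m" "c i \<noteq> 0"
  let ?Z = "{t \<in> {0<..<1}. lincomb m ?\<psi> c t = 0}"
  show "finite ?Z \<and> card ?Z < m"
  proof (rule ccontr)
    assume "\<not> (finite ?Z \<and> card ?Z < m)"
    then have "\<exists>X\<subseteq>?Z. finite X \<and> card X = m"
    proof (cases "finite ?Z")
      case True
      then have "m \<le> card ?Z" using \<open>\<not> (finite ?Z \<and> card ?Z < m)\<close> by linarith
      then show ?thesis using obtain_subset_with_card_n by meson
    next
      case False
      then show ?thesis using infinite_arbitrarily_large by meson
    qed
    then obtain X where X: "X \<subseteq> ?Z" "finite X" "card X = m" by blast
    define w where "w = lincomb m (\<lambda>i. \<phi> (m + i)) c"
    have w: "w (- x) = w x" if "x \<in> X" for x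
    proof -
      have "lincomb m ?\<psi> c x = 0" using X that by auto
      moreover have "lincomb m ?\<psi> c x = w x - w (- x)"
        by (simp add: lincomb_def w_def right_diff_distrib sum_subtractf)
      ultimately show ?thesis by simp
    qed
    obtain d where d: "\<exists>i<Suc m. d i \<noteq> 0"
      "\<forall>x\<in>X. lincomb (Suc m) (\<lambda>i. if i < m then \<phi> i else w) d x = 0"
      using lincomb_vanishing[OF X(2), of "Suc m" "\<lambda>i. if i < m then \<phi> i else w"] X by auto
    define C where "C = (\<lambda>i. if i < m then d i else d m * c (i - m))"
    have split: "lincomb (2 * m) \<phi> C t = lincomb m \<phi> d t + d m * w t" for t
      unfolding lincomb_split by (simp add: lincomb_def C_def w_def sum_distrib_left mult_ac)
    have zero: "lincomb m \<phi> d x + d m * w x = 0" if "x \<in> X" for x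
      using d(2) that by (simp add: lincomb_def)
    have "\<exists>i<2 * m. C i \<noteq> 0"
    proof (cases "d m = 0")
      case True
      then obtain j where "j < m" "d j \<noteq> 0" using d(1) less_Suc_eq by auto
      then show ?thesis by (intro exI[of _ j]) (auto simp: C_def)
    next
      case False
      then show ?thesis using i by (intro exI[of _ "m + i"]) (auto simp: C_def)
    qed
    then have "card (X \<union> uminus ` X) < 2 * m"
    proof (rule few_zeros(2))
      fix x assume "x \<in> X \<union> uminus ` X"
      then consider "x \<in> X" | "- x \<in> X" by auto
      then show "lincomb (2 * m) \<phi> C x = 0"
      proof cases
        case 1
        then show ?thesis using zero split by simp
      next
        case 2
        then have "lincomb m \<phi> d x = lincomb m \<phi> d (- x)"
          using X(1) ev[of _ "- x"] by (force simp: lincomb_def intro!: sum.cong)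
        then show ?thesis using zero[OF 2] w[OF 2] split by simp
      qed
    qed (use X in auto)
    moreover have "card (X \<union> uminus ` X) = card X + card (uminus ` X)"
    proof (rule card_Un_disjoint)
      have pos: "x > 0" if "x \<in> X" for x using X(1) that by auto
      show "X \<inter> uminus ` X = {}"
      proof (rule ccontr)
        assume "X \<inter> uminus ` X \<noteq> {}"
        then obtain x where "x \<in> X" "- x \<in> X" by auto
        then show False using pos[of x] pos[of "- x"] by simp
      qed
    qed (use X in auto)
    ultimately show False using X by (simp add: card_image)
  qed
qed simp

section \<open>Canonical points\<close>

text \<open>
  Counted from 0, the canonical sign function starts with value -1 to the right and 1 to the left, so it
  has a jump at 0 as well.
\<close>

lemma canonical_sign_halves:
  assumes sm: "strict_mono_on {- int m - 1..int m + 1} \<alpha>"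
    and ends: "\<alpha> (- int m - 1) = -1" "\<alpha> 0 = 0" "\<alpha> (int m + 1) = 1"
  shows "t \<in> {0<..<1} \<Longrightarrow> canonical_sign (2 * m) \<alpha> t = - sign_pattern \<alpha> {1..int m} t"
    and "t \<in> {-1<..<0} \<Longrightarrow> canonical_sign (2 * m) \<alpha> t = (-1) ^ m * sign_pattern \<alpha> {- int m..-1} t"
proof -
  have mono: "\<alpha> i \<le> \<alpha> j" if "i \<le> j" "- int m - 1 \<le> i" "j \<le> int m + 1" for i j
    using strict_mono_on_leD[OF sm] that by auto
  have loc: "\<exists>i\<in>{- int m..int m + 1}. \<forall>j\<in>{- int m - 1..int m + 1}. (t < \<alpha> j) = (i \<le> j)"
    if t: "t \<in> {-1<..<1}"
  proof -
    define K where "K = {i \<in> {- int m..int m + 1}. t < \<alpha> i}"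
    have "K \<subseteq> {- int m..int m + 1}" by (auto simp: K_def)
    then have K: "finite K" "int m + 1 \<in> K"
      using ends t finite_subset by (blast, auto simp: K_def)
    define i where "i = Min K"
    have iK: "i \<in> K" unfolding i_def using K by (intro Min_in) auto
    have below: "\<alpha> (i - 1) \<le> t"
    proof (cases "i = - int m")
      case True
      then show ?thesis using ends t by simp
    next
      case False
      then have "i - 1 \<notin> K" using Min_le[OF K(1), of "i - 1"] by (auto simp: i_def)
      then show ?thesis using False iK by (auto simp: K_def)
    qed
    have "(t < \<alpha> j) = (i \<le> j)" if j: "j \<in> {- int m - 1..int m + 1}" for j
    proof
      assume tj: "t < \<alpha> j"
      show "i \<le> j"
      proof (rule ccontr)
        assume "\<not> i \<le> j"
        then have "\<alpha> j \<le> \<alpha> (i - 1)" using j iK by (intro mono) (auto simp: K_def)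
        then show False using tj below by simp
      qed
    next
      assume "i \<le> j"
      then have "\<alpha> i \<le> \<alpha> j" using j iK by (intro mono) (auto simp: K_def)
      then show "t < \<alpha> j" using iK by (auto simp: K_def)
    qed
    then show ?thesis using iK by (auto simp: K_def)
  qed
  have cs: "canonical_sign (2 * m) \<alpha> t = (-1) powi i"
    if i: "i \<in> {- int m..int m + 1}" "\<forall>j\<in>{- int m - 1..int m + 1}. (t < \<alpha> j) = (i \<le> j)" for i
  proof -
    have "canonical_sign (2 * m) \<alpha> t = (\<Sum>k\<in>{- int m..int m + 1}. if k = i then (-1) powi i else 0)"
      unfolding canonical_sign_def
    proof (rule sum.cong)
      fix k assume k: "k \<in> {- int m..int m + 1}"
      have "(t < \<alpha> k) = (i \<le> k)" "(t < \<alpha> (k - 1)) = (i \<le> k - 1)" using i(2) k by auto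
      then have "t \<in> {\<alpha> (k - 1)..<\<alpha> k} \<longleftrightarrow> k = i" by (auto simp: not_less[symmetric])
      then show "(-1) powi k * indicator {\<alpha> (k - 1)..<\<alpha> k} t = (if k = i then (-1) powi i else 0 :: real)"
        by (auto simp: indicator_def)
    qed simp
    also have "\<dots> = (-1) powi i" using i(1) by simp
    finally show ?thesis .
  qed
  show "canonical_sign (2 * m) \<alpha> t = - sign_pattern \<alpha> {1..int m} t" if t: "t \<in> {0<..<1}"
  proof -
    obtain i where i: "i \<in> {- int m..int m + 1}" "\<forall>j\<in>{- int m - 1..int m + 1}. (t < \<alpha> j) = (i \<le> j)"
      using loc t by auto
    have "i > 0" using i(2)[rule_format, of 0] t ends by auto
    then obtain k where k: "i = int (Suc k)" using zero_less_imp_eq_int by (metis Suc_pred' of_nat_0_less_iff)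
    have "{1..int m} = {1..i - 1} \<union> {i..int m}" using \<open>i > 0\<close> i by auto
    then have "sign_pattern \<alpha> {1..int m} t = sign_pattern \<alpha> {1..i - 1} t * sign_pattern \<alpha> {i..int m} t"
      by (simp add: sign_pattern_Un)
    also have "sign_pattern \<alpha> {i..int m} t = 1"
      by (rule sign_pattern_all_greater) (use i \<open>i > 0\<close> in auto)
    also have "sign_pattern \<alpha> {1..i - 1} t = (-1) ^ card {1..i - 1}"
      by (rule sign_pattern_all_le) (use i \<open>i > 0\<close> in \<open>auto simp: not_less[symmetric]\<close>)
    also have "card {1..i - 1} = k" using k by simp
    finally show ?thesis using cs[OF i] unfolding k power_int_of_nat by simp
  qed
  show "canonical_sign (2 * m) \<alpha> t = (-1) ^ m * sign_pattern \<alpha> {- int m..-1} t" if t: "t \<in> {-1<..<0}"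
  proof -
    obtain i where i: "i \<in> {- int m..int m + 1}" "\<forall>j\<in>{- int m - 1..int m + 1}. (t < \<alpha> j) = (i \<le> j)"
      using loc t by auto
    have "i \<le> 0" using i(2)[rule_format, of 0] t ends by auto
    define k where "k = nat (i + int m)"
    have k: "i = int k - int m" using i by (auto simp: k_def)
    have "{- int m..-1} = {- int m..i - 1} \<union> {i..-1}" using \<open>i \<le> 0\<close> i by auto
    then have "sign_pattern \<alpha> {- int m..-1} t = sign_pattern \<alpha> {- int m..i - 1} t * sign_pattern \<alpha> {i..-1} t"
      by (simp add: sign_pattern_Un)
    also have "sign_pattern \<alpha> {i..-1} t = 1"
      by (rule sign_pattern_all_greater) (use i \<open>i \<le> 0\<close> in auto)
    also have "sign_pattern \<alpha> {- int m..i - 1} t = (-1) ^ card {- int m..i - 1}"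
      by (rule sign_pattern_all_le) (use i \<open>i \<le> 0\<close> in \<open>auto simp: not_less[symmetric]\<close>)
    also have "card {- int m..i - 1} = k" by (simp add: k_def add.commute)
    finally have "sign_pattern \<alpha> {- int m..-1} t = (-1) ^ k" by simp
    moreover have "(-1 :: real) ^ k / (-1) ^ m = (-1) ^ m * (-1) ^ k"
      by (cases "even m") auto
    ultimately show ?thesis using cs[OF i] unfolding k
      by (simp add: power_int_diff)
  qed
qed

lemma canonical_sign_odd:
  assumes sm: "strict_mono_on {- int m - 1..int m + 1} \<alpha>"
    and ends: "\<alpha> (- int m - 1) = -1" "\<alpha> 0 = 0" "\<alpha> (int m + 1) = 1"
    and sym: "\<And>i. i \<in> {1..int m} \<Longrightarrow> \<alpha> (- i) = - \<alpha> i"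
    and t: "t \<in> {0<..<1}" "t \<notin> \<alpha> ` {1..int m}"
  shows "canonical_sign (2 * m) \<alpha> (- t) = sign_pattern \<alpha> {1..int m} t"
proof -
  have "canonical_sign (2 * m) \<alpha> (- t) = (-1) ^ m * sign_pattern \<alpha> {- int m..-1} (- t)"
    by (rule canonical_sign_halves(2)[OF sm ends]) (use t in auto)
  also have "sign_pattern \<alpha> {- int m..-1} (- t) = (\<Prod>j\<in>{1..int m}. - (if t < \<alpha> j then 1 else -1))"
    unfolding sign_pattern_def
  proof (rule prod.reindex_bij_witness[where i = uminus and j = uminus])
    fix j assume j: "j \<in> {- int m..-1}"
    then have "\<alpha> (- (- j)) = - \<alpha> (- j)" by (intro sym) auto
    moreover have "t \<noteq> \<alpha> (- j)" using t(2) j by (metis atLeastAtMost_iff image_eqI minus_le_iff neg_le_iff_le)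
    ultimately show "- (if t < \<alpha> (- j) then 1 else -1) = (if - t < \<alpha> j then 1 else -1 :: real)" by auto
  qed auto
  also have "\<dots> = (-1) ^ m * sign_pattern \<alpha> {1..int m} t"
    by (simp add: prod_uminus sign_pattern_def)
  finally show ?thesis by (simp flip: mult.assoc power_add power_mult_distrib)
qed

lemma borel_measurable_canonical_sign: "canonical_sign n \<alpha> \<in> borel_measurable borel"
  unfolding canonical_sign_def[abs_def] by measurable

context charging_measure
begin

lemma symmetric_integral_reflect:
  fixes h :: "real \<Rightarrow> real"
  assumes sym: "symmetric_measure \<nu>" and h: "h \<in> borel_measurable borel"
  shows "(LINT t|\<nu>. h (- t)) = (LINT t|\<nu>. h t)"
proof -
  have m: "uminus \<in> measurable \<nu> borel" "(\<lambda>t. t) \<in> measurable \<nu> borel"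
    by (auto intro!: measurable_borel)
  have "distr \<nu> borel uminus = distr \<nu> borel (\<lambda>t. t)"
  proof (rule measure_eqI)
    fix A assume "A \<in> sets (distr \<nu> borel uminus)"
    then have A: "A \<in> sets borel" by simp
    have "uminus -` A \<inter> space \<nu> = uminus ` (A \<inter> {-1..1})" by force
    moreover have "emeasure \<nu> (uminus ` (A \<inter> {-1..1})) = emeasure \<nu> (A \<inter> {-1..1})"
      using sym A unfolding symmetric_measure_def by (metis inf_le2 sets.Int borel_closed closed_atLeastAtMost)
    ultimately show "emeasure (distr \<nu> borel uminus) A = emeasure (distr \<nu> borel (\<lambda>t. t)) A"
      using A m by (simp add: emeasure_distr)
  qed simp
  then show ?thesis
    using integral_distr[OF m(1) h] integral_distr[OF m(2) h] by simp
qed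

lemma symmetric_integral_halves:
  fixes h :: "real \<Rightarrow> real"
  assumes sym: "symmetric_measure \<nu>" and h: "h \<in> borel_measurable borel" "\<And>t. \<bar>h t\<bar> \<le> B"
  shows "(LINT t|\<nu>. h t) = (LINT t|\<nu>. indicator {0<..<1} t * (h t + h (- t)))"
proof -
  have B: "B \<ge> 0" using h(2)[of 0] by linarith
  have i1: "integrable \<nu> (\<lambda>t. indicator A t * h (e * t))" if "A \<in> sets borel" for A e
  proof (rule integrable_bounded[of _ "{}" B])
    have [measurable]: "h \<in> borel_measurable borel" "A \<in> sets borel" by (rule h that)+
    show "(\<lambda>t. indicator A t * h (e * t)) \<in> borel_measurable \<nu>"
      by (rule measurable_borel) measurable
    show "\<bar>indicator A t * h (e * t)\<bar> \<le> B" for t using h(2)[of "e * t"] B by (auto simp: indicator_def)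
  qed simp
  have "(LINT t|\<nu>. h t) = (LINT t|\<nu>. indicator {0<..<1} t * h t + indicator {-1<..<0} t * h t)"
  proof (rule integral_cong_AE)
    have [measurable]: "h \<in> borel_measurable borel" by (rule h)
    show "h \<in> borel_measurable \<nu>" by (rule measurable_borel[OF h(1)])
    show "(\<lambda>t. indicator {0<..<1} t * h t + indicator {-1<..<0} t * h t) \<in> borel_measurable \<nu>"
      by (rule measurable_borel) measurable
    have "finite {-1, 0, 1 :: real}" by simp
    from AE_not_finite[OF this] AE_space
    show "AE t in \<nu>. h t = indicator {0<..<1} t * h t + indicator {-1<..<0} t * h t"
      by eventually_elim (auto simp: indicator_def)
  qed
  also have "\<dots> = (LINT t|\<nu>. indicator {0<..<1} t * h t) + (LINT t|\<nu>. indicator {-1<..<0} t * h t)"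
    using i1[of _ 1] by (intro Bochner_Integration.integral_add) auto
  also have "(LINT t|\<nu>. indicator {-1<..<0} t * h t) = (LINT t|\<nu>. indicator {-1<..<0} (- t) * h (- t))"
    by (rule symmetric_integral_reflect[OF sym, symmetric]) (use h in measurable)
  also have "\<dots> = (LINT t|\<nu>. indicator {0<..<1} t * h (- t))"
    by (rule Bochner_Integration.integral_cong) (auto simp: indicator_def)
  also have "(LINT t|\<nu>. indicator {0<..<1} t * h t) + \<dots> =
      (LINT t|\<nu>. indicator {0<..<1} t * h t + indicator {0<..<1} t * h (- t))"
    using i1[of _ 1] i1[of _ "-1"] by (intro Bochner_Integration.integral_add[symmetric]) auto
  finally show ?thesis by (simp add: distrib_left)
qed

text \<open>
  Folding the integral at 0 leaves the moments of the odd parts; the even basis functions cancel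
  because the canonical sign function is odd almost everywhere.
\<close>

lemma canonical_orthogonality:
  assumes H: "haar_system \<phi> (2 * m) (-1) 1"
    and ev: "\<And>i t. i < m \<Longrightarrow> t \<in> {-1..1} \<Longrightarrow> \<phi> i (- t) = \<phi> i t"
    and sym: "symmetric_measure \<nu>"
    and sm: "strict_mono_on {- int m - 1..int m + 1} \<alpha>"
    and ends: "\<alpha> (- int m - 1) = -1" "\<alpha> 0 = 0" "\<alpha> (int m + 1) = 1"
    and sa: "\<And>i. i \<in> {1..int m} \<Longrightarrow> \<alpha> (- i) = - \<alpha> i"
  defines "\<psi> \<equiv> \<lambda>i t. \<phi> (m + i) t - \<phi> (m + i) (- t)"
  defines "x \<equiv> \<lambda>i. if i < m then \<alpha> (int i + 1) else 0"
  shows "(\<forall>c. (LINT t|\<nu>. canonical_sign (2 * m) \<alpha> t * lincomb (2 * m) \<phi> c t) = 0) \<longleftrightarrow>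
    charged_haar.moments \<nu> \<psi> m 0 1 x = (\<lambda>i. 0)"
proof -
  interpret Y: haar_system \<phi> "2 * m" "-1" 1 by (rule H)
  interpret O: haar_system \<psi> m 0 1 unfolding \<psi>_def by (rule odd_parts_haar[OF H ev])
  interpret O: charged_haar \<nu> \<psi> m 0 1 by unfold_locales auto
  interpret Y: charged_haar \<nu> \<phi> "2 * m" "-1" 1 by unfold_locales auto
  let ?s = "canonical_sign (2 * m) \<alpha>"
  have sx: "sign_pattern \<alpha> {1..int m} t = sign_pattern x {..<m} t" for t
    unfolding sign_pattern_def
    by (rule prod.reindex_bij_witness[where i = "\<lambda>i. int i + 1" and j = "\<lambda>k. nat (k - 1)"])
      (auto simp: x_def)
  have main: "(LINT t|\<nu>. ?s t * lincomb (2 * m) \<phi> c t) = - (\<Sum>i<m. c (m + i) * O.moments x i)" for c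
  proof -
    let ?g = "lincomb (2 * m) \<phi> c"
    \<comment> \<open>The basis functions are controlled inside the interval only, so the integrand is cut off before it is reflected.\<close>
    let ?h = "\<lambda>t. indicator {-1<..<1} t * (?s t * ?g t)"
    have [measurable]: "?s \<in> borel_measurable borel" by (rule borel_measurable_canonical_sign)
    have [measurable]: "(\<lambda>t. indicator {-1<..<1} t * ?g t) \<in> borel_measurable borel"
      by (rule Y.measurable_on_segment[OF Y.continuous_lincomb])
    have hm: "?h \<in> borel_measurable borel"
    proof -
      have "(\<lambda>t. ?s t * (indicator {-1<..<1} t * ?g t)) \<in> borel_measurable borel" by measurable
      then show ?thesis by (simp add: mult_ac)
    qed
    have gm: "?g \<in> borel_measurable \<nu>"
      by (rule measurable_continuous[of "{}"]) (use Y.continuous_lincomb in auto)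
    obtain B where B: "\<And>t. t \<in> {-1..1} \<Longrightarrow> \<bar>?g t\<bar> \<le> B" using Y.lincomb_bounded[of c] by blast
    have B0: "0 \<le> B" using B[of 0] by auto
    have s1: "\<bar>?s t\<bar> \<le> 1" if "t \<in> {-1<..<1} - {0}" for t
    proof (cases "t > 0")
      case True
      then show ?thesis using canonical_sign_halves(1)[OF sm ends, of t] that by simp
    next
      case False
      then show ?thesis using canonical_sign_halves(2)[OF sm ends, of t] that by (simp add: abs_mult)
    qed
    have hB: "\<bar>?h t\<bar> \<le> B * (1 + \<bar>?s 0\<bar>)" for t
    proof -
      have "\<bar>?s t\<bar> \<le> 1 + \<bar>?s 0\<bar>" if "t \<in> {-1<..<1}" using s1[of t] that by (cases "t = 0") auto
      then show ?thesis using B[of t] B0 mult_mono[of "\<bar>?g t\<bar>" B "\<bar>?s t\<bar>" "1 + \<bar>?s 0\<bar>"]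
        by (auto simp: indicator_def abs_mult mult.commute)
    qed
    have "(LINT t|\<nu>. ?s t * ?g t) = (LINT t|\<nu>. ?h t)"
    proof (rule integral_cong_AE)
      show "(\<lambda>t. ?s t * ?g t) \<in> borel_measurable \<nu>"
        by (intro borel_measurable_times gm measurable_borel borel_measurable_canonical_sign)
      show "?h \<in> borel_measurable \<nu>" by (rule measurable_borel[OF hm])
      have "finite {-1, 1 :: real}" by simp
      from AE_not_finite[OF this] AE_space show "AE t in \<nu>. ?s t * ?g t = ?h t"
        by eventually_elim (auto simp: indicator_def)
    qed
    also have "\<dots> = (LINT t|\<nu>. indicator {0<..<1} t * (?h t + ?h (- t)))"
      by (rule symmetric_integral_halves[OF sym hm hB])
    also have "\<dots> = (LINT t|\<nu>. - (indicator {0<..<1} t *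
        (sign_pattern x {..<m} t * lincomb m \<psi> (\<lambda>i. c (m + i)) t)))"
    proof (rule integral_cong_AE)
      have "(\<lambda>t. indicator {0<..<1} t * (h t + h (- t))) \<in> borel_measurable borel"
        if [measurable]: "h \<in> borel_measurable borel" for h :: "real \<Rightarrow> real"
        by measurable
      from measurable_borel[OF this[OF hm]]
      show "(\<lambda>t. indicator {0<..<1} t * (?h t + ?h (- t))) \<in> borel_measurable \<nu>" .
      show "(\<lambda>t. - (indicator {0<..<1} t *
          (sign_pattern x {..<m} t * lincomb m \<psi> (\<lambda>i. c (m + i)) t))) \<in> borel_measurable \<nu>"
        by (intro borel_measurable_uminus borel_measurable_integrable
            O.integrable_on_segment[where M = 1] O.continuous_lincomb sign_pattern_borel) simp
      have "finite (\<alpha> ` {1..int m})" by simp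
      from AE_not_finite[OF this]
      show "AE t in \<nu>. indicator {0<..<1} t * (?h t + ?h (- t)) = - (indicator {0<..<1} t *
          (sign_pattern x {..<m} t * lincomb m \<psi> (\<lambda>i. c (m + i)) t))"
      proof eventually_elim
        case (elim t)
        show ?case
        proof (cases "t \<in> {0<..<1::real}")
          case True
          have "lincomb m \<phi> c (- t) = lincomb m \<phi> c t"
            unfolding lincomb_def by (rule sum.cong) (use ev True in auto)
          then have gd: "?g t - ?g (- t) = lincomb m \<psi> (\<lambda>i. c (m + i)) t"
            unfolding lincomb_split by (simp add: lincomb_def \<psi>_def right_diff_distrib sum_subtractf)
          have s1: "?s t = - sign_pattern x {..<m} t"
            using canonical_sign_halves(1)[OF sm ends True] sx by simp
          have s2: "?s (- t) = sign_pattern x {..<m} t"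
            using canonical_sign_odd[OF sm ends sa True elim] sx by simp
          have "?h t = - sign_pattern x {..<m} t * ?g t" "?h (- t) = sign_pattern x {..<m} t * ?g (- t)"
            using True by (simp_all add: s1 s2)
          then show ?thesis using True unfolding gd[symmetric] by (simp add: right_diff_distrib)
        qed simp
      qed
    qed
    also have "\<dots> = - (\<Sum>i<m. c (m + i) * O.moments x i)"
      by (simp add: O.moments_lincomb)
    finally show ?thesis .
  qed
  show ?thesis
  proof
    assume all: "\<forall>c. (LINT t|\<nu>. ?s t * lincomb (2 * m) \<phi> c t) = 0"
    show "O.moments x = (\<lambda>i. 0)"
    proof
      fix i
      show "O.moments x i = 0"
      proof (cases "i < m")
        case True
        have "(\<Sum>j<m. (if m + j = m + i then 1 else 0) * O.moments x j) = 0"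
          using main[of "\<lambda>j. if j = m + i then 1 else 0"] all by simp
        moreover have "(\<Sum>j<m. (if m + j = m + i then 1 else 0) * O.moments x j) =
            (\<Sum>j<m. if j = i then O.moments x j else 0)"
          by (rule sum.cong) auto
        ultimately show ?thesis using True by simp
      qed (simp add: O.moments_def)
    qed
  qed (simp add: main)
qed

lemma ex1_canonical_points:
  assumes cheb: "chebyshev_space (-1) 1 n Y" and n: "n = 2 * m"
    and dim: "fun_vs.dim (Y \<inter> even_functions) = m" and sym: "symmetric_measure \<nu>"
  shows "\<exists>!\<alpha>. canonical_points \<nu> Y n \<alpha>"
proof -
  obtain \<phi> where \<phi>: "Y = range (lincomb n \<phi>)" "haar_system \<phi> (2 * m) (-1) 1"
    "\<And>i t. i < m \<Longrightarrow> t \<in> {-1..1} \<Longrightarrow> \<phi> i (- t) = \<phi> i t"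
    using chebyshev_basis[OF cheb n dim] n by auto
  define \<psi> where "\<psi> = (\<lambda>i t. \<phi> (m + i) t - \<phi> (m + i) (- t))"
  interpret haar_system \<psi> m 0 1 unfolding \<psi>_def by (rule odd_parts_haar[OF \<phi>(2,3)])
  interpret charged_haar \<nu> \<psi> m 0 1 by unfold_locales auto
  let ?I = "{- int m - 1..int m + 1}"
  have nm: "n div 2 = m" using n by simp
  have cp: "canonical_points \<nu> Y n \<alpha> \<longleftrightarrow> \<alpha> \<in> extensional ?I \<and> strict_mono_on ?I \<alpha> \<and>
      \<alpha> (- int m - 1) = -1 \<and> \<alpha> 0 = 0 \<and> \<alpha> (int m + 1) = 1 \<and> (\<forall>i\<in>{1..int m}. \<alpha> (- i) = - \<alpha> i) \<and>
      moments (\<lambda>i. if i < m then \<alpha> (int i + 1) else 0) = (\<lambda>i. 0)" for \<alpha>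
  proof -
    have "(\<forall>g\<in>Y. (LINT x|\<nu>. canonical_sign n \<alpha> x * g x) = 0) \<longleftrightarrow>
        (\<forall>c. (LINT t|\<nu>. canonical_sign (2 * m) \<alpha> t * lincomb (2 * m) \<phi> c t) = 0)"
      using \<phi>(1) n by auto
    then show ?thesis
      unfolding canonical_points_def nm
      using canonical_orthogonality[OF \<phi>(2,3) sym, of \<alpha>, folded \<psi>_def] by blast
  qed
  obtain x where x: "x \<in> open_simplex" "moments x = (\<lambda>i. 0)"
    and uniq: "\<And>y. y \<in> open_simplex \<Longrightarrow> moments y = (\<lambda>i. 0) \<Longrightarrow> y = x"
    using vanishing_moments by blast
  show ?thesis
  proof (rule ex_ex1I)
    \<comment> \<open>The canonical points with nonnegative index, from 0 up to the right end 1.\<close>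
    define y where "y = (\<lambda>k. if k = 0 then 0 else if k \<le> m then x (k - 1) else 1)"
    have ymono: "y i < y j" if "i < j" "j \<le> Suc m" for i j
      using x(1) that by (auto simp: y_def open_simplex_def)
    define \<alpha> where "\<alpha> = restrict (\<lambda>k. if k \<ge> 0 then y (nat k) else - y (nat (- k))) ?I"
    have y0: "y 0 = 0" by (simp add: y_def)
    have ypos: "0 < y k" if "0 < k" "k \<le> Suc m" for k using ymono[of 0 k] y0 that by simp
    have "strict_mono_on ?I \<alpha>"
    proof (rule strict_mono_onI)
      fix r s assume rs: "r \<in> ?I" "s \<in> ?I" "r < s"
      consider "0 \<le> r" | "r < 0" "0 \<le> s" | "s < 0" by linarith
      then show "\<alpha> r < \<alpha> s"
      proof cases
        case 1
        then show ?thesis using rs by (auto simp: \<alpha>_def intro!: ymono)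
      next
        case 2
        have "0 < y (nat (- r))" using 2 rs by (intro ypos) auto
        moreover have "0 \<le> y (nat s)"
          using ypos[of "nat s"] y0 2 rs by (cases "nat s = 0") (auto simp: less_imp_le)
        ultimately show ?thesis using 2 rs by (simp add: \<alpha>_def)
      next
        case 3
        have "y (nat (- s)) < y (nat (- r))" using 3 rs by (intro ymono) auto
        then show ?thesis using 3 rs by (simp add: \<alpha>_def)
      qed
    qed
    moreover have "(\<lambda>i. if i < m then \<alpha> (int i + 1) else 0) = x"
    proof
      fix i
      show "(if i < m then \<alpha> (int i + 1) else 0) = x i"
      proof (cases "i < m")
        case True
        have "nat (int i + 1) = Suc i" by simp
        then show ?thesis using True by (simp add: \<alpha>_def y_def)
      qed (use x(1) in \<open>auto simp: open_simplex_def\<close>)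
    qed
    moreover have "\<alpha> (- int m - 1) = -1" "\<alpha> (int m + 1) = 1"
    proof -
      have "nat (int m + 1) = Suc m" "nat (- (- int m - 1)) = Suc m" by simp_all
      then show "\<alpha> (- int m - 1) = -1" "\<alpha> (int m + 1) = 1"
        by (simp_all add: \<alpha>_def y_def)
    qed
    moreover have "\<alpha> 0 = 0" by (simp add: \<alpha>_def y_def)
    moreover have "\<forall>i\<in>{1..int m}. \<alpha> (- i) = - \<alpha> i" by (auto simp: \<alpha>_def)
    moreover have "\<alpha> \<in> extensional ?I" by (simp add: \<alpha>_def)
    ultimately have "canonical_points \<nu> Y n \<alpha>" using x(2) by (simp only: cp)
    then show "\<exists>\<alpha>. canonical_points \<nu> Y n \<alpha>" using exI[of "canonical_points \<nu> Y n" \<alpha>] by simp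
  next
    fix \<alpha> \<beta> assume ab: "canonical_points \<nu> Y n \<alpha>" "canonical_points \<nu> Y n \<beta>"
    have osx: "(\<lambda>i. if i < m then \<gamma> (int i + 1) else 0) = x" if "canonical_points \<nu> Y n \<gamma>" for \<gamma>
    proof (rule uniq)
      have g: "strict_mono_on ?I \<gamma>" "\<gamma> 0 = 0" "\<gamma> (int m + 1) = 1" using that unfolding cp by auto
      have lt: "\<gamma> i < \<gamma> j" if "i < j" "i \<ge> 0" "j \<le> int m + 1" for i j
        using strict_mono_onD[OF g(1)] that by auto
      have "0 < \<gamma> (int i + 1)" "\<gamma> (int i + 1) < 1" if "i < m" for i
        using lt[of 0 "int i + 1"] lt[of "int i + 1" "int m + 1"] g that by auto
      moreover have "\<gamma> (int i + 1) < \<gamma> (int j + 1)" if "i < j" "j < m" for i j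
        using lt that by auto
      ultimately show "(\<lambda>i. if i < m then \<gamma> (int i + 1) else 0) \<in> open_simplex"
        by (auto simp: open_simplex_def)
    qed (use that in \<open>simp add: cp\<close>)
    have pos: "\<alpha> k = \<beta> k" if "k \<in> {1..int m}" for k
    proof -
      have "nat (k - 1) < m" "int (nat (k - 1)) + 1 = k" using that by auto
      then show ?thesis
        using fun_cong[OF osx[OF ab(1)], of "nat (k - 1)"] fun_cong[OF osx[OF ab(2)], of "nat (k - 1)"] by simp
    qed
    show "\<alpha> = \<beta>"
    proof (rule extensionalityI[of _ ?I])
      fix k assume "k \<in> ?I"
      then consider "k \<in> {1..int m}" | "- k \<in> {1..int m}" | "k = 0" | "k = int m + 1" | "k = - int m - 1"
        by fastforce
      then show "\<alpha> k = \<beta> k"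
      proof cases
        case 2
        have neg: "\<gamma> k = - \<gamma> (- k)" if "canonical_points \<nu> Y n \<gamma>" for \<gamma>
        proof -
          have "\<forall>i\<in>{1..int m}. \<gamma> (- i) = - \<gamma> i" using that unfolding cp by blast
          from this[rule_format, OF 2] show ?thesis by simp
        qed
        show ?thesis unfolding neg[OF ab(1)] neg[OF ab(2)] pos[OF 2] ..
      qed (use ab pos in \<open>auto simp: cp\<close>)
    qed (use ab in \<open>auto simp: cp\<close>)
  qed
qed

end

section \<open>Existence and uniqueness of the best approximation\<close>

lemma neg_pos_disjoint: "(A \<inter> {..<0}) \<inter> (B \<inter> {0<..}) = {}" for A B :: "real set"
proof (rule equals0I)
  fix x assume "x \<in> (A \<inter> {..<0}) \<inter> (B \<inter> {0<..})"
  then have "x < 0" "0 < x" by blast+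
  then show False by simp
qed

lemma neg_pos_split:
  fixes A :: "real set"
  assumes "0 \<notin> A"
  shows "A = (A \<inter> {..<0}) \<union> (A \<inter> {0<..})"
proof -
  have "x < 0 \<or> x > 0" if "x \<in> A" for x using assms that by (metis linorder_neqE_linordered_idom)
  then show ?thesis by blast
qed

lemma card_neg_pos:
  fixes A :: "real set"
  assumes "finite A" "0 \<notin> A"
  shows "card A = card (A \<inter> {..<0}) + card (A \<inter> {0<..})"
proof -
  have "card ((A \<inter> {..<0}) \<union> (A \<inter> {0<..})) = card (A \<inter> {..<0}) + card (A \<inter> {0<..})"
    by (intro card_Un_disjoint neg_pos_disjoint finite_Int disjI1 assms)
  from trans[OF arg_cong[OF neg_pos_split[OF assms(2)], of card] this] show ?thesis .
qed

lemma pattern_halves: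
  assumes A: "finite A" "0 \<notin> A"
  shows "t < 0 \<Longrightarrow> set_pattern (insert 0 A) t = set_pattern (A \<inter> {..<0}) t"
    and "t > 0 \<Longrightarrow> set_pattern (insert 0 A) t =
      - ((-1) ^ card (A \<inter> {..<0}) * set_pattern (A \<inter> {0<..}) t)"
proof -
  have "set_pattern ((A \<inter> {..<0}) \<union> (A \<inter> {0<..})) t =
      set_pattern (A \<inter> {..<0}) t * set_pattern (A \<inter> {0<..}) t"
    by (intro sign_pattern_Un neg_pos_disjoint finite_Int disjI1 A)
  from trans[OF arg_cong[OF neg_pos_split[OF A(2)], of "\<lambda>A. set_pattern A t"] this]
  have split: "set_pattern A t = set_pattern (A \<inter> {..<0}) t * set_pattern (A \<inter> {0<..}) t" .
  have ins: "set_pattern (insert 0 A) t = (if t < 0 then 1 else -1) * set_pattern A t"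
    using A by (rule sign_pattern_insert)
  show "set_pattern (insert 0 A) t = set_pattern (A \<inter> {..<0}) t" if "t < 0"
  proof -
    have "set_pattern (A \<inter> {0<..}) t = 1" by (rule sign_pattern_all_greater) (use that in auto)
    then show ?thesis using ins split that by simp
  qed
  show "set_pattern (insert 0 A) t = - ((-1) ^ card (A \<inter> {..<0}) * set_pattern (A \<inter> {0<..}) t)" if "t > 0"
  proof -
    have "set_pattern (A \<inter> {..<0}) t = (-1) ^ card (A \<inter> {..<0})"
      by (rule sign_pattern_all_le) (use that in auto)
    then show ?thesis using ins split that by simp
  qed
qed

lemma one_sided_bounded:
  fixes f :: "real \<Rightarrow> real"
  assumes "continuous_on {a..<b} f" "((\<lambda>x. \<bar>f x\<bar>) \<longlongrightarrow> L) (at_left b)"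
  shows "\<exists>B. \<forall>t\<in>{a..<b}. \<bar>f t\<bar> \<le> B"
proof -
  have "\<forall>\<^sub>F x in at_left b. \<bar>f x\<bar> < L + 1" using order_tendstoD(2)[OF assms(2), of "L + 1"] by simp
  then obtain d where d: "d < b" "\<And>y. d < y \<Longrightarrow> y < b \<Longrightarrow> \<bar>f y\<bar> < L + 1"
    unfolding eventually_at_left_field by blast
  have "bounded (f ` {a..d})"
    by (intro compact_imp_bounded compact_continuous_image continuous_on_subset[OF assms(1)]) (use d in auto)
  then obtain B where B: "\<And>t. t \<in> {a..d} \<Longrightarrow> \<bar>f t\<bar> \<le> B" unfolding bounded_iff real_norm_def by blast
  have "\<bar>f t\<bar> \<le> max B (L + 1)" if "t \<in> {a..<b}" for t
    using B[of t] d(2)[of t] that by (cases "t \<le> d") (auto simp: less_imp_le max_def)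
  then show ?thesis by blast
qed

text \<open>
  This makes the functions integrable; the point 0, where the value is unconstrained, carries no mass.
\<close>

lemma J0_bounded:
  assumes "f \<in> J0"
  shows "\<exists>B. \<forall>t\<in>{-1..1} - {0}. \<bar>f t\<bar> \<le> B"
proof -
  obtain L R where c: "continuous_on ({-1..1} - {0}) f" and L: "((\<lambda>x. \<bar>f x\<bar>) \<longlongrightarrow> L) (at_left 0)"
    and R: "((\<lambda>x. \<bar>f x\<bar>) \<longlongrightarrow> R) (at_right 0)"
    using assms unfolding J0_def by blast
  have "continuous_on {-1..<0} f" by (rule continuous_on_subset[OF c]) auto
  from one_sided_bounded[OF this L] obtain B where B: "\<forall>t\<in>{-1..<0}. \<bar>f t\<bar> \<le> B" by blast
  have "continuous_on {-1..<0} (\<lambda>t. f (- t))"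
    by (rule continuous_on_compose2[OF c]) (auto intro!: continuous_intros)
  moreover have "((\<lambda>x. \<bar>f (- x)\<bar>) \<longlongrightarrow> R) (at_left 0)"
    using R by (simp add: filterlim_at_left_to_right)
  ultimately obtain C where C: "\<forall>t\<in>{-1..<0}. \<bar>f (- t)\<bar> \<le> C" using one_sided_bounded by blast
  have "\<bar>f t\<bar> \<le> max B C" if "t \<in> {-1..1} - {0}" for t
  proof (cases "t < 0")
    case True
    then have "t \<in> {-1..<0}" using that by auto
    from B[rule_format, OF this] show ?thesis by simp
  next
    case False
    then have "- t \<in> {-1..<0}" using that by auto
    from C[rule_format, OF this] have "\<bar>f t\<bar> \<le> C" by simp
    then show ?thesis by simp
  qed
  then show ?thesis by blast
qed

locale chebyshev_approximation = charged_haar \<nu> \<phi> n "-1" 1 for \<nu> \<phi> n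
begin

lemma comb_measurable: "comb c \<in> borel_measurable \<nu>"
  by (rule measurable_continuous[of "{}"]) (use continuous_lincomb in auto)

lemma comb_integrable: "integrable \<nu> (comb c)"
proof -
  obtain B where "\<forall>t\<in>{-1..1}. \<bar>comb c t\<bar> \<le> B" using lincomb_bounded by blast
  then show ?thesis by (intro integrable_bounded[OF comb_measurable, of "{}"]) auto
qed

lemma J0_measurable: "f \<in> J0 \<Longrightarrow> f \<in> borel_measurable \<nu>"
  by (rule measurable_continuous[of "{0}"]) (auto simp: J0_def)

lemma J0_integrable:
  assumes "f \<in> J0"
  shows "integrable \<nu> f"
proof -
  obtain B where "\<forall>t\<in>{-1..1} - {0}. \<bar>f t\<bar> \<le> B" using J0_bounded[OF assms] by blast
  then show ?thesis by (intro integrable_bounded[OF J0_measurable[OF assms], of "{0}"]) auto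
qed

lemma AE_exists: "AE t in \<nu>. P t \<Longrightarrow> \<exists>t\<in>{-1<..<1}. P t"
  by (rule AE_interval_exists) auto

definition err :: "(real \<Rightarrow> real) \<Rightarrow> (nat \<Rightarrow> real) \<Rightarrow> real" where
  "err f c = L1_norm \<nu> (\<lambda>t. f t - comb c t)"

lemma err_integrable: "integrable \<nu> f \<Longrightarrow> integrable \<nu> (\<lambda>t. \<bar>f t - comb c t\<bar>)"
  by (intro integrable_abs Bochner_Integration.integrable_diff comb_integrable)

lemma err_triangle:
  assumes "integrable \<nu> f"
  shows "err f c \<le> err f d + L1_norm \<nu> (comb (\<lambda>i. d i - c i))"
proof -
  have i: "integrable \<nu> (\<lambda>t. \<bar>comb (\<lambda>i. d i - c i) t\<bar>)" by (intro integrable_abs comb_integrable)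
  have "err f c \<le> (LINT t|\<nu>. \<bar>f t - comb d t\<bar> + \<bar>comb (\<lambda>i. d i - c i) t\<bar>)"
    unfolding err_def L1_norm_def
    by (rule integral_mono) (use err_integrable[OF assms] i in \<open>auto simp: lincomb_diff\<close>)
  also have "\<dots> = err f d + L1_norm \<nu> (comb (\<lambda>i. d i - c i))"
    unfolding err_def L1_norm_def
    by (rule Bochner_Integration.integral_add) (use err_integrable[OF assms] i in auto)
  finally show ?thesis .
qed

lemma norm_le_coefficients: "L1_norm \<nu> (comb c) \<le> (\<Sum>i<n. \<bar>c i\<bar> * L1_norm \<nu> (\<phi> i))"
proof -
  have int: "integrable \<nu> (\<lambda>t. \<bar>\<phi> i t\<bar>)" if "i < n" for i
  proof -
    have "comb (\<lambda>j. if j = i then 1 else 0) = \<phi> i"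
      using that by (simp add: lincomb_def fun_eq_iff if_distrib[of "\<lambda>x. x * _"] cong: if_cong)
    then show ?thesis using comb_integrable integrable_abs by metis
  qed
  have "L1_norm \<nu> (comb c) \<le> (LINT t|\<nu>. (\<Sum>i<n. \<bar>c i\<bar> * \<bar>\<phi> i t\<bar>))"
    unfolding L1_norm_def
  proof (rule integral_mono)
    show "integrable \<nu> (\<lambda>t. \<Sum>i<n. \<bar>c i\<bar> * \<bar>\<phi> i t\<bar>)"
      by (intro Bochner_Integration.integrable_sum integrable_mult_right int) auto
    show "\<bar>comb c t\<bar> \<le> (\<Sum>i<n. \<bar>c i\<bar> * \<bar>\<phi> i t\<bar>)" for t
      unfolding lincomb_def by (rule order_trans[OF sum_abs]) (simp add: abs_mult)
  qed (intro integrable_abs comb_integrable)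
  also have "\<dots> = (\<Sum>i<n. \<bar>c i\<bar> * L1_norm \<nu> (\<phi> i))"
    unfolding L1_norm_def
    by (subst Bochner_Integration.integral_sum) (auto intro!: integrable_mult_right int)
  finally show ?thesis .
qed

lemma continuous_on_err:
  assumes "integrable \<nu> f"
  shows "continuous_on S (err f)"
proof (rule continuous_on_sequentiallyI)
  fix u c assume u: "u \<longlonglongrightarrow> (c :: nat \<Rightarrow> real)"
  let ?b = "\<lambda>k. \<Sum>i<n. \<bar>u k i - c i\<bar> * L1_norm \<nu> (\<phi> i)"
  have "?b \<longlonglongrightarrow> (\<Sum>i<n. \<bar>c i - c i\<bar> * L1_norm \<nu> (\<phi> i))"
    by (intro tendsto_intros tendsto_coordinate u)
  then have b: "?b \<longlonglongrightarrow> 0" by simp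
  have "\<bar>err f (u k) - err f c\<bar> \<le> ?b k" for k
  proof -
    have "(\<Sum>i<n. \<bar>c i - u k i\<bar> * L1_norm \<nu> (\<phi> i)) = ?b k"
      by (simp add: abs_minus_commute)
    then show ?thesis
      using err_triangle[OF assms, of "u k" c] err_triangle[OF assms, of c "u k"]
        norm_le_coefficients[of "\<lambda>i. c i - u k i"] norm_le_coefficients[of "\<lambda>i. u k i - c i"]
      by linarith
  qed
  then have "(\<lambda>k. err f (u k) - err f c) \<longlonglongrightarrow> 0"
    by (intro Lim_null_comparison[OF _ b] always_eventually) auto
  then show "(\<lambda>k. err f (u k)) \<longlonglongrightarrow> err f c" by (simp add: LIM_zero_iff)
qed

lemma norm_pos:
  assumes "\<exists>i<n. c i \<noteq> 0"
  shows "0 < L1_norm \<nu> (comb c)"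
proof -
  have i: "integrable \<nu> (\<lambda>t. \<bar>comb c t\<bar>)" by (intro integrable_abs comb_integrable)
  have "L1_norm \<nu> (comb c) \<noteq> 0"
  proof
    assume "L1_norm \<nu> (comb c) = 0"
    then have "AE t in \<nu>. \<bar>comb c t\<bar> = 0"
      unfolding L1_norm_def by (subst (asm) integral_nonneg_eq_0_iff_AE[OF i]) auto
    moreover have "AE t in \<nu>. t \<notin> {t \<in> {-1<..<1}. comb c t = 0}"
      by (rule AE_not_finite) (use haar assms in auto)
    ultimately have "AE t in \<nu>. t \<notin> {-1<..<1}" by eventually_elim auto
    then show False using AE_exists by blast
  qed
  moreover have "0 \<le> L1_norm \<nu> (comb c)" unfolding L1_norm_def by simp
  ultimately show ?thesis by simp
qed

text \<open>
  By homogeneity the norm is at least a fixed positive multiple of the largest coefficient, so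
  only a compact box of coefficients competes with the approximation 0.
\<close>

lemma best_approximation_exists:
  assumes f: "integrable \<nu> f"
  shows "\<exists>c. \<forall>d. err f c \<le> err f d"
proof -
  have z: "integrable \<nu> (\<lambda>t. 0 :: real)" by simp
  have N: "L1_norm \<nu> (comb c) = err (\<lambda>t. 0) c" for c by (simp add: err_def L1_norm_def)
  obtain \<delta> where \<delta>: "\<delta> > 0" "\<And>d. d \<in> coeff_sphere n \<Longrightarrow> \<delta> \<le> L1_norm \<nu> (comb d)"
  proof (cases "coeff_sphere n = {}")
    case True
    then show ?thesis using that[of 1] by simp
  next
    case False
    obtain d0 where "d0 \<in> coeff_sphere n" "\<forall>d\<in>coeff_sphere n. L1_norm \<nu> (comb d0) \<le> L1_norm \<nu> (comb d)"
      using continuous_attains_inf[OF compact_coeff_sphere False continuous_on_err[OF z]] N by auto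
    then show ?thesis using that[of "L1_norm \<nu> (comb d0)"] norm_pos coeff_sphere_nonzero by blast
  qed
  let ?z = "\<lambda>_ :: nat. 0 :: real"
  \<comment> \<open>An approximation with a coefficient larger than R has norm at least twice the norm of f, so it is no better than 0.\<close>
  define R where "R = 2 * err f ?z / \<delta>"
  have e0: "err f c \<ge> 0" for c by (simp add: err_def L1_norm_def)
  have R: "R \<ge> 0" using e0 \<delta> by (simp add: R_def)
  let ?K = "{c :: nat \<Rightarrow> real. \<forall>i. \<bar>c i\<bar> \<le> (if i < n then R else 0)}"
  have zK: "?z \<in> ?K" using R by auto
  then have "?K \<noteq> {}" by (metis empty_iff)
  then obtain c where c: "c \<in> ?K" "\<forall>d\<in>?K. err f c \<le> err f d"
    using continuous_attains_inf[OF compact_coordinate_box _ continuous_on_err[OF f]] by meson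
  have "err f c \<le> err f d" for d
  proof -
    define d' where "d' = (\<lambda>i. if i < n then d i else 0)"
    have "comb d = comb d'" by (intro ext lincomb_cong) (simp add: d'_def)
    then have dd: "err f d = err f d'" "L1_norm \<nu> (comb d) = L1_norm \<nu> (comb d')" by (simp_all add: err_def)
    show ?thesis
    proof (cases "d' \<in> ?K")
      case True
      then show ?thesis using c dd by auto
    next
      case False
      then obtain i where i: "i < n" "R < \<bar>d i\<bar>" using R by (auto simp: d'_def split: if_splits)
      then have "\<exists>i<n. d i \<noteq> 0" using R by auto
      then obtain r e where re: "r > 0" "e \<in> coeff_sphere n" "\<forall>i<n. d i = r * e i"
        using normalise_coefficients by blast
      have "\<bar>d i\<bar> = r * \<bar>e i\<bar>" using re i by (simp add: abs_mult)
      also have "\<bar>e i\<bar> \<le> 1" using re(2) by (auto simp: coeff_sphere_def split: if_splits)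
      then have "r * \<bar>e i\<bar> \<le> r" using re(1) by (simp add: mult_left_le)
      finally have rR: "R < r" using i by linarith
      have "comb d t = r * comb e t" for t
        unfolding lincomb_scale[symmetric] by (rule lincomb_cong) (use re in auto)
      then have "L1_norm \<nu> (comb d) = r * L1_norm \<nu> (comb e)"
        using re by (simp add: L1_norm_def abs_mult)
      moreover have "R * \<delta> \<le> r * L1_norm \<nu> (comb e)"
        using rR \<delta>(2)[OF re(2)] \<delta>(1) R by (intro mult_mono) auto
      moreover have "R * \<delta> = 2 * err f ?z" using \<delta> by (simp add: R_def)
      moreover have "L1_norm \<nu> (comb d) \<le> err f d + err f ?z"
      proof -
        have "L1_norm \<nu> (comb d) \<le> (LINT t|\<nu>. \<bar>f t - comb d t\<bar> + \<bar>f t - comb ?z t\<bar>)"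
          unfolding L1_norm_def
          by (rule integral_mono)
            (use err_integrable[OF f] integrable_abs[OF comb_integrable] integrable_abs[OF f]
              in \<open>auto simp: lincomb_def[of _ _ ?z]\<close>)
        also have "\<dots> = err f d + err f ?z" unfolding err_def L1_norm_def
          by (rule Bochner_Integration.integral_add) (use err_integrable[OF f] in auto)
        finally show ?thesis .
      qed
      moreover have "err f c \<le> err f ?z" using c zK by blast
      ultimately show ?thesis by linarith
    qed
  qed
  then show ?thesis by blast
qed

text \<open>
  The one-sided derivative of the distance in every direction of the space is nonnegative. It is minus
  the integral of the sign of the error against the direction; taking the opposite direction gives
  equality.
\<close>

lemma best_orthogonal:
  assumes f: "integrable \<nu> f" and best: "\<And>d. err f c \<le> err f d"
    and nz: "AE t in \<nu>. f t - comb c t \<noteq> 0"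
  shows "(LINT t|\<nu>. sgn (f t - comb c t) * comb d t) = 0"
proof -
  define h where "h = (\<lambda>t. f t - comb c t)"
  have h: "integrable \<nu> h" unfolding h_def by (intro Bochner_Integration.integrable_diff f comb_integrable)
  then have [measurable]: "h \<in> borel_measurable \<nu>" by (rule borel_measurable_integrable)
  have [measurable]: "comb d \<in> borel_measurable \<nu>" for d by (rule comb_measurable)
  have "(LINT t|\<nu>. sgn (h t) * comb d t) \<le> 0" for d
  proof -
    \<comment> \<open>Difference quotients of the error in direction d, with step 1 / (k + 1).\<close>
    let ?q = "\<lambda>k t. (\<bar>h t\<bar> - \<bar>h t - (1 / real (Suc k)) * comb d t\<bar>) * real (Suc k)"
    have "(\<lambda>k. LINT t|\<nu>. ?q k t) \<longlonglongrightarrow> (LINT t|\<nu>. sgn (h t) * comb d t)"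
    proof (rule integral_dominated_convergence)
      show "integrable \<nu> (\<lambda>t. \<bar>comb d t\<bar>)" by (intro integrable_abs comb_integrable)
      show "AE t in \<nu>. norm (?q k t) \<le> \<bar>comb d t\<bar>" for k
      proof (rule AE_I2)
        fix t
        have "\<bar>\<bar>h t\<bar> - \<bar>h t - (1 / real (Suc k)) * comb d t\<bar>\<bar> \<le> \<bar>(1 / real (Suc k)) * comb d t\<bar>" by linarith
        then have "\<bar>?q k t\<bar> \<le> \<bar>(1 / real (Suc k)) * comb d t\<bar> * real (Suc k)"
          unfolding abs_mult[of _ "real (Suc k)"] by (intro mult_mono) auto
        then show "norm (?q k t) \<le> \<bar>comb d t\<bar>" by (simp add: abs_mult)
      qed
      show "AE t in \<nu>. (\<lambda>k. ?q k t) \<longlonglongrightarrow> sgn (h t) * comb d t"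
        using nz
      proof eventually_elim
        case (elim t)
        then have ht: "\<bar>h t\<bar> > 0" by (simp add: h_def)
        have "(\<lambda>k. (1 / real (Suc k)) * comb d t) \<longlonglongrightarrow> 0 * comb d t"
          using LIMSEQ_inverse_real_of_nat by (intro tendsto_intros) (simp add: inverse_eq_divide)
        then have "\<forall>\<^sub>F k in sequentially. dist ((1 / real (Suc k)) * comb d t) 0 < \<bar>h t\<bar>"
          using tendstoD ht by fastforce
        then have "\<forall>\<^sub>F k in sequentially. ?q k t = sgn (h t) * comb d t"
        proof (rule eventually_mono)
          fix k assume "dist ((1 / real (Suc k)) * comb d t) 0 < \<bar>h t\<bar>"
          then have "\<bar>(1 / real (Suc k)) * comb d t\<bar> < \<bar>h t\<bar>" by (simp add: dist_real_def)
          then have "\<bar>h t\<bar> - \<bar>h t - (1 / real (Suc k)) * comb d t\<bar> = sgn (h t) * ((1 / real (Suc k)) * comb d t)"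
            by (cases "h t > 0") (auto simp: sgn_if abs_if split: if_splits)
          then show "?q k t = sgn (h t) * comb d t" by simp
        qed
        then show ?case by (rule tendsto_eventually)
      qed
    qed measurable
    moreover have "(LINT t|\<nu>. ?q k t) \<le> 0" for k
    proof -
      have "err f c \<le> err f (\<lambda>i. c i + (1 / real (Suc k)) * d i)" by (rule best)
      moreover have eq: "f t - comb (\<lambda>i. c i + (1 / real (Suc k)) * d i) t = h t - (1 / real (Suc k)) * comb d t" for t
        unfolding lincomb_add lincomb_scale by (simp add: h_def)
      have "err f (\<lambda>i. c i + (1 / real (Suc k)) * d i) = (LINT t|\<nu>. \<bar>h t - (1 / real (Suc k)) * comb d t\<bar>)"
        unfolding err_def L1_norm_def by (simp only: eq)
      moreover have "err f c = (LINT t|\<nu>. \<bar>h t\<bar>)" by (simp add: err_def L1_norm_def h_def)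
      ultimately have "(LINT t|\<nu>. \<bar>h t\<bar>) \<le> (LINT t|\<nu>. \<bar>h t - (1 / real (Suc k)) * comb d t\<bar>)"
        by linarith
      moreover have "(LINT t|\<nu>. ?q k t) =
          ((LINT t|\<nu>. \<bar>h t\<bar>) - (LINT t|\<nu>. \<bar>h t - (1 / real (Suc k)) * comb d t\<bar>)) * real (Suc k)"
        by (subst Bochner_Integration.integral_diff[symmetric])
          (auto intro!: integrable_abs h comb_integrable Bochner_Integration.integrable_diff integrable_mult_right)
      ultimately show ?thesis by (simp add: mult_nonpos_nonneg)
    qed
    ultimately show ?thesis by (intro LIMSEQ_le_const2) auto
  qed
  from this[of d] this[of "\<lambda>i. - d i"] show ?thesis by (simp add: lincomb_uminus h_def)
qed

lemma plain_integral:
  assumes "\<rho> \<in> borel_measurable borel"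
  shows "(LINT t|\<nu>. indicator {-1<..<1} t * (\<rho> t * comb c t)) = (LINT t|\<nu>. \<rho> t * comb c t)"
proof (rule integral_cong_AE)
  have [measurable]: "\<rho> \<in> borel_measurable \<nu>" "comb c \<in> borel_measurable \<nu>"
    by (intro measurable_borel assms comb_measurable)+
  have [measurable]: "(indicator {-1<..<1} :: real \<Rightarrow> real) \<in> borel_measurable \<nu>"
    by (rule measurable_borel) measurable
  show "(\<lambda>t. indicator {-1<..<1} t * (\<rho> t * comb c t)) \<in> borel_measurable \<nu>" by measurable
  show "(\<lambda>t. \<rho> t * comb c t) \<in> borel_measurable \<nu>" by measurable
  have "finite {-1, 1 :: real}" by simp
  from AE_not_finite[OF this] AE_space
  show "AE t in \<nu>. indicator {-1<..<1} t * (\<rho> t * comb c t) = \<rho> t * comb c t"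
    by eventually_elim (auto simp: indicator_def)
qed

lemma pattern_integrable: "integrable \<nu> (\<lambda>t. set_pattern A t * comb c t)"
proof -
  obtain B where B: "\<forall>t\<in>{-1..1}. \<bar>comb c t\<bar> \<le> B" using lincomb_bounded by blast
  have "(\<lambda>t. set_pattern A t * comb c t) \<in> borel_measurable \<nu>"
    by (intro borel_measurable_times measurable_borel sign_pattern_borel comb_measurable)
  then show ?thesis by (rule integrable_bounded[of _ "{}"]) (use B in \<open>auto simp: abs_mult\<close>)
qed

text \<open>
  Normalise both patterns to have value 1 immediately to the left of 0, hence -1 immediately to the right. The
  pattern with jumps A on the left and B on the right, and none at 0, is followed by the difference of the two: to
  the left it is the first pattern, to the right the negative of the second, up to a global sign.
\<close>

lemma orthogonal_patterns_eq:
  assumes A: "finite A" "A \<subseteq> {-1<..<1} - {0}" and B: "finite B" "B \<subseteq> {-1<..<1} - {0}"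
    and orthA: "\<And>c. (LINT t|\<nu>. set_pattern (insert 0 A) t * comb c t) = 0"
    and orthB: "\<And>c. (LINT t|\<nu>. set_pattern (insert 0 B) t * comb c t) = 0"
    and few: "card (A \<inter> {..<0}) + card (B \<inter> {0<..}) < n"
  shows "A = B"
proof -
  define M where "M = (A \<inter> {..<0}) \<union> (B \<inter> {0<..})"
  have finM: "finite M" using A B by (simp add: M_def)
  have "card M < n" using few card_Un_le[of "A \<inter> {..<0}" "B \<inter> {0<..}"] by (simp add: M_def)
  from weak_sign_pattern[OF finM this, of "\<lambda>z. z"] obtain c where c: "\<exists>i<n. c i \<noteq> 0"
    "\<And>t. t \<in> {-1<..<1} - M \<Longrightarrow> set_pattern M t * comb c t \<ge> 0" unfolding image_ident by blast
  define \<alpha> where "\<alpha> = (-1 :: real) ^ card (A \<inter> {..<0})"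
  define \<beta> where "\<beta> = (-1 :: real) ^ card (B \<inter> {..<0})"
  have ab: "\<alpha> = 1 \<or> \<alpha> = -1" "\<beta> = 1 \<or> \<beta> = -1"
    unfolding \<alpha>_def \<beta>_def by (cases "even (card (A \<inter> {..<0}))"; simp)
      (cases "even (card (B \<inter> {..<0}))"; simp)
  define u where "u = (\<lambda>t. \<alpha> * set_pattern (insert 0 A) t)"
  define v where "v = (\<lambda>t. \<beta> * set_pattern (insert 0 B) t)"
  have uv: "u t = 1 \<or> u t = -1" "v t = 1 \<or> v t = -1" for t
    using ab sign_pattern_cases[of "\<lambda>z. z" "insert 0 A" t] sign_pattern_cases[of "\<lambda>z. z" "insert 0 B" t]
    by (auto simp: u_def v_def)
  have Mneg: "\<alpha> * set_pattern M t = u t" if "t < 0" for t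
  proof -
    have "set_pattern M t = set_pattern (A \<inter> {..<0}) t * set_pattern (B \<inter> {0<..}) t"
      unfolding M_def by (intro sign_pattern_Un neg_pos_disjoint finite_Int disjI1 A B)
    moreover have "set_pattern (B \<inter> {0<..}) t = 1" by (rule sign_pattern_all_greater) (use that in auto)
    moreover have "set_pattern (insert 0 A) t = set_pattern (A \<inter> {..<0}) t"
      by (rule pattern_halves(1)) (use A that in auto)
    ultimately show ?thesis by (simp add: u_def)
  qed
  have Mpos: "\<alpha> * set_pattern M t = - v t" if "t > 0" for t
  proof -
    have "set_pattern M t = set_pattern (A \<inter> {..<0}) t * set_pattern (B \<inter> {0<..}) t"
      unfolding M_def by (intro sign_pattern_Un neg_pos_disjoint finite_Int disjI1 A B)
    moreover have "set_pattern (A \<inter> {..<0}) t = \<alpha>"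
      unfolding \<alpha>_def by (rule sign_pattern_all_le) (use that in auto)
    moreover have "v t = - set_pattern (B \<inter> {0<..}) t"
    proof -
      have "v t = \<beta> * - (\<beta> * set_pattern (B \<inter> {0<..}) t)"
        unfolding v_def \<beta>_def by (subst pattern_halves(2)) (use B that in auto)
      then show ?thesis using ab(2) by auto
    qed
    ultimately show ?thesis using ab(1) by auto
  qed
  have "AE t in \<nu>. t \<in> {-1<..<1} \<longrightarrow> u t - v t = 0"
  proof (rule orthogonal_one_signed)
    show "\<exists>i<n. \<alpha> * c i \<noteq> 0" using c(1) ab by auto
    show m: "(\<lambda>t. u t - v t) \<in> borel_measurable borel"
      unfolding u_def v_def
      by (intro borel_measurable_diff borel_measurable_times borel_measurable_const sign_pattern_borel)
    show "\<bar>u t - v t\<bar> \<le> 2" for t using uv[of t] by auto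
    show "0 \<le> (u t - v t) * lincomb n \<phi> (\<lambda>i. \<alpha> * c i) t" if t: "t \<in> {-1<..<1} - insert 0 M" for t
    proof -
      have ct: "0 \<le> set_pattern M t * comb c t" using c(2)[of t] t by auto
      consider "t < 0" | "t > 0" using t by force
      then show ?thesis
      proof cases
        case 1
        then have "set_pattern M t = \<alpha> * u t" using Mneg[of t] ab by auto
        then have "0 \<le> u t * (\<alpha> * comb c t)" using ct by (simp add: mult_ac)
        then show ?thesis unfolding lincomb_scale using uv[of t] by auto
      next
        case 2
        then have "set_pattern M t = - (\<alpha> * v t)" using Mpos[of t] ab by auto
        then have "v t * (\<alpha> * comb c t) \<le> 0" using ct by (simp add: mult_ac)
        then show ?thesis unfolding lincomb_scale using uv[of t] by auto
      qed
    qed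
    have "(LINT t|\<nu>. (u t - v t) * comb (\<lambda>i. \<alpha> * c i) t) =
        (LINT t|\<nu>. \<alpha> * (set_pattern (insert 0 A) t * comb (\<lambda>i. \<alpha> * c i) t)
          - \<beta> * (set_pattern (insert 0 B) t * comb (\<lambda>i. \<alpha> * c i) t))"
      by (rule Bochner_Integration.integral_cong) (auto simp: u_def v_def algebra_simps)
    also have "\<dots> = 0"
      by (subst Bochner_Integration.integral_diff) (simp_all add: pattern_integrable orthA orthB)
    finally show "(LINT t|\<nu>. indicator {-1<..<1} t * ((u t - v t) * lincomb n \<phi> (\<lambda>i. \<alpha> * c i) t)) = 0"
      by (simp add: plain_integral[OF m])
  qed (use finM in auto)
  then have ae: "AE t in \<nu>. t \<in> {-1<..<1} \<longrightarrow> u t = v t" by eventually_elim simp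
  have AE: "AE t in \<nu>. t \<in> {-1<..<1} \<longrightarrow> set_pattern (insert 0 A) t = (\<alpha> * \<beta>) * set_pattern (insert 0 B) t"
    using ae by eventually_elim (use ab in \<open>auto simp: u_def v_def\<close>)
  have AE': "AE t in \<nu>. t \<in> {-1<..<1} \<longrightarrow> set_pattern (insert 0 B) t = (\<alpha> * \<beta>) * set_pattern (insert 0 A) t"
    using ae by eventually_elim (use ab in \<open>auto simp: u_def v_def\<close>)
  have "insert 0 A \<subseteq> (\<lambda>z. z) ` insert 0 B"
    by (rule set_pattern_points[OF inside _ _ _ AE]) (use A B in auto)
  moreover have "insert 0 B \<subseteq> (\<lambda>z. z) ` insert 0 A"
    by (rule set_pattern_points[OF inside _ _ _ AE']) (use A B in auto)
  moreover have "0 \<notin> A" "0 \<notin> B" using A B by auto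
  ultimately show ?thesis unfolding image_ident by blast
qed

text \<open>
  The points of A are those of the canonical sign function other than 0. Both orders of the two
  patterns are needed in the final comparison, because it is not known on which side of 0 the error has the
  smaller number of jumps.
\<close>

lemma best_approximation_unique:
  assumes f: "f \<in> J0" and nm: "n = 2 * m" and A: "finite A" "A \<subseteq> {-1<..<1} - {0}"
    and cards: "card (A \<inter> {..<0}) = m" "card (A \<inter> {0<..}) = m"
    and orthA: "\<And>c. (LINT t|\<nu>. set_pattern (insert 0 A) t * comb c t) = 0"
    and best: "\<And>d. err f c1 \<le> err f d" "\<And>d. err f c2 \<le> err f d"
  shows "comb c1 = comb c2"
proof (rule ccontr)
  assume ne: "comb c1 \<noteq> comb c2"
  have fi: "integrable \<nu> f" by (rule J0_integrable[OF f])
  have cf: "continuous_on ({-1..1} - {0}) f" using f by (simp add: J0_def)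
  have cg: "continuous_on S (comb c)" if "S \<subseteq> {-1..1}" for S c
    by (rule continuous_on_subset[OF continuous_lincomb that])
  have c12: "\<exists>i<n. c1 i - c2 i \<noteq> 0"
  proof -
    obtain t where "comb c1 t \<noteq> comb c2 t" using ne by auto
    then show ?thesis by (intro lincomb_nonzero[of n \<phi> _ t]) (simp add: lincomb_diff)
  qed
  define c where "c = (\<lambda>i. (1 / 2) * c1 i + (1 / 2) * c2 i)"
  have gc: "comb c t = (comb c1 t + comb c2 t) / 2" for t
    unfolding c_def lincomb_add lincomb_scale by simp
  define k where "k = (\<lambda>t. \<bar>f t - comb c1 t\<bar> / 2 + \<bar>f t - comb c2 t\<bar> / 2 - \<bar>f t - comb c t\<bar>)"
  have k0: "k t \<ge> 0" for t unfolding k_def gc by (auto simp: abs_if field_simps)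
  have ki: "integrable \<nu> k"
    unfolding k_def using err_integrable[OF fi] by (intro Bochner_Integration.integrable_diff
      Bochner_Integration.integrable_add integrable_divide) auto
  have "(LINT t|\<nu>. k t) = err f c1 / 2 + err f c2 / 2 - err f c"
    unfolding k_def err_def L1_norm_def using err_integrable[OF fi] by simp
  moreover have "err f c1 = err f c2" using best by (simp add: order_antisym)
  ultimately have Ik: "(LINT t|\<nu>. k t) = err f c1 - err f c" by simp
  moreover have "(LINT t|\<nu>. k t) \<ge> 0" using k0 by simp
  ultimately have ec: "err f c = err f c1" using best(1)[of c] by linarith
  then have "(LINT t|\<nu>. k t) = 0" using Ik by simp
  then have AEk: "AE t in \<nu>. k t = 0"
    by (subst (asm) integral_nonneg_eq_0_iff_AE[OF ki]) (use k0 in auto)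
  \<comment> \<open>The defect k in the triangle inequality has integral 0; off 0 it is continuous.\<close>
  have kz: "k t = 0" if t: "t \<in> {-1<..<1} - {0}" for t
  proof (rule ccontr)
    assume "k t \<noteq> 0"
    have ck: "continuous_on ({-1<..<1} - {0}) k"
      unfolding k_def by (intro continuous_intros cg continuous_on_subset[OF cf]) auto
    have "open ({-1<..<1} - {0 :: real})" by (intro open_Diff) auto
    then have "open ({s \<in> {-1<..<1} - {0}. k s \<noteq> 0})"
      using continuous_open_preimage[OF ck, of "- {0}"] by (simp add: vimage_def Int_def open_Compl)
    moreover have "AE s in \<nu>. s \<in> {s \<in> {-1<..<1} - {0}. k s \<noteq> 0} \<longrightarrow> False"
      using AEk by eventually_elim auto
    moreover have "t \<in> {s \<in> {-1<..<1} - {0}. k s \<noteq> 0} \<inter> {-1..1}" using t \<open>k t \<noteq> 0\<close> by auto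
    ultimately show False using AE_open_exists[of "{s \<in> {-1<..<1} - {0}. k s \<noteq> 0}" "\<lambda>_. False"] by blast
  qed
  define h where "h = (\<lambda>t. f t - comb c t)"
  define P where "P = {t \<in> {-1<..<1} - {0}. h t = 0}"
  have Pz: "comb (\<lambda>i. c1 i - c2 i) t = 0" if "t \<in> P" for t
  proof -
    have "k t = 0" "h t = 0" using kz that by (auto simp: P_def)
    then have "\<bar>f t - comb c1 t\<bar> + \<bar>f t - comb c2 t\<bar> = 0" unfolding k_def h_def by simp
    then have "f t - comb c1 t = 0" "f t - comb c2 t = 0" by (simp_all add: add_nonneg_eq_0_iff)
    then show ?thesis unfolding lincomb_diff by simp
  qed
  have P: "finite P" "card P < n"
    by (rule few_zeros[OF c12 _ Pz]; auto simp: P_def)+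
  have "\<exists>J\<subseteq>insert 0 P. \<exists>\<epsilon>\<in>{1, -1}. \<forall>t\<in>{-1<..<1} - insert 0 P. sgn (h t) = \<epsilon> * set_pattern J t"
  proof (rule sgn_eq_sign_pattern)
    show "continuous_on ({-1<..<1} - insert 0 P) h"
      unfolding h_def by (intro continuous_intros cg continuous_on_subset[OF cf]) auto
  qed (use P in \<open>auto simp: P_def\<close>)
  then obtain J \<epsilon> where J': "J \<subseteq> insert 0 P" "\<epsilon> \<in> {1, -1}"
    "\<forall>t\<in>{-1<..<1} - insert 0 P. sgn (h t) = \<epsilon> * set_pattern J t" by (elim exE bexE conjE)
  have "\<epsilon> = 1 \<or> \<epsilon> = -1" using J'(2) by simp
  note J = J'(1) this J'(3)[rule_format]
  have finJ: "finite J" using J(1) P finite_subset by blast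
  have out: "AE t in \<nu>. t \<in> {-1<..<1} - insert 0 P"
  proof -
    have "finite ({-1, 1, 0} \<union> P)" using P by simp
    from AE_not_finite[OF this] AE_space show ?thesis by eventually_elim auto
  qed
  have orthJ: "(LINT t|\<nu>. set_pattern J t * comb d t) = 0" for d
  proof -
    have "(LINT t|\<nu>. sgn (f t - comb c t) * comb d t) = 0"
    proof (rule best_orthogonal[OF fi])
      show "err f c \<le> err f d" for d using ec best by simp
      show "AE t in \<nu>. f t - comb c t \<noteq> 0" using out by eventually_elim (auto simp: P_def h_def)
    qed
    moreover have "(LINT t|\<nu>. sgn (f t - comb c t) * comb d t) = (LINT t|\<nu>. \<epsilon> * (set_pattern J t * comb d t))"
    proof (rule integral_cong_AE)
      have [measurable]: "f \<in> borel_measurable \<nu>" by (rule J0_measurable[OF f])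
      have [measurable]: "comb c \<in> borel_measurable \<nu>" for c by (rule comb_measurable)
      show "(\<lambda>t. sgn (f t - comb c t) * comb d t) \<in> borel_measurable \<nu>" by measurable
      show "(\<lambda>t. \<epsilon> * (set_pattern J t * comb d t)) \<in> borel_measurable \<nu>"
        by (intro borel_measurable_integrable integrable_mult_right pattern_integrable)
      show "AE t in \<nu>. sgn (f t - comb c t) * comb d t = \<epsilon> * (set_pattern J t * comb d t)"
        using out
      proof eventually_elim
        case (elim t)
        then show ?case using J(3)[OF elim] by (simp add: h_def)
      qed
    qed
    ultimately show ?thesis using J(2) by auto
  qed
  \<comment> \<open>A pattern with fewer than n jumps is not orthogonal to the space.\<close>
  have "\<not> card J < n"
  proof
    assume "card J < n"
    from weak_sign_pattern[OF finJ this, of "\<lambda>z. z"] obtain d where d: "\<exists>i<n. d i \<noteq> 0"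
      "\<And>t. t \<in> {-1<..<1} - J \<Longrightarrow> set_pattern J t * comb d t \<ge> 0" unfolding image_ident by blast
    have "AE t in \<nu>. t \<in> {-1<..<1} \<longrightarrow> set_pattern J t = 0"
      by (rule orthogonal_one_signed[OF d(1), where M = 1 and F = J])
        (use finJ d(2) orthJ in \<open>auto simp: plain_integral sign_pattern_borel\<close>)
    then show False using AE_interval_exists[of "-1" 1 "\<lambda>_. False"] by simp
  qed
  then have cJ: "n \<le> card J" by simp
  have "0 \<in> J"
  proof (rule ccontr)
    assume "0 \<notin> J"
    then have "J \<subseteq> P" using J(1) by auto
    then have "card J \<le> card P" using P card_mono by blast
    then show False using cJ P by simp
  qed
  define B where "B = J - {0}"
  have B: "finite B" "B \<subseteq> P" "J = insert 0 B" "0 \<notin> B"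
    using finJ J(1) \<open>0 \<in> J\<close> by (auto simp: B_def)
  have Bsub: "B \<subseteq> {-1<..<1} - {0}" using B(2) by (auto simp: P_def)
  have "card J = Suc (card B)" using B by simp
  moreover have "card B \<le> card P" using B P card_mono by blast
  ultimately have cB: "Suc (card B) = n" using cJ P by linarith
  have "card B = card (B \<inter> {..<0}) + card (B \<inter> {0<..})"
    by (rule card_neg_pos[OF B(1,4)])
  then consider "card (B \<inter> {0<..}) < m" | "card (B \<inter> {..<0}) < m" using cB nm by linarith
  then have "A = B"
  proof cases
    case 1
    show ?thesis
      by (rule orthogonal_patterns_eq[OF A B(1) Bsub orthA orthJ[unfolded B(3)]]) (use 1 cards nm in simp)
  next
    case 2
    show ?thesis
      by (rule orthogonal_patterns_eq[OF B(1) Bsub A orthJ[unfolded B(3)] orthA, symmetric])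
        (use 2 cards nm in simp)
  qed
  moreover have "card A = card (A \<inter> {..<0}) + card (A \<inter> {0<..})"
    by (rule card_neg_pos) (use A in auto)
  ultimately show False using cB cards nm by simp
qed

end

section \<open>Alternation and simple zeros\<close>

text \<open>
  That a function alternates on a finite set is expressed by a sign pattern jumping at the points of
  that very set: it changes sign from each point to the next. The predicate P covers both
  zeros and simple zeros.
\<close>

lemma alternation_count:
  fixes u :: "real \<Rightarrow> real"
  assumes "finite T" "T \<noteq> {}" "\<And>t. t \<in> T \<Longrightarrow> \<epsilon> * set_pattern T t * u t > 0"
    and "\<And>x y. x \<in> T \<Longrightarrow> y \<in> T \<Longrightarrow> x < y \<Longrightarrow> u x * u y < 0 \<Longrightarrow> \<exists>z\<in>{x<..<y}. P z"
  shows "\<exists>Z. finite Z \<and> Suc (card Z) = card T \<and> Z \<subseteq> {Min T<..<Max T} \<and> (\<forall>z\<in>Z. P z)"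
  using assms
proof (induction T rule: finite_linorder_max_induct)
  case empty
  then show ?case by simp
next
  case (insert b A)
  have b: "b \<notin> A" using insert.hyps(2) by blast
  show ?case
  proof (cases "A = {}")
    case True
    then show ?thesis by (intro exI[of _ "{}"]) auto
  next
    case False
    have pat: "set_pattern (insert b A) t = set_pattern A t" if "t \<in> A" for t
      using sign_pattern_insert[OF insert.hyps(1) b, of "\<lambda>z. z" t] insert.hyps(2) that by simp
    have A: "\<epsilon> * set_pattern A t * u t > 0" if "t \<in> A" for t
      using insert.prems(2)[of t] pat[OF that] that by simp
    obtain Z where Z: "finite Z" "Suc (card Z) = card A" "Z \<subseteq> {Min A<..<Max A}" "\<forall>z\<in>Z. P z"
      using insert.IH[OF False A insert.prems(3)] by blast
    have M: "Max A \<in> A" using insert.hyps(1) False by (rule Max_in)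
    have "set_pattern A (Max A) = (-1) ^ card A"
      by (rule sign_pattern_all_le) (use insert.hyps(1) in auto)
    then have 1: "\<epsilon> * (-1) ^ card A * u (Max A) > 0" using A[OF M] by simp
    have "set_pattern A b = (-1) ^ card A"
      by (rule sign_pattern_all_le) (use insert.hyps(2) in \<open>simp add: less_imp_le\<close>)
    then have "set_pattern (insert b A) b = - ((-1) ^ card A)"
      using sign_pattern_insert[OF insert.hyps(1) b, of "\<lambda>z. z" b] by simp
    then have 2: "\<epsilon> * (-1) ^ card A * u b < 0" using insert.prems(2)[of b] by simp
    have Mb: "Max A < b" using insert.hyps(2) M by blast
    have "u (Max A) * u b < 0"
    proof -
      have "(\<epsilon> * (-1) ^ card A * u (Max A)) * (\<epsilon> * (-1) ^ card A * u b) < 0"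
        using 1 2 by (rule mult_pos_neg)
      moreover have "(\<epsilon> * (-1) ^ card A * u (Max A)) * (\<epsilon> * (-1) ^ card A * u b) =
          (\<epsilon> * (-1) ^ card A)\<^sup>2 * (u (Max A) * u b)" by (simp add: power2_eq_square mult_ac)
      ultimately show ?thesis using zero_le_power2[of "\<epsilon> * (-1) ^ card A"]
        by (metis mult_nonneg_nonneg not_less)
    qed
    then obtain z where z: "z \<in> {Max A<..<b}" "P z" using insert.prems(3)[of "Max A" b] M Mb by blast
    have "z \<notin> Z" using Z(3) z(1) by fastforce
    moreover have "insert z Z \<subseteq> {Min (insert b A)<..<Max (insert b A)}"
    proof -
      have mM: "Min A \<le> Max A" using insert.hyps(1) M by simp
      moreover have "Min (insert b A) = Min A"
        using mM Mb by (simp add: Min_insert[OF insert.hyps(1) False] min_absorb2)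
      moreover have "Max (insert b A) = b" using insert.hyps(1) False Mb by (subst Max_insert) auto
      ultimately show ?thesis using Z(3) z(1) Mb by fastforce
    qed
    ultimately show ?thesis
      using Z z b insert.hyps(1) by (intro exI[of _ "insert z Z"]) auto
  qed
qed

lemma simple_zeros_uminus: "simple_zeros (\<lambda>t. - u t) = simple_zeros u"
  unfolding simple_zeros_def zeros_on_def by auto

text \<open>
  The zero is the infimum of the points of negative value. A function that vanishes on an interval
  between its positive and negative values has no simple zero there, which is why zeros on
  intervals are excluded.
\<close>

lemma simple_zero_between:
  fixes u :: "real \<Rightarrow> real"
  assumes cont: "continuous_on {x..y} u" and xy: "x < y" "u x > 0" "u y < 0"
    and sub: "{x..y} \<subseteq> {-1..1} - {0}"
    and nz: "\<And>p q. p < q \<Longrightarrow> x \<le> p \<Longrightarrow> q \<le> y \<Longrightarrow> \<exists>r\<in>{p<..<q}. u r \<noteq> 0"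
  shows "\<exists>z\<in>{x<..<y}. z \<in> simple_zeros u"
proof -
  define S where "S = {t \<in> {x..y}. u t < 0}"
  have S: "y \<in> S" "bdd_below S" using xy by (auto simp: S_def)
  define z where "z = Inf S"
  have z: "x \<le> z" "z \<le> y"
    unfolding z_def using S by (auto intro!: cInf_greatest cInf_lower simp: S_def)
  have before: "u t \<ge> 0" if "x \<le> t" "t < z" for t
  proof (rule ccontr)
    assume "\<not> u t \<ge> 0"
    then have "t \<in> S" using that z by (auto simp: S_def)
    then have "z \<le> t" unfolding z_def by (rule cInf_lower) (rule S)
    then show False using that by simp
  qed
  have after: "\<exists>t\<in>S. z \<le> t \<and> t < z + e" if "e > 0" for e
  proof -
    have "Inf S < z + e" using that by (simp add: z_def)
    then obtain t where "t \<in> S" "t < z + e" using cInf_lessD[of S] S by blast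
    moreover have "z \<le> t" unfolding z_def using \<open>t \<in> S\<close> S(2) by (rule cInf_lower)
    ultimately show ?thesis by blast
  qed
  have near: "\<exists>d>0. \<forall>t\<in>{x..y}. \<bar>t - z\<bar> < d \<longrightarrow> \<bar>u t - u z\<bar> < \<bar>u z\<bar>" if "u z \<noteq> 0"
    using cont z that unfolding continuous_on_iff dist_real_def
    by (metis atLeastAtMost_iff zero_less_abs_iff)
  have uz: "u z = 0"
  proof (rule ccontr)
    assume "u z \<noteq> 0"
    then obtain d where d: "d > 0" "\<And>t. t \<in> {x..y} \<Longrightarrow> \<bar>t - z\<bar> < d \<Longrightarrow> \<bar>u t - u z\<bar> < \<bar>u z\<bar>"
      using near by blast
    show False
    proof (cases "u z > 0")
      case True
      obtain t where t: "t \<in> S" "z \<le> t" "t < z + d" using after[OF d(1)] by blast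
      then have "\<bar>u t - u z\<bar> < \<bar>u z\<bar>" by (intro d(2)) (auto simp: S_def)
      then show False using True t(1) by (auto simp: S_def)
    next
      case False
      then have "u z < 0" using \<open>u z \<noteq> 0\<close> by simp
      then have "x < z" using xy z by (cases "x = z") auto
      define t where "t = max x (z - d / 2)"
      have t: "x \<le> t" "t < z" "\<bar>t - z\<bar> < d" using \<open>x < z\<close> d(1) by (auto simp: t_def)
      have "\<bar>u t - u z\<bar> < \<bar>u z\<bar>" by (rule d(2)) (use t z in auto)
      then show False using before[of t] t \<open>u z < 0\<close> by auto
    qed
  qed
  have zin: "x < z" "z < y" using z uz xy by (auto simp: less_le)
  have neg: "\<exists>\<^sub>F t in at z within {-1..1}. u t < 0"
    unfolding frequently_at
  proof (intro allI impI)
    fix d :: real assume "d > 0"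
    then obtain t where t: "t \<in> S" "z \<le> t" "t < z + d" using after by blast
    then have "t \<noteq> z" using uz by (auto simp: S_def)
    moreover have "t \<in> {-1..1}" using t(1) sub by (auto simp: S_def)
    ultimately show "\<exists>t\<in>{-1..1}. t \<noteq> z \<and> dist t z < d \<and> u t < 0"
      using t by (intro bexI[of _ t]) (auto simp: S_def dist_real_def)
  qed
  have pos: "\<exists>\<^sub>F t in at z within {-1..1}. u t > 0"
    unfolding frequently_at
  proof (intro allI impI)
    fix d :: real assume d: "d > 0"
    have "max x (z - d) < z" using zin d by auto
    then obtain r where r: "r \<in> {max x (z - d)<..<z}" "u r \<noteq> 0"
      using nz[of "max x (z - d)" z] zin by auto
    then have "u r > 0" using before[of r] by (auto simp: less_le)
    moreover have "r \<in> {x..y}" using r(1) zin by auto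
    then have "r \<in> {-1..1}" using sub by blast
    ultimately show "\<exists>t\<in>{-1..1}. t \<noteq> z \<and> dist t z < d \<and> u t > 0"
      using r by (intro bexI[of _ r]) (auto simp: dist_real_def)
  qed
  have "z \<in> {x..y}" using zin by simp
  then have "z \<in> {-1..1} - {0}" using sub by blast
  then have "z \<in> zeros_on ({-1..1} - {0}) u" using uz by (simp add: zeros_on_def)
  then have "z \<in> simple_zeros u" using pos neg by (simp add: simple_zeros_def)
  then show ?thesis using zin by auto
qed

lemma simple_zero_of_opposite_signs:
  fixes u :: "real \<Rightarrow> real"
  assumes cont: "continuous_on {x..y} u" and xy: "x < y" "u x * u y < 0"
    and sub: "{x..y} \<subseteq> {-1..1} - {0}"
    and nz: "\<And>p q. p < q \<Longrightarrow> x \<le> p \<Longrightarrow> q \<le> y \<Longrightarrow> \<exists>r\<in>{p<..<q}. u r \<noteq> 0"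
  shows "\<exists>z\<in>{x<..<y}. z \<in> simple_zeros u"
proof (cases "u x > 0")
  case True
  then have "u y < 0" using xy(2) by (simp add: mult_less_0_iff)
  then show ?thesis using simple_zero_between[OF cont xy(1) True _ sub nz] by blast
next
  case False
  then have s: "- u x > 0" "- u y < 0" using xy(2) by (auto simp: mult_less_0_iff)
  have "\<exists>z\<in>{x<..<y}. z \<in> simple_zeros (\<lambda>t. - u t)"
    by (rule simple_zero_between[OF continuous_on_minus[OF cont] xy(1) _ _ sub]) (use s nz in auto)
  then show ?thesis unfolding simple_zeros_uminus .
qed

definition alternates :: "nat \<Rightarrow> real set \<Rightarrow> (real \<Rightarrow> real) \<Rightarrow> bool" where
  "alternates k I u \<longleftrightarrow> (\<exists>T \<epsilon>. finite T \<and> T \<subseteq> I \<and> card T = Suc k \<and>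
     (\<forall>t\<in>T. \<epsilon> * set_pattern T t * u t > 0))"

definition halves :: "real set \<Rightarrow> real set \<Rightarrow> bool" where
  "halves I1 I2 \<longleftrightarrow> (I1, I2) \<in> {({-1..<0}, {0<..1}), ({0<..1}, {-1..<0})}"

lemma halves_sym: "halves I1 I2 \<Longrightarrow> halves I2 I1"
  by (auto simp: halves_def)

lemma perturbation_keeps_sign:
  fixes v e r :: real
  assumes "\<bar>e\<bar> < \<bar>v\<bar>" "r * v > 0"
  shows "r * (v + e) > 0"
proof (cases "v > 0")
  case True
  then have "r > 0" using assms(2) by (simp add: zero_less_mult_iff)
  moreover have "v + e > 0" using assms(1) True by linarith
  ultimately show ?thesis by simp
next
  case False
  then have "r < 0" "v < 0" using assms(2) by (auto simp: zero_less_mult_iff)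
  moreover have "v + e < 0" using assms(1) \<open>v < 0\<close> by linarith
  ultimately show ?thesis by (simp add: mult_neg_neg)
qed

lemma small_perturbation:
  fixes v p :: "real \<Rightarrow> real"
  assumes "finite T" "\<And>t. t \<in> T \<Longrightarrow> v t \<noteq> 0"
  shows "\<exists>\<delta>>0. \<forall>d. 0 < d \<and> d \<le> \<delta> \<longrightarrow> (\<forall>t\<in>T. \<bar>d * p t\<bar> < \<bar>v t\<bar>)"
  using assms
proof (induction T rule: finite_induct)
  case empty
  then show ?case by (intro exI[of _ 1]) auto
next
  case (insert x T)
  then obtain \<delta> where \<delta>: "\<delta> > 0" "\<forall>d. 0 < d \<and> d \<le> \<delta> \<longrightarrow> (\<forall>t\<in>T. \<bar>d * p t\<bar> < \<bar>v t\<bar>)" by auto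
  define e where "e = \<bar>v x\<bar> / (\<bar>p x\<bar> + 1)"
  have vx: "\<bar>v x\<bar> > 0" using insert.prems by simp
  have e: "e > 0" using vx by (simp add: e_def add_nonneg_pos)
  have "\<bar>d * p x\<bar> < \<bar>v x\<bar>" if "0 < d" "d \<le> e" for d
  proof -
    have "\<bar>d * p x\<bar> = d * \<bar>p x\<bar>" using that by (simp add: abs_mult)
    also have "\<dots> < d * (\<bar>p x\<bar> + 1)" using that by simp
    also have "\<dots> \<le> e * (\<bar>p x\<bar> + 1)" using that by (intro mult_right_mono) auto
    also have "\<dots> = \<bar>v x\<bar>" by (simp add: e_def add_nonneg_pos less_imp_neq[symmetric])
    finally show ?thesis .
  qed
  then show ?case using \<delta> e by (intro exI[of _ "min \<delta> e"]) auto
qed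

text \<open>
  W stands for the span of Y and the function to be approximated.
\<close>

locale few_sign_changes = haar_system \<phi> n "-1" 1 for \<phi> n +
  fixes W :: "(real \<Rightarrow> real) set" and m :: nat
  assumes nm: "n = 2 * m" and m: "m > 0"
    and W_closed: "\<And>u e c. u \<in> W \<Longrightarrow> (\<lambda>t. e * u t + lincomb n \<phi> c t) \<in> W"
    and W_cont: "\<And>u. u \<in> W \<Longrightarrow> continuous_on ({-1..1} - {0}) u"
    and W_simple: "\<And>u. u \<in> W \<Longrightarrow> finite (simple_zeros u) \<and> card (simple_zeros u) \<le> n"
    and W_half: "half_nondegenerate n W"
begin

lemma W_perturb: "u \<in> W \<Longrightarrow> (\<lambda>t. u t + e * comb c t) \<in> W"
  using W_closed[of u 1 "\<lambda>i. e * c i"] by (simp add: lincomb_scale)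

lemma half_subset: "halves I1 I2 \<Longrightarrow> I1 \<subseteq> {-1..1} - {0}"
  by (auto simp: halves_def)

lemma half_interval: "halves I1 I2 \<Longrightarrow> x \<in> I1 \<Longrightarrow> y \<in> I1 \<Longrightarrow> {x..y} \<subseteq> I1"
  by (auto simp: halves_def)

text \<open>
  Alternation is stable under small perturbations, and for all but countably many factors d the
  perturbation by d times a nonzero element of Y vanishes on no interval: otherwise it would
  vanish at a rational point where that element does not, and the point determines d.
\<close>

lemma alternation_bound:
  assumes u: "u \<in> W" and I: "halves I1 I2" and k: "alternates k1 I1 u" "alternates k2 I2 u"
  shows "k1 + k2 \<le> n"
proof -
  obtain T1 e1 where T1: "finite T1" "T1 \<subseteq> I1" "card T1 = Suc k1" "\<forall>t\<in>T1. e1 * set_pattern T1 t * u t > 0"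
    using k(1) unfolding alternates_def by blast
  obtain T2 e2 where T2: "finite T2" "T2 \<subseteq> I2" "card T2 = Suc k2" "\<forall>t\<in>T2. e2 * set_pattern T2 t * u t > 0"
    using k(2) unfolding alternates_def by blast
  let ?p = "comb (\<lambda>_. 1)"
  have pz: "finite {t \<in> {-1<..<1}. ?p t = 0}" using haar[of 0 "\<lambda>_. 1"] nm m by simp
  have "finite (T1 \<union> T2)" using T1 T2 by simp
  moreover have "u t \<noteq> 0" if "t \<in> T1 \<union> T2" for t using T1(4) T2(4) that by force
  ultimately obtain \<delta> where \<delta>: "\<delta> > 0"
    "\<forall>d. 0 < d \<and> d \<le> \<delta> \<longrightarrow> (\<forall>t\<in>T1 \<union> T2. \<bar>d * ?p t\<bar> < \<bar>u t\<bar>)"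
    using small_perturbation[of "T1 \<union> T2" u ?p] by blast
  have "uncountable ({0<..<\<delta>} - (\<lambda>r. - u r / ?p r) ` \<rat>)"
    by (rule uncountable_minus_countable) (use \<delta>(1) uncountable_open_interval countable_rat in auto)
  then obtain d where d: "d \<in> {0<..<\<delta>}" "d \<notin> (\<lambda>r. - u r / ?p r) ` \<rat>"
    by (metis DiffE countable_empty ex_in_conv)
  \<comment> \<open>The choice of d keeps w from vanishing at rational points other than zeros of the perturbing function.\<close>
  define w where "w = (\<lambda>t. u t + d * ?p t)"
  have w: "w \<in> W" unfolding w_def by (rule W_perturb[OF u])
  have sign: "r * w t > 0" if "t \<in> T1 \<union> T2" "r * u t > 0" for r t
    unfolding w_def by (rule perturbation_keeps_sign) (use \<delta>(2) d that in auto)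
  have nz: "\<exists>r\<in>{p<..<q}. w r \<noteq> 0" if pq: "p < q" "-1 \<le> p" "q \<le> 1" for p q
  proof (rule ccontr)
    assume *: "\<not> ?thesis"
    have "infinite (\<rat> \<inter> {p<..<q})"
    proof
      assume fin: "finite (\<rat> \<inter> {p<..<q})"
      then obtain s where s: "p < s" "s < q" "{p<..<s} \<inter> (\<rat> \<inter> {p<..<q}) = {}"
      proof (cases "\<rat> \<inter> {p<..<q} = {}")
        case True
        then show ?thesis using that[of "(p + q) / 2"] pq by auto
      next
        case False
        then have "Min (\<rat> \<inter> {p<..<q}) \<in> \<rat> \<inter> {p<..<q}" using fin Min_in by blast
        moreover have "{p<..<Min (\<rat> \<inter> {p<..<q})} \<inter> (\<rat> \<inter> {p<..<q}) = {}"
          using fin by (auto dest: Min_le)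
        ultimately show ?thesis using that[of "Min (\<rat> \<inter> {p<..<q})"] by auto
      qed
      obtain r where "r \<in> \<rat>" "p < r" "r < s" using Rats_dense_in_real[OF s(1)] by blast
      then show False using s by auto
    qed
    then obtain r where r: "r \<in> \<rat>" "r \<in> {p<..<q}" "r \<notin> {t \<in> {-1<..<1}. ?p t = 0}"
    proof -
      have "\<not> \<rat> \<inter> {p<..<q} \<subseteq> {t \<in> {-1<..<1}. ?p t = 0}"
        using \<open>infinite (\<rat> \<inter> {p<..<q})\<close> pz finite_subset by blast
      then obtain r where "r \<in> \<rat> \<inter> {p<..<q}" "r \<notin> {t \<in> {-1<..<1}. ?p t = 0}" by blast
      then show thesis using that by blast
    qed
    then have "?p r \<noteq> 0" using pq by auto
    moreover have "w r = 0" using * r(2) by blast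
    ultimately have "d = - u r / ?p r" by (simp add: w_def field_simps)
    then show False using d(2) r(1) by blast
  qed
  have zs: "\<exists>Z. finite Z \<and> Suc (card Z) = card T \<and> Z \<subseteq> {Min T<..<Max T} \<and> (\<forall>z\<in>Z. z \<in> simple_zeros w)"
    if H: "halves J1 J2" and T: "finite T" "T \<subseteq> J1" "T \<noteq> {}" "\<forall>t\<in>T. e * set_pattern T t * u t > 0"
      "T \<subseteq> T1 \<union> T2" for J1 J2 T e
  proof (rule alternation_count[OF T(1,3)])
    show "e * set_pattern T t * w t > 0" if "t \<in> T" for t by (rule sign) (use T that in auto)
    show "\<exists>z\<in>{x<..<y}. z \<in> simple_zeros w" if xy: "x \<in> T" "y \<in> T" "x < y" "w x * w y < 0" for x y
    proof -
      have sub: "{x..y} \<subseteq> {-1..1} - {0}"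
        using half_interval[OF H, of x y] half_subset[OF H] T(2) xy by blast
      have "x \<in> {x..y}" "y \<in> {x..y}" using xy(3) by auto
      then have "x \<in> {-1..1}" "y \<in> {-1..1}" using sub by blast+
      then have "-1 \<le> x" "y \<le> 1" by auto
      then show ?thesis
        by (intro simple_zero_of_opposite_signs[OF continuous_on_subset[OF W_cont[OF w] sub] xy(3,4) sub] nz)
          auto
    qed
  qed
  have ne: "T1 \<noteq> {}" "T2 \<noteq> {}" using T1(3) T2(3) by auto
  obtain Z1 where Z1: "finite Z1" "Suc (card Z1) = card T1" "Z1 \<subseteq> {Min T1<..<Max T1}" "Z1 \<subseteq> simple_zeros w"
    using zs[OF I T1(1,2) ne(1) T1(4)] by blast
  obtain Z2 where Z2: "finite Z2" "Suc (card Z2) = card T2" "Z2 \<subseteq> {Min T2<..<Max T2}" "Z2 \<subseteq> simple_zeros w"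
    using zs[OF halves_sym[OF I] T2(1,2) ne(2) T2(4)] by blast
  have mm: "Min T1 \<in> I1" "Max T1 \<in> I1" "Min T2 \<in> I2" "Max T2 \<in> I2"
    using T1 T2 ne Min_in Max_in by blast+
  have "Z1 \<inter> Z2 = {}"
  proof (rule equals0I)
    fix z assume "z \<in> Z1 \<inter> Z2"
    then have "Min T1 < z" "z < Max T1" "Min T2 < z" "z < Max T2" using Z1(3) Z2(3) by auto
    then show False using mm I by (auto simp: halves_def)
  qed
  then have "card (Z1 \<union> Z2) = k1 + k2" using Z1 Z2 T1(3) T2(3) by (simp add: card_Un_disjoint)
  moreover have "card (Z1 \<union> Z2) \<le> card (simple_zeros w)"
    using W_simple[OF w] Z1(4) Z2(4) by (intro card_mono) auto
  ultimately show ?thesis using W_simple[OF w] by linarith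
qed

end

section \<open>The sign of the interpolation error\<close>

context few_sign_changes
begin

definition nodes :: "real set \<Rightarrow> real set \<Rightarrow> real set \<Rightarrow> real set \<Rightarrow> bool" where
  "nodes I1 I2 N1 N2 \<longleftrightarrow> halves I1 I2 \<and> N1 \<subseteq> I1 \<inter> {-1<..<1} \<and> N2 \<subseteq> I2 \<inter> {-1<..<1} \<and>
     finite N1 \<and> finite N2 \<and> card N1 = m \<and> card N2 = m"

lemma nodes_sym: "nodes I1 I2 N1 N2 \<Longrightarrow> nodes I2 I1 N2 N1"
  using halves_sym by (auto simp: nodes_def)

lemma halves_disjoint: "halves I1 I2 \<Longrightarrow> I1 \<inter> I2 = {}"
  by (auto simp: halves_def)

lemma nodes_disjoint: "nodes I1 I2 N1 N2 \<Longrightarrow> N1 \<inter> N2 = {}"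
  using halves_disjoint[of I1 I2] unfolding nodes_def by blast

lemma node_interpolation:
  assumes "nodes I1 I2 N1 N2"
  shows "\<exists>c. (\<forall>b\<in>N1. comb c b = v b) \<and> (\<forall>b\<in>N2. comb c b = w b)"
proof -
  have d: "N1 \<inter> N2 = {}" by (rule nodes_disjoint[OF assms])
  have "card (N1 \<union> N2) = n" using assms d nm by (simp add: nodes_def card_Un_disjoint)
  then obtain c where c: "\<forall>b\<in>N1 \<union> N2. comb c b = (if b \<in> N1 then v b else w b)"
    using interpolation[of "N1 \<union> N2" "\<lambda>b. if b \<in> N1 then v b else w b"] assms
    by (auto simp: nodes_def)
  show ?thesis using c d by (intro exI[of _ c]) auto
qed

text \<open>
  The m nodes on one half, together with two points at which v has opposite signs relative to the
  pattern of the nodes, are m + 2 points on which a perturbation of v alternates: at the nodes v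
  vanishes and the perturbation decides the sign. With the m sign changes on the other half this exceeds n.
\<close>

lemma no_sign_conflict:
  assumes N: "nodes I1 I2 N1 N2" and v: "v \<in> W" and zero: "\<And>b. b \<in> N2 \<Longrightarrow> v b = 0"
    and alt: "alternates m I1 v" and t: "t1 \<in> I2" "t2 \<in> I2"
    and conflict: "set_pattern N2 t1 * v t1 > 0" "set_pattern N2 t2 * v t2 < 0"
  shows False
proof -
  have I: "halves I1 I2" "finite N2" "card N2 = m" "N2 \<subseteq> I2" using N by (auto simp: nodes_def)
  have tN: "t1 \<notin> N2" "t2 \<notin> N2" "t1 \<noteq> t2" using zero conflict by force+
  define T where "T = N2 \<union> {t1, t2}"
  \<comment> \<open>The two additional points reverse the pattern from the smaller one on, up to the larger one.\<close>
  define \<epsilon> where "\<epsilon> = (if t1 < t2 then -1 else 1 :: real)"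
  have T: "finite T" "T \<subseteq> I2" "card T = Suc (Suc m)"
    using I t tN by (auto simp: T_def)
  have split: "set_pattern T s = set_pattern N2 s * set_pattern {t1, t2} s" for s
    unfolding T_def by (rule sign_pattern_Un) (use I tN in auto)
  have pair: "set_pattern {t1, t2} s = (if s < t1 then 1 else -1) * (if s < t2 then 1 else -1)" for s
    using tN(3) by (simp add: sign_pattern_def)
  have t1v: "\<epsilon> * set_pattern T t1 * v t1 > 0"
    unfolding split pair \<epsilon>_def using conflict(1) tN(3) by auto
  have t2v: "\<epsilon> * set_pattern T t2 * v t2 > 0"
    unfolding split pair \<epsilon>_def using conflict(2) tN(3) by auto
  obtain c where c: "\<forall>b\<in>N1. comb c b = 0" "\<forall>b\<in>N2. comb c b = \<epsilon> * set_pattern T b"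
    using node_interpolation[OF N, of "\<lambda>_. 0" "\<lambda>b. \<epsilon> * set_pattern T b"] by blast
  let ?p = "comb c"
  obtain T1 e1 where T1: "finite T1" "T1 \<subseteq> I1" "card T1 = Suc m" "\<forall>t\<in>T1. e1 * set_pattern T1 t * v t > 0"
    using alt unfolding alternates_def by blast
  have "v t \<noteq> 0" if "t \<in> T1 \<union> {t1, t2}" for t using T1(4) conflict that by force
  then obtain \<delta> where \<delta>: "\<delta> > 0" "\<forall>d. 0 < d \<and> d \<le> \<delta> \<longrightarrow> (\<forall>t\<in>T1 \<union> {t1, t2}. \<bar>d * ?p t\<bar> < \<bar>v t\<bar>)"
    using small_perturbation[of "T1 \<union> {t1, t2}" v ?p] T1(1) by blast
  define u where "u = (\<lambda>t. v t + \<delta> * ?p t)"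
  have sign: "r * u t > 0" if "t \<in> T1 \<union> {t1, t2}" "r * v t > 0" for r t
    unfolding u_def by (rule perturbation_keeps_sign) (use \<delta> that in auto)
  have "alternates m I1 u"
    unfolding alternates_def using T1 sign by (intro exI[of _ T1] exI[of _ e1]) auto
  moreover have "alternates (Suc m) I2 u"
    unfolding alternates_def
  proof (intro exI[of _ T] exI[of _ \<epsilon>] conjI ballI)
    fix s assume "s \<in> T"
    then consider "s \<in> N2" | "s = t1" | "s = t2" by (auto simp: T_def)
    then show "\<epsilon> * set_pattern T s * u s > 0"
    proof cases
      case 1
      have "\<epsilon> * \<epsilon> = 1" by (simp add: \<epsilon>_def)
      have "\<epsilon> * set_pattern T s * u s = \<delta> * (\<epsilon> * \<epsilon>) * (set_pattern T s * set_pattern T s)"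
        using 1 zero c(2) by (simp add: u_def mult_ac)
      then show ?thesis using \<delta>(1) \<open>\<epsilon> * \<epsilon> = 1\<close> by simp
    qed (use sign t1v t2v in auto)
  qed (use T in auto)
  moreover have "u \<in> W" unfolding u_def by (rule W_perturb[OF v])
  ultimately have "m + Suc m \<le> n" using alternation_bound[OF _ I(1)] by blast
  then show False using nm by simp
qed

text \<open>
  A first perturbation, prescribed at the nodes of the first half and vanishing at those of the second,
  produces the m sign changes on the first half.
\<close>

lemma one_signed_half:
  assumes N: "nodes I1 I2 N1 N2" and h: "h \<in> W" and zero: "\<And>b. b \<in> N1 \<union> N2 \<Longrightarrow> h b = 0"
    and s: "s \<in> I1" "h s \<noteq> 0" and t: "t1 \<in> I2" "t2 \<in> I2"
    and conflict: "set_pattern N2 t1 * h t1 > 0" "set_pattern N2 t2 * h t2 < 0"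
  shows False
proof -
  have I: "finite N1" "card N1 = m" "N1 \<subseteq> I1" using N by (auto simp: nodes_def)
  have sN: "s \<notin> N1" using zero s by auto
  define T where "T = insert s N1"
  have T: "finite T" "T \<subseteq> I1" "card T = Suc m" using I s sN by (auto simp: T_def)
  define \<epsilon> where "\<epsilon> = set_pattern T s * sgn (h s)"
  have \<epsilon>: "\<epsilon> * \<epsilon> = 1" "\<epsilon> * set_pattern T s * h s > 0"
  proof -
    have "\<epsilon> * \<epsilon> = (set_pattern T s * set_pattern T s) * (sgn (h s) * sgn (h s))"
      by (simp only: \<epsilon>_def mult_ac)
    then show "\<epsilon> * \<epsilon> = 1" using s(2) by (simp add: sgn_if)
    have "\<epsilon> * set_pattern T s * h s = (set_pattern T s * set_pattern T s) * (sgn (h s) * h s)"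
      by (simp only: \<epsilon>_def mult_ac)
    then show "\<epsilon> * set_pattern T s * h s > 0" using s(2) by (simp add: sgn_if)
  qed
  obtain c where c: "\<forall>b\<in>N1. comb c b = \<epsilon> * set_pattern T b" "\<forall>b\<in>N2. comb c b = 0"
    using node_interpolation[OF N, of "\<lambda>b. \<epsilon> * set_pattern T b" "\<lambda>_. 0"] by blast
  let ?p = "comb c"
  have "h t \<noteq> 0" if "t \<in> {s, t1, t2}" for t using s conflict that by force
  then obtain \<delta> where \<delta>: "\<delta> > 0" "\<forall>d. 0 < d \<and> d \<le> \<delta> \<longrightarrow> (\<forall>t\<in>{s, t1, t2}. \<bar>d * ?p t\<bar> < \<bar>h t\<bar>)"
    using small_perturbation[of "{s, t1, t2}" h ?p] by blast
  define v where "v = (\<lambda>t. h t + \<delta> * ?p t)"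
  have sign: "r * v t > 0" if "t \<in> {s, t1, t2}" "r * h t > 0" for r t
    unfolding v_def by (rule perturbation_keeps_sign) (use \<delta> that in auto)
  have "v \<in> W" unfolding v_def by (rule W_perturb[OF h])
  moreover have "v b = 0" if "b \<in> N2" for b using that zero c(2) by (simp add: v_def)
  moreover have "alternates m I1 v"
    unfolding alternates_def
  proof (intro exI[of _ T] exI[of _ \<epsilon>] conjI ballI)
    fix t assume "t \<in> T"
    then consider "t \<in> N1" | "t = s" by (auto simp: T_def)
    then show "\<epsilon> * set_pattern T t * v t > 0"
    proof cases
      case 1
      have "\<epsilon> * set_pattern T t * v t = \<delta> * (\<epsilon> * \<epsilon>) * (set_pattern T t * set_pattern T t)"
        using 1 zero c(1) by (simp add: v_def mult_ac)
      then show ?thesis using \<delta>(1) \<epsilon>(1) by simp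
    qed (use sign \<epsilon> in auto)
  qed (use T in auto)
  moreover have "set_pattern N2 t1 * v t1 > 0" using sign conflict(1) by auto
  moreover have "set_pattern N2 t2 * v t2 < 0"
    using sign[of t2 "- set_pattern N2 t2"] conflict(2) by auto
  ultimately show False using no_sign_conflict[OF N _ _ _ t] by blast
qed

lemma half_points_near_0:
  assumes "halves I1 I2" "d > 0"
  shows "\<exists>t\<in>I1. t \<noteq> 0 \<and> \<bar>t\<bar> < d"
proof -
  consider "I1 = {-1..<0}" | "I1 = {0<..1}" using assms(1) by (auto simp: halves_def)
  then show ?thesis
  proof cases
    case 1
    then show ?thesis using assms(2) by (intro bexI[of _ "- min 1 (d / 2)"]) auto
  next
    case 2
    then show ?thesis using assms(2) by (intro bexI[of _ "min 1 (d / 2)"]) auto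
  qed
qed

lemma positive_near_0:
  fixes u :: "real \<Rightarrow> real"
  assumes I: "halves I1 I2" and lim: "(u \<longlongrightarrow> l) (at 0 within I1)" and l: "l > 0" and d: "d > 0"
  shows "\<exists>t\<in>I1. \<bar>t\<bar> < d \<and> u t > 0"
proof -
  have "\<forall>\<^sub>F t in at 0 within I1. u t > 0" by (rule order_tendstoD(1)[OF lim l])
  then obtain e where e: "e > 0" "\<And>t. t \<in> I1 \<Longrightarrow> t \<noteq> 0 \<Longrightarrow> \<bar>t\<bar> < e \<Longrightarrow> u t > 0"
    unfolding eventually_at by (auto simp: dist_real_def)
  obtain t where "t \<in> I1" "t \<noteq> 0" "\<bar>t\<bar> < min d e" using half_points_near_0[OF I, of "min d e"] d e(1) by auto
  then show ?thesis using e(2) by (intro bexI[of _ t]) auto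
qed

lemma nodes_away_from_0:
  assumes "nodes I1 I2 N1 N2"
  shows "\<exists>d>0. \<forall>b\<in>N1. d \<le> \<bar>b\<bar>"
proof -
  have N1: "finite N1" "N1 \<noteq> {}" using assms m by (auto simp: nodes_def)
  have "0 \<notin> N1" using assms by (auto simp: nodes_def halves_def)
  then have "0 < Min (abs ` N1)" using N1 by (subst Min_gr_iff) auto
  then show ?thesis using N1 by (intro exI[of _ "Min (abs ` N1)"]) auto
qed

lemma set_pattern_near_0:
  assumes I: "halves I1 I2" and s: "s \<in> I1" "\<bar>s\<bar> < d" and t: "t \<in> I1 \<or> t = 0" "\<bar>t\<bar> < d"
    and N: "\<And>b. b \<in> N \<Longrightarrow> d \<le> \<bar>b\<bar>"
  shows "set_pattern N s = set_pattern N t"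
proof (rule sign_pattern_eq)
  fix b assume "b \<in> N"
  then have "d \<le> \<bar>b\<bar>" by (rule N)
  then show "(s < b) = (t < b)" using s t by linarith
qed

text \<open>
  The n prescribed values force m zeros on one half and m - 1 on the other. There is no room for a
  further zero, so the sign next to 0 persists up to 0.
\<close>

lemma alternation_function:
  assumes N: "nodes I1 I2 N1 N2"
  shows "\<exists>c. comb c 0 > 0 \<and> (\<forall>b\<in>N2. comb c b = 0) \<and>
    (\<forall>b\<in>N1. comb c b = - (set_pattern (insert 0 N1) 0 * set_pattern (insert 0 N1) b))"
proof -
  define \<sigma> where "\<sigma> = set_pattern (insert 0 N1)"
  have I: "finite N1" "card N1 = m" "N1 \<subseteq> I1" "finite N2" "card N2 = m" "halves I1 I2"
    "N1 \<subseteq> {-1<..<1}" "N2 \<subseteq> {-1<..<1}" "N2 \<subseteq> I2"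
    using N by (auto simp: nodes_def)
  have z: "0 \<notin> I1" "0 \<notin> I2" using I(6) by (auto simp: halves_def)
  obtain c where c: "\<forall>b\<in>N1. comb c b = - (\<sigma> 0 * \<sigma> b)" "\<forall>b\<in>N2. comb c b = 0"
    using node_interpolation[OF N, of "\<lambda>b. - (\<sigma> 0 * \<sigma> b)" "\<lambda>_. 0"] by blast
  let ?q = "comb c"
  have \<sigma>\<sigma>: "\<sigma> t * \<sigma> t = 1" for t by (simp add: \<sigma>_def)
  obtain b0 where b0: "b0 \<in> N1" using I(1,2) m by fastforce
  have c0: "\<exists>i<n. c i \<noteq> 0"
  proof (rule lincomb_nonzero[of n \<phi> c b0])
    show "?q b0 \<noteq> 0" using c(1) b0 by (simp add: \<sigma>_def)
  qed
  have crossing: "\<exists>z\<in>{x<..<y}. ?q z = 0"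
    if "-1 \<le> x" "x < y" "y \<le> 1" "?q x * ?q y < 0" for x y
    by (rule opposite_signs_zero[OF continuous_on_subset[OF continuous_lincomb]]) (use that in auto)
  \<comment> \<open>The m zeros on the other half leave room for at most m - 1 zeros here.\<close>
  have few: "card Z + m < n" if Z: "finite Z" "Z \<subseteq> insert 0 I1 \<inter> {-1<..<1}" "\<forall>z\<in>Z. ?q z = 0" for Z
  proof -
    have "card (Z \<union> N2) < n"
      by (rule few_zeros(2)[OF c0]) (use Z I c(2) in auto)
    moreover have "Z \<inter> N2 = {}" using Z(2) I(9) halves_disjoint[OF I(6)] z by blast
    ultimately show ?thesis using Z(1) I(4,5) by (simp add: card_Un_disjoint)
  qed
  have hull: "{x<..<y} \<subseteq> I1 \<inter> {-1<..<1}" if "x \<in> insert 0 N1" "y \<in> insert 0 N1" for x y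
    using that I(3,6,7) unfolding halves_def by (auto; force)
  have "?q 0 > 0"
  proof (rule ccontr)
    assume "\<not> ?q 0 > 0"
    then consider "?q 0 < 0" | "?q 0 = 0" by linarith
    then show False
    proof cases
      case 1
      let ?T = "insert 0 N1"
      have T: "finite ?T" "?T \<noteq> {}" "card ?T = Suc m"
      proof -
        have "0 \<notin> N1" using z(1) I(3) by blast
        then show "finite ?T" "?T \<noteq> {}" "card ?T = Suc m" using I(1,2) by simp_all
      qed
      have "\<exists>Z. finite Z \<and> Suc (card Z) = card ?T \<and> Z \<subseteq> {Min ?T<..<Max ?T} \<and> (\<forall>z\<in>Z. ?q z = 0)"
      proof (rule alternation_count[OF T(1,2)])
        fix t assume t: "t \<in> ?T"
        show "(- \<sigma> 0) * set_pattern ?T t * ?q t > 0"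
        proof (cases "t = 0")
          case True
          have "(- \<sigma> 0) * set_pattern ?T t * ?q t = - ((\<sigma> 0 * \<sigma> 0) * ?q 0)"
            using True by (simp add: \<sigma>_def)
          then show ?thesis using 1 \<sigma>\<sigma> by simp
        next
          case False
          then have "?q t = - (\<sigma> 0 * \<sigma> t)" using c(1) t by auto
          then have "(- \<sigma> 0) * set_pattern ?T t * ?q t = (\<sigma> 0 * \<sigma> 0) * (\<sigma> t * \<sigma> t)"
            by (simp add: \<sigma>_def mult_ac)
          then show ?thesis using \<sigma>\<sigma> by simp
        qed
      next
        fix x y assume "x \<in> ?T" "y \<in> ?T" "x < y" "?q x * ?q y < 0"
        moreover have "x \<in> {-1..1}" "y \<in> {-1..1}" using calculation I(7) by auto
        ultimately show "\<exists>z\<in>{x<..<y}. ?q z = 0" by (intro crossing) auto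
      qed
      then obtain Z where Z: "finite Z" "Suc (card Z) = card ?T" "Z \<subseteq> {Min ?T<..<Max ?T}" "\<forall>z\<in>Z. ?q z = 0"
        by blast
      have "Z \<subseteq> insert 0 I1 \<inter> {-1<..<1}"
        using Z(3) hull[of "Min ?T" "Max ?T"] Min_in[OF T(1,2)] Max_in[OF T(1,2)] by blast
      from few[OF Z(1) this Z(4)] show False using Z(2) T(3) nm by simp
    next
      case 2
      have T: "N1 \<noteq> {}" using b0 by auto
      have pat: "\<sigma> t = (if t < 0 then 1 else -1) * set_pattern N1 t" for t
        unfolding \<sigma>_def by (rule sign_pattern_insert) (use I z in auto)
      obtain k where k: "k = 1 \<or> k = -1" "\<And>t. t \<in> N1 \<Longrightarrow> \<sigma> t = k * set_pattern N1 t"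
      proof -
        consider "I1 = {-1..<0}" | "I1 = {0<..1}" using I(6) by (auto simp: halves_def)
        then show thesis
        proof cases
          case 1
          then show thesis using that[of 1] pat I(3) by force
        next
          case 2
          then show thesis using that[of "-1"] pat I(3) by force
        qed
      qed
      have kk: "k * k = 1" using k(1) by auto
      have "\<exists>Z. finite Z \<and> Suc (card Z) = card N1 \<and> Z \<subseteq> {Min N1<..<Max N1} \<and> (\<forall>z\<in>Z. ?q z = 0)"
      proof (rule alternation_count[OF I(1) T])
        fix t assume t: "t \<in> N1"
        then have "?q t = - (\<sigma> 0 * (k * set_pattern N1 t))" using c(1) k(2) by auto
        then have "(- \<sigma> 0 * k) * set_pattern N1 t * ?q t =
            (\<sigma> 0 * \<sigma> 0) * (k * k) * (set_pattern N1 t * set_pattern N1 t)"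
          by (simp only: minus_mult_left[symmetric] minus_mult_right[symmetric] minus_minus mult_ac)
        then show "(- \<sigma> 0 * k) * set_pattern N1 t * ?q t > 0" using \<sigma>\<sigma> kk by simp
      next
        fix x y assume "x \<in> N1" "y \<in> N1" "x < y" "?q x * ?q y < 0"
        moreover have "x \<in> {-1..1}" "y \<in> {-1..1}" using calculation I(7) by auto
        ultimately show "\<exists>z\<in>{x<..<y}. ?q z = 0" by (intro crossing) auto
      qed
      then obtain Z where Z: "finite Z" "Suc (card Z) = card N1" "Z \<subseteq> {Min N1<..<Max N1}" "\<forall>z\<in>Z. ?q z = 0"
        by blast
      have ZI: "Z \<subseteq> I1 \<inter> {-1<..<1}"
        using Z(3) hull[of "Min N1" "Max N1"] Min_in[OF I(1) T] Max_in[OF I(1) T] by blast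
      then have "0 \<notin> Z" using z by auto
      moreover have "card (insert 0 Z) + m < n"
        by (rule few) (use ZI Z 2 in auto)
      ultimately show False using Z(1,2) I(2) nm by simp
    qed
  qed
  then show ?thesis using c unfolding \<sigma>_def by blast
qed

text \<open>
  Let q be the function of \<open>alternation_function\<close> and v = h - l q, which keeps the zeros on
  the second half. For l strictly between B / q(0) and A / q(0) the one-sided limits of v at 0 have
  opposite signs. Then v alternates on the first half, so on the second half it has one sign
  relative to the nodes, the one that makes it negative next to 0. For smaller positive l that sign is
  reversed; if B = 0, then l = 0 and h itself serve instead. At the value l0 = B / q(0) both weak
  inequalities hold, so v vanishes on the second half, while it has m zeros on the first without
  vanishing there: this is the degenerate situation that is excluded.
\<close>

lemma no_common_sign:
  assumes N: "nodes I1 I2 N1 N2" and h: "h \<in> W" and zero: "\<And>b. b \<in> N1 \<union> N2 \<Longrightarrow> h b = 0"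
    and limA: "(h \<longlongrightarrow> A) (at 0 within I1)" and limB: "(h \<longlongrightarrow> B) (at 0 within I2)"
    and AB: "0 \<le> B" "B < A"
    and nonneg: "\<And>t. t \<in> I2 \<Longrightarrow> set_pattern N2 0 * set_pattern N2 t * h t \<ge> 0"
  shows False
proof -
  have I: "halves I1 I2" "finite N1" "card N1 = m" "N1 \<subseteq> I1" "finite N2" "card N2 = m"
    using N by (auto simp: nodes_def)
  define \<sigma> where "\<sigma> = set_pattern (insert 0 N1)"
  define \<kappa> where "\<kappa> = set_pattern N2 0"
  have \<kappa>: "\<kappa> = 1 \<or> \<kappa> = -1" unfolding \<kappa>_def by (rule sign_pattern_cases)
  obtain c where c: "comb c 0 > 0" "\<And>b. b \<in> N2 \<Longrightarrow> comb c b = 0"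
    "\<And>b. b \<in> N1 \<Longrightarrow> comb c b = - (\<sigma> 0 * \<sigma> b)"
    using alternation_function[OF N] unfolding \<sigma>_def by blast
  let ?q = "comb c"
  define q0 where "q0 = ?q 0"
  have q0: "q0 > 0" using c(1) by (simp add: q0_def)
  define v where "v = (\<lambda>l t. h t + (- l) * ?q t)"
  have vW: "v l \<in> W" for l unfolding v_def by (rule W_perturb[OF h])
  have v0: "v l b = 0" if "b \<in> N2" for l b using zero c(2) that by (simp add: v_def)
  have qlim: "(?q \<longlongrightarrow> q0) (at 0 within J)" if "J \<subseteq> {-1..1}" for J
    using continuous_lincomb[of c] that unfolding continuous_on_def q0_def
    by (meson atLeastAtMost_iff neg_le_0_iff_le tendsto_within_subset zero_le_one)
  have sub: "I1 \<subseteq> {-1..1}" "I2 \<subseteq> {-1..1}" using I(1) by (auto simp: halves_def)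
  have vlim1: "(v l \<longlongrightarrow> A - l * q0) (at 0 within I1)" for l
    unfolding v_def using tendsto_add[OF limA tendsto_mult_left[OF qlim[OF sub(1)], of "- l"]] by simp
  have vlim2: "(v l \<longlongrightarrow> B - l * q0) (at 0 within I2)" for l
    unfolding v_def using tendsto_add[OF limB tendsto_mult_left[OF qlim[OF sub(2)], of "- l"]] by simp
  have alt: "alternates m I1 (v l)" if l: "l > 0" "A - l * q0 > 0" for l
  proof -
    obtain d where d: "d > 0" "\<And>b. b \<in> N1 \<Longrightarrow> d \<le> \<bar>b\<bar>" using nodes_away_from_0[OF N] by blast
    obtain s where s: "s \<in> I1" "\<bar>s\<bar> < d" "v l s > 0" using positive_near_0[OF I(1) vlim1 l(2) d(1)] by blast
    have sN: "s \<notin> N1" using d(2) s(2) by force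
    have z: "0 \<notin> N1" using I(1,4) by (auto simp: halves_def)
    let ?T = "insert s N1"
    have Ts: "set_pattern ?T s = \<sigma> 0"
    proof -
      have "set_pattern N1 s = set_pattern N1 0"
        by (rule set_pattern_near_0[OF I(1) s(1,2) _ _ d(2)]) (use d in auto)
      then show ?thesis using sN z I(2) by (simp add: \<sigma>_def sign_pattern_insert)
    qed
    have Tb: "set_pattern ?T b = \<sigma> b" if "b \<in> N1" for b
    proof -
      have "(b < s) = (b < 0)" using d(2)[OF that] s(1,2) that I(1,4) by (auto simp: halves_def)
      then show ?thesis using sN z I(2) by (simp add: \<sigma>_def sign_pattern_insert)
    qed
    have \<sigma>\<sigma>: "\<sigma> t * \<sigma> t = 1" for t by (simp add: \<sigma>_def)
    show ?thesis unfolding alternates_def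
    proof (intro exI[of _ ?T] exI[of _ "\<sigma> 0"] conjI ballI)
      fix t assume t: "t \<in> ?T"
      show "\<sigma> 0 * set_pattern ?T t * v l t > 0"
      proof (cases "t = s")
        case True
        then show ?thesis using Ts \<sigma>\<sigma> s(3) by simp
      next
        case False
        then have tN: "t \<in> N1" using t by simp
        have "v l t = l * (\<sigma> 0 * \<sigma> t)" using zero c(3)[OF tN] tN by (simp add: v_def)
        then have "\<sigma> 0 * set_pattern ?T t * v l t = l * (\<sigma> 0 * \<sigma> 0) * (\<sigma> t * \<sigma> t)"
          using Tb[OF tN] by (simp add: mult_ac)
        then show ?thesis using \<sigma>\<sigma> l(1) by simp
      qed
    qed (use I s sN in auto)
  qed
  have onesign: "e * (\<kappa> * set_pattern N2 t * v l t) \<ge> 0"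
    if l: "l > 0" "A - l * q0 > 0" and e: "e = 1 \<or> e = -1" "e * (B - l * q0) > 0" and t: "t \<in> I2" for l e t
  proof (rule ccontr)
    assume neg: "\<not> ?thesis"
    obtain d where d: "d > 0" "\<And>b. b \<in> N2 \<Longrightarrow> d \<le> \<bar>b\<bar>" using nodes_away_from_0[OF nodes_sym[OF N]] by blast
    have "((\<lambda>t. e * v l t) \<longlongrightarrow> e * (B - l * q0)) (at 0 within I2)" by (intro tendsto_mult_left vlim2)
    then obtain s where s: "s \<in> I2" "\<bar>s\<bar> < d" "e * v l s > 0"
      using positive_near_0[OF halves_sym[OF I(1)] _ e(2) d(1)] by blast
    have Ns: "set_pattern N2 s = \<kappa>"
      unfolding \<kappa>_def by (rule set_pattern_near_0[OF halves_sym[OF I(1)] s(1,2) _ _ d(2)]) (use d in auto)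
    have conf: False if "x \<in> I2" "y \<in> I2" "set_pattern N2 x * v l x > 0" "set_pattern N2 y * v l y < 0" for x y
      using no_sign_conflict[OF N vW v0 alt[OF l] that] by blast
    show False
      using conf[of s t] conf[of t s] s t neg \<kappa> e(1) Ns by (auto simp: not_le)
  qed
  define l0 where "l0 = B / q0"
  have l0: "l0 * q0 = B" "l0 \<ge> 0" using q0 AB by (auto simp: l0_def)
  have vdiff: "v l t = v l0 t - (l - l0) * ?q t" for l t by (simp add: v_def algebra_simps)
  \<comment> \<open>A strict sign at l0 persists for nearby l, on whichever side of l0 they are taken.\<close>
  have perturb: "\<exists>l. P l \<and> r * v l t > 0"
    if r: "r * v l0 t > 0" and P: "\<And>e. e > 0 \<Longrightarrow> \<exists>l. P l \<and> \<bar>l - l0\<bar> < e" for P r t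
  proof -
    have nz: "v l0 t \<noteq> 0" using r by auto
    define e where "e = \<bar>v l0 t\<bar> / (\<bar>?q t\<bar> + 1)"
    have e: "e > 0" using nz by (simp add: e_def add_nonneg_pos)
    obtain l where l: "P l" "\<bar>l - l0\<bar> < e" using P[OF e] by blast
    have "\<bar>- (l - l0) * ?q t\<bar> < \<bar>v l0 t\<bar>"
    proof -
      have "\<bar>- (l - l0) * ?q t\<bar> = \<bar>l - l0\<bar> * \<bar>?q t\<bar>"
        by (simp add: abs_mult abs_minus_commute)
      also have "\<dots> \<le> \<bar>l - l0\<bar> * (\<bar>?q t\<bar> + 1)" by (intro mult_left_mono) auto
      also have "\<dots> < e * (\<bar>?q t\<bar> + 1)" using l(2) by (intro mult_strict_right_mono) auto
      also have "\<dots> = \<bar>v l0 t\<bar>" by (simp add: e_def add_nonneg_pos less_imp_neq[symmetric])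
      finally show ?thesis .
    qed
    from perturbation_keeps_sign[OF this r] have "r * v l t > 0" unfolding vdiff[of l]
      by (simp add: algebra_simps)
    then show ?thesis using l(1) by blast
  qed
  have le: "\<kappa> * set_pattern N2 t * v l0 t \<le> 0" if t: "t \<in> I2" for t
  proof (rule ccontr)
    assume "\<not> ?thesis"
    then have "\<kappa> * set_pattern N2 t * v l0 t > 0" by simp
    moreover have "\<exists>l. (l > l0 \<and> l < A / q0) \<and> \<bar>l - l0\<bar> < e" if "e > 0" for e
    proof -
      have "l0 < A / q0" using AB q0 by (simp add: l0_def divide_strict_right_mono)
      then have "l0 < min (A / q0) (l0 + e)" using that by simp
      then obtain l where "l0 < l" "l < min (A / q0) (l0 + e)" using dense by blast
      then show ?thesis by (intro exI[of _ l]) auto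
    qed
    ultimately obtain l where l: "l > l0" "l < A / q0" "\<kappa> * set_pattern N2 t * v l t > 0"
      using perturb[of "\<kappa> * set_pattern N2 t" t "\<lambda>l. l > l0 \<and> l < A / q0"] by blast
    have "A - l * q0 > 0" using l(2) q0 by (simp add: field_simps)
    moreover have "l0 * q0 < l * q0" using l(1) q0 by simp
    ultimately have "(-1) * (\<kappa> * set_pattern N2 t * v l t) \<ge> 0"
      using l0 l t by (intro onesign) auto
    then show False using l(3) by simp
  qed
  have ge: "\<kappa> * set_pattern N2 t * v l0 t \<ge> 0" if t: "t \<in> I2" for t
  proof (cases "B = 0")
    case True
    then have "l0 = 0" by (simp add: l0_def)
    then show ?thesis using nonneg[OF t] by (simp add: v_def \<kappa>_def)
  next
    case False
    then have l0pos: "l0 > 0" using AB q0 by (simp add: l0_def)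
    show ?thesis
    proof (rule ccontr)
      assume "\<not> ?thesis"
      then have "(- (\<kappa> * set_pattern N2 t)) * v l0 t > 0" by simp
      moreover have "\<exists>l. (l > 0 \<and> l < l0) \<and> \<bar>l - l0\<bar> < e" if "e > 0" for e
      proof -
        have "max 0 (l0 - e) < l0" using that l0pos by simp
        then obtain l where "max 0 (l0 - e) < l" "l < l0" using dense by blast
        then show ?thesis by (intro exI[of _ l]) auto
      qed
      ultimately obtain l where l: "l > 0" "l < l0" "(- (\<kappa> * set_pattern N2 t)) * v l t > 0"
        using perturb[of "- (\<kappa> * set_pattern N2 t)" t "\<lambda>l. l > 0 \<and> l < l0"] by blast
      have lq: "l * q0 < l0 * q0" using l(2) q0 by simp
      then have "1 * (\<kappa> * set_pattern N2 t * v l t) \<ge> 0"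
        using l0 l t AB by (intro onesign) auto
      then show False using l(3) by simp
    qed
  qed
  have vanish: "v l0 t = 0" if "t \<in> I2" for t
    using le[OF that] ge[OF that] \<kappa> by auto
  have "A - l0 * q0 > 0" using l0 AB by simp
  then obtain s where s: "s \<in> I1" "v l0 s > 0" using positive_near_0[OF I(1) vlim1, of l0 1] by auto
  have fewz: "finite (zeros_on I1 (v l0)) \<and> card (zeros_on I1 (v l0)) < m"
  proof -
    have "(I2, I1) \<in> {({-1..<0}, {0<..1}), ({0<..1}, {-1..<0})}" using I(1) by (auto simp: halves_def)
    then have "(\<forall>x\<in>I2. v l0 x = 0) \<and> (\<exists>x\<in>I1. v l0 x \<noteq> 0) \<longrightarrow>
        finite (zeros_on I1 (v l0)) \<and> card (zeros_on I1 (v l0)) < n div 2"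
      using W_half vW[of l0] unfolding half_nondegenerate_def by fastforce
    moreover have "v l0 s \<noteq> 0" using s(2) by simp
    ultimately show ?thesis using vanish s(1) nm by auto
  qed
  have "\<exists>Z. finite Z \<and> card Z = m \<and> Z \<subseteq> zeros_on I1 (v l0)"
  proof (cases "B = 0")
    case True
    then have "l0 = 0" by (simp add: l0_def)
    then have "N1 \<subseteq> zeros_on I1 (v l0)" using I(4) zero by (auto simp: v_def zeros_on_def)
    then show ?thesis using I(2,3) by blast
  next
    case False
    then have "l0 > 0" using AB q0 by (simp add: l0_def)
    from alt[OF this \<open>A - l0 * q0 > 0\<close>] obtain T e where
      T: "finite T" "T \<subseteq> I1" "card T = Suc m" "\<forall>t\<in>T. e * set_pattern T t * v l0 t > 0"
      unfolding alternates_def by blast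
    have ne: "T \<noteq> {}" using T(3) by auto
    have "\<exists>Z. finite Z \<and> Suc (card Z) = card T \<and> Z \<subseteq> {Min T<..<Max T} \<and> (\<forall>z\<in>Z. v l0 z = 0)"
    proof (rule alternation_count[OF T(1) ne])
      fix x y assume xy: "x \<in> T" "y \<in> T" "x < y" "v l0 x * v l0 y < 0"
      have "{x..y} \<subseteq> {-1..1} - {0}"
        using half_interval[OF I(1), of x y] half_subset[OF I(1)] T(2) xy by blast
      from opposite_signs_zero[OF continuous_on_subset[OF W_cont[OF vW] this] xy(3,4)]
      show "\<exists>z\<in>{x<..<y}. v l0 z = 0" .
    qed (use T(4) in auto)
    then obtain Z where Z: "finite Z" "Suc (card Z) = card T" "Z \<subseteq> {Min T<..<Max T}" "\<forall>z\<in>Z. v l0 z = 0"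
      by blast
    have "{Min T..Max T} \<subseteq> I1"
      using half_interval[OF I(1), of "Min T" "Max T"] T(1,2) ne Min_in Max_in by blast
    moreover have "{Min T<..<Max T} \<subseteq> {Min T..Max T}" by auto
    ultimately have "Z \<subseteq> zeros_on I1 (v l0)" using Z(3,4) unfolding zeros_on_def by blast
    then show ?thesis using Z(1,2) T(3) by auto
  qed
  then show False using fewz card_mono by (metis not_less)
qed

lemma nonzero_near_0:
  fixes u :: "real \<Rightarrow> real"
  assumes I: "halves I1 I2" and lim: "(u \<longlongrightarrow> l) (at 0 within I1)" and l: "l \<noteq> 0"
  shows "\<exists>t\<in>I1. u t \<noteq> 0"
proof (cases "l > 0")
  case True
  then show ?thesis using positive_near_0[OF I lim True, of 1] by force
next
  case False
  then have "- l > 0" using l by simp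
  then show ?thesis using positive_near_0[OF I tendsto_minus[OF lim], of 1] by force
qed

text \<open>
  If h vanished on one half, it would have m zeros on the other, hence vanish there as well, and
  could not have different one-sided limits.
\<close>

lemma nonzero_on_half:
  assumes N: "nodes I1 I2 N1 N2" and h: "h \<in> W" and zero: "\<And>b. b \<in> N1 \<union> N2 \<Longrightarrow> h b = 0"
    and limA: "(h \<longlongrightarrow> A) (at 0 within I1)" and limB: "(h \<longlongrightarrow> B) (at 0 within I2)" and AB: "A \<noteq> B"
  shows "\<exists>s\<in>I1. h s \<noteq> 0"
proof (rule ccontr)
  assume "\<not> ?thesis"
  then have z: "\<forall>s\<in>I1. h s = 0" by blast
  have I: "halves I1 I2" "N2 \<subseteq> I2" "card N2 = m" using N by (auto simp: nodes_def)
  have "A = 0" using nonzero_near_0[OF I(1) limA] z by blast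
  then have "\<exists>x\<in>I2. h x \<noteq> 0" using nonzero_near_0[OF halves_sym[OF I(1)] limB] AB by blast
  moreover have "(I1, I2) \<in> {({-1..<0}, {0<..1}), ({0<..1}, {-1..<0})}" using I(1) by (auto simp: halves_def)
  then have "(\<forall>x\<in>I1. h x = 0) \<and> (\<exists>x\<in>I2. h x \<noteq> 0) \<longrightarrow>
      finite (zeros_on I2 h) \<and> card (zeros_on I2 h) < n div 2"
    using W_half h unfolding half_nondegenerate_def by fastforce
  ultimately have f: "finite (zeros_on I2 h)" "card (zeros_on I2 h) < m" using z nm by auto
  have "N2 \<subseteq> zeros_on I2 h" using zero I(2) by (auto simp: zeros_on_def)
  then show False using card_mono[OF f(1)] f(2) I(3) by (metis not_less)
qed

lemma one_signed_near_0:
  assumes N: "nodes I1 I2 N1 N2" and h: "h \<in> W" and zero: "\<And>b. b \<in> N1 \<union> N2 \<Longrightarrow> h b = 0"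
    and limA: "(h \<longlongrightarrow> A) (at 0 within I1)" and limB: "(h \<longlongrightarrow> B) (at 0 within I2)" and AB: "A \<noteq> B"
  shows "\<exists>\<eta>\<in>{1, -1}. \<eta> * B \<ge> 0 \<and> (\<forall>t\<in>I2. set_pattern N2 0 * set_pattern N2 t * (\<eta> * h t) \<ge> 0)"
proof -
  obtain s where s: "s \<in> I1" "h s \<noteq> 0" using nonzero_on_half[OF N h zero limA limB AB] by blast
  define \<kappa> where "\<kappa> = set_pattern N2 0"
  have \<kappa>: "\<kappa> = 1 \<or> \<kappa> = -1" unfolding \<kappa>_def by (rule sign_pattern_cases)
  have "\<not> ((\<exists>t\<in>I2. set_pattern N2 t * h t > 0) \<and> (\<exists>t\<in>I2. set_pattern N2 t * h t < 0))"
    using one_signed_half[OF N h zero s] by blast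
  then have "(\<forall>t\<in>I2. set_pattern N2 t * h t \<le> 0) \<or> (\<forall>t\<in>I2. set_pattern N2 t * h t \<ge> 0)"
    by (meson not_less)
  then obtain e where e: "e = 1 \<or> e = (-1::real)" "\<And>t. t \<in> I2 \<Longrightarrow> e * (set_pattern N2 t * h t) \<ge> 0"
  proof
    assume "\<forall>t\<in>I2. set_pattern N2 t * h t \<le> 0"
    then show thesis using that[of "-1"] by simp
  next
    assume "\<forall>t\<in>I2. set_pattern N2 t * h t \<ge> 0"
    then show thesis using that[of 1] by simp
  qed
  define \<eta> where "\<eta> = \<kappa> * e"
  have \<eta>: "\<eta> = 1 \<or> \<eta> = -1" using \<kappa> e(1) by (auto simp: \<eta>_def)
  have nonneg: "\<kappa> * set_pattern N2 t * (\<eta> * h t) \<ge> 0" if "t \<in> I2" for t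
    using e(2)[OF that] \<kappa> by (auto simp: \<eta>_def mult_ac)
  have "\<eta> * B \<ge> 0"
  proof (rule ccontr)
    assume "\<not> \<eta> * B \<ge> 0"
    then have neg: "- (\<eta> * B) > 0" by simp
    have I: "halves I2 I1" using N halves_sym by (auto simp: nodes_def)
    obtain d where d: "d > 0" "\<And>b. b \<in> N2 \<Longrightarrow> d \<le> \<bar>b\<bar>" using nodes_away_from_0[OF nodes_sym[OF N]] by blast
    have "((\<lambda>t. - (\<eta> * h t)) \<longlongrightarrow> - (\<eta> * B)) (at 0 within I2)" by (intro tendsto_minus tendsto_mult_left limB)
    from positive_near_0[OF I this neg d(1)] obtain t where t: "t \<in> I2" "\<bar>t\<bar> < d" "\<eta> * h t < 0" by auto
    have "set_pattern N2 t = \<kappa>"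
      unfolding \<kappa>_def by (rule set_pattern_near_0[OF I t(1,2) _ _ d(2)]) (use d in auto)
    then show False using nonneg[OF t(1)] t(3) \<kappa> by auto
  qed
  then show ?thesis using \<eta> nonneg unfolding \<kappa>_def by blast
qed

text \<open>
  The patterns are normalised to be 1 next to 0, so the error changes its sign at 0, in the weak sense,
  just as the canonical sign function does.
\<close>

lemma interpolation_error_sign:
  assumes N: "nodes I1 I2 N1 N2" and h: "h \<in> W" and zero: "\<And>b. b \<in> N1 \<union> N2 \<Longrightarrow> h b = 0"
    and limA: "(h \<longlongrightarrow> A) (at 0 within I1)" and limB: "(h \<longlongrightarrow> B) (at 0 within I2)" and AB: "A \<noteq> B"
  shows "\<exists>\<eta>\<in>{1, -1}. (\<forall>t\<in>I1. set_pattern N1 0 * set_pattern N1 t * (\<eta> * h t) \<ge> 0) \<and>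
    (\<forall>t\<in>I2. set_pattern N2 0 * set_pattern N2 t * (\<eta> * h t) \<le> 0)"
proof -
  have zero': "\<And>b. b \<in> N2 \<union> N1 \<Longrightarrow> h b = 0" using zero by blast
  obtain e2 where e2: "e2 \<in> {1, -1}" "e2 * B \<ge> 0"
    "\<forall>t\<in>I2. set_pattern N2 0 * set_pattern N2 t * (e2 * h t) \<ge> 0"
    using one_signed_near_0[OF N h zero limA limB AB] by blast
  obtain e1 where e1: "e1 \<in> {1, -1}" "e1 * A \<ge> 0"
    "\<forall>t\<in>I1. set_pattern N1 0 * set_pattern N1 t * (e1 * h t) \<ge> 0"
    using one_signed_near_0[OF nodes_sym[OF N] h zero' limB limA AB[symmetric]] by blast
  have "e1 \<noteq> e2"
  proof
    assume e: "e1 = e2"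
    have W: "(\<lambda>t. e2 * h t) \<in> W" using W_closed[OF h, of e2 "\<lambda>_. 0"] by (simp add: lincomb_def)
    have lA: "((\<lambda>t. e2 * h t) \<longlongrightarrow> e2 * A) (at 0 within I1)" by (intro tendsto_mult_left limA)
    have lB: "((\<lambda>t. e2 * h t) \<longlongrightarrow> e2 * B) (at 0 within I2)" by (intro tendsto_mult_left limB)
    have "e2 * A \<noteq> e2 * B" using AB e2(1) by auto
    then consider "e2 * B < e2 * A" | "e2 * A < e2 * B" by linarith
    then show False
    proof cases
      case 1
      show False by (rule no_common_sign[OF N W _ lA lB e2(2) 1]) (use zero e2(3) in auto)
    next
      case 2
      show False
        by (rule no_common_sign[OF nodes_sym[OF N] W _ lB lA _ 2]) (use zero e e1(2,3) in auto)
    qed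
  qed
  then have "e2 = - e1" using e1(1) e2(1) by auto
  then show ?thesis using e1(1,3) e2(3) by (intro bexI[of _ e1]) auto
qed

end

section \<open>Interpolation in the canonical points\<close>

lemma canonical_points_nodes:
  assumes cp: "canonical_points \<nu> Y (2 * m) \<alpha>"
  defines "NL \<equiv> \<alpha> ` {- int m..-1}" and "NR \<equiv> \<alpha> ` {1..int m}"
  shows "NL \<subseteq> {-1<..<0}" "NR \<subseteq> {0<..<1}" "card NL = m" "card NR = m"
    and "\<And>t. t \<in> {-1<..<1} - {0} \<Longrightarrow>
      canonical_sign (2 * m) \<alpha> t = (-1) ^ m * set_pattern (insert 0 (NL \<union> NR)) t"
proof -
  let ?I = "{- int m - 1..int m + 1}"
  have sm: "strict_mono_on ?I \<alpha>" and ends: "\<alpha> (- int m - 1) = -1" "\<alpha> 0 = 0" "\<alpha> (int m + 1) = 1"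
    using cp by (auto simp: canonical_points_def)
  have lt: "\<alpha> i < \<alpha> j" if "i < j" "- int m - 1 \<le> i" "j \<le> int m + 1" for i j
    using strict_mono_onD[OF sm, of i j] that by auto
  have "inj_on \<alpha> ?I" using strict_mono_on_imp_inj_on[OF sm] .
  then have inj: "inj_on \<alpha> {- int m..-1}" "inj_on \<alpha> {1..int m}"
    by (rule inj_on_subset, force)+
  show NL: "NL \<subseteq> {-1<..<0}"
  proof
    fix z assume "z \<in> NL"
    then obtain i where "i \<in> {- int m..-1}" "z = \<alpha> i" by (auto simp: NL_def)
    then show "z \<in> {-1<..<0}" using lt[of "- int m - 1" i] lt[of i 0] ends by auto
  qed
  show NR: "NR \<subseteq> {0<..<1}"
  proof
    fix z assume "z \<in> NR"
    then obtain i where "i \<in> {1..int m}" "z = \<alpha> i" by (auto simp: NR_def)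
    then show "z \<in> {0<..<1}" using lt[of 0 i] lt[of i "int m + 1"] ends by auto
  qed
  show cL: "card NL = m" "card NR = m" using inj by (simp_all add: NL_def NR_def card_image)
  show "canonical_sign (2 * m) \<alpha> t = (-1) ^ m * set_pattern (insert 0 (NL \<union> NR)) t"
    if t: "t \<in> {-1<..<1} - {0}" for t
  proof -
    have A: "finite (NL \<union> NR)" "0 \<notin> NL \<union> NR" using NL NR by (auto simp: NL_def NR_def)
    have parts: "(NL \<union> NR) \<inter> {..<0} = NL" "(NL \<union> NR) \<inter> {0<..} = NR" using NL NR by force+
    show ?thesis
    proof (cases "t < 0")
      case True
      have "canonical_sign (2 * m) \<alpha> t = (-1) ^ m * sign_pattern \<alpha> {- int m..-1} t"
        by (rule canonical_sign_halves(2)[OF sm ends]) (use t True in auto)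
      then show ?thesis
        using pattern_halves(1)[OF A True] sign_pattern_image[OF inj(1)] parts by (simp add: NL_def)
    next
      case False
      then have pos: "t > 0" using t by auto
      have "canonical_sign (2 * m) \<alpha> t = - sign_pattern \<alpha> {1..int m} t"
        by (rule canonical_sign_halves(1)[OF sm ends]) (use t pos in auto)
      moreover have "set_pattern (insert 0 (NL \<union> NR)) t = - ((-1) ^ m * sign_pattern \<alpha> {1..int m} t)"
        using pattern_halves(2)[OF A pos] sign_pattern_image[OF inj(2), of t] parts cL
        by (simp add: NR_def)
      moreover have "(-1 :: real) ^ m * (-1) ^ m = 1" by (simp flip: power_mult_distrib)
      ultimately show ?thesis by (simp flip: mult.assoc)
    qed
  qed
qed

lemma few_sign_changes_span:
  assumes H: "haar_system \<phi> (2 * m) (-1) 1" and m: "m > 0"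
    and f: "continuous_on ({-1..1} - {0}) f"
    and half: "half_nondegenerate (2 * m) (fun_vs.span (insert f (range (lincomb (2 * m) \<phi>))))"
    and simple: "\<forall>h\<in>fun_vs.span (insert f (range (lincomb (2 * m) \<phi>))).
      finite (simple_zeros h) \<and> card (simple_zeros h) \<le> 2 * m"
  shows "few_sign_changes \<phi> (2 * m) (fun_vs.span (insert f (range (lincomb (2 * m) \<phi>)))) m"
proof -
  interpret haar_system \<phi> "2 * m" "-1" 1 by (rule H)
  let ?W = "fun_vs.span (insert f (range (lincomb (2 * m) \<phi>)))"
  show ?thesis
  proof unfold_locales
    fix u :: "real \<Rightarrow> real" and e :: real and c assume u: "u \<in> ?W"
    have "fun_scale e u + lincomb (2 * m) \<phi> c \<in> ?W"
      by (intro fun_vs.span_add fun_vs.span_scale u fun_vs.span_base) auto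
    then show "(\<lambda>t. e * u t + lincomb (2 * m) \<phi> c t) \<in> ?W" by (simp add: fun_scale_def plus_fun_def)
  next
    have "?W \<subseteq> {u. continuous_on ({-1..1} - {0}) u}"
    proof (rule fun_vs.span_minimal)
      show "insert f (range (lincomb (2 * m) \<phi>)) \<subseteq> {u. continuous_on ({-1..1} - {0}) u}"
        using f continuous_on_subset[OF continuous_lincomb] by auto
      show "fun_vs.subspace {u. continuous_on ({-1..1} - {0}) u}"
        by (rule fun_vs.subspaceI)
          (auto simp: fun_scale_def plus_fun_def zero_fun_def intro: continuous_on_add continuous_on_mult_left)
    qed
    then show "continuous_on ({-1..1} - {0}) u" if "u \<in> ?W" for u using that by blast
  qed (use m half simple in auto)
qed

context chebyshev_approximation
begin

lemma best_L1_approx_iff: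
  assumes "Y = range comb"
  shows "best_L1_approx \<nu> Y f (comb c) \<longleftrightarrow> (\<forall>d. err f c \<le> err f d)"
  using assms by (auto simp: best_L1_approx_def err_def)

text \<open>
  Duality: integrating against the sign pattern gives the norm of the error for the given coefficients,
  ignores all elements of the space, and never exceeds the norm.
\<close>

lemma best_of_error_sign:
  assumes f: "f \<in> J0" and orth: "\<And>c. (LINT t|\<nu>. set_pattern A t * comb c t) = 0"
    and \<theta>: "\<theta> = 1 \<or> \<theta> = -1"
    and sign: "\<And>t. t \<in> {-1..1} - {0} \<Longrightarrow> \<theta> * set_pattern A t * (f t - comb c t) \<ge> 0"
  shows "err f c \<le> err f d"
proof -
  let ?s = "\<lambda>t. \<theta> * set_pattern A t"
  have abs: "\<bar>?s t\<bar> = 1" for t using \<theta> by (auto simp: abs_mult)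
  have fi: "integrable \<nu> f" by (rule J0_integrable[OF f])
  have [measurable]: "f \<in> borel_measurable \<nu>" by (rule J0_measurable[OF f])
  have [measurable]: "set_pattern A \<in> borel_measurable \<nu>" by (intro measurable_borel sign_pattern_borel)
  have [measurable]: "comb d \<in> borel_measurable \<nu>" for d by (rule comb_measurable)
  have sf: "integrable \<nu> (\<lambda>t. ?s t * f t)"
    by (rule Bochner_Integration.integrable_bound[OF fi])
      (use abs in \<open>auto simp: abs_mult[of _ "f _"]\<close>)
  have sg: "integrable \<nu> (\<lambda>t. ?s t * comb d t)" for d
    using integrable_mult_right[OF pattern_integrable, of \<theta>] by (simp add: mult_ac)
  have same: "(LINT t|\<nu>. ?s t * (f t - comb d t)) = (LINT t|\<nu>. ?s t * f t)" for d
  proof -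
    have "(LINT t|\<nu>. ?s t * comb d t) = \<theta> * (LINT t|\<nu>. set_pattern A t * comb d t)"
      by (simp add: mult.assoc)
    then have "(LINT t|\<nu>. ?s t * comb d t) = 0" using orth by simp
    then show ?thesis
      using Bochner_Integration.integral_diff[OF sf sg[of d]] by (simp add: right_diff_distrib)
  qed
  have "err f c = (LINT t|\<nu>. ?s t * (f t - comb c t))"
    unfolding err_def L1_norm_def
  proof (rule integral_cong_AE)
    have "finite {0 :: real}" by simp
    from AE_not_finite[OF this] AE_space show "AE t in \<nu>. \<bar>f t - comb c t\<bar> = ?s t * (f t - comb c t)"
    proof eventually_elim
      case (elim t)
      then have "?s t * (f t - comb c t) \<ge> 0" by (intro sign) auto
      then have "?s t * (f t - comb c t) = \<bar>?s t * (f t - comb c t)\<bar>" by simp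
      also have "\<dots> = \<bar>f t - comb c t\<bar>" using abs[of t] by (simp only: abs_mult mult_1)
      finally show ?case by simp
    qed
  qed measurable
  also have "\<dots> = (LINT t|\<nu>. ?s t * (f t - comb d t))" by (simp only: same)
  also have "\<dots> \<le> err f d"
    unfolding err_def L1_norm_def
  proof (rule integral_mono)
    show "integrable \<nu> (\<lambda>t. ?s t * (f t - comb d t))"
      unfolding right_diff_distrib by (intro Bochner_Integration.integrable_diff sf sg)
    show "?s t * (f t - comb d t) \<le> \<bar>f t - comb d t\<bar>" for t
      using abs_ge_self[of "?s t * (f t - comb d t)"] abs[of t] by (simp only: abs_mult mult_1)
  qed (rule err_integrable[OF fi])
  finally show ?thesis .
qed

lemma interpolant_best:
  assumes nm: "n = 2 * m" and m: "m > 0" and f: "f \<in> J0" and jump: "jumps_at_0 f"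
    and half: "half_nondegenerate n (fun_vs.span (insert f (range comb)))"
    and simple: "\<forall>h\<in>fun_vs.span (insert f (range comb)). finite (simple_zeros h) \<and> card (simple_zeros h) \<le> n"
    and N: "NL \<subseteq> {-1<..<0}" "NR \<subseteq> {0<..<1}" "finite NL" "finite NR" "card NL = m" "card NR = m"
    and orth: "\<And>c. (LINT t|\<nu>. set_pattern (insert 0 (NL \<union> NR)) t * comb c t) = 0"
    and int: "\<And>b. b \<in> NL \<union> NR \<Longrightarrow> comb c b = f b"
  shows "err f c \<le> err f d"
proof -
  let ?W = "fun_vs.span (insert f (range comb))"
  have cf: "continuous_on ({-1..1} - {0}) f" using f by (simp add: J0_def)
  interpret few_sign_changes \<phi> n ?W m
    using few_sign_changes_span[OF _ m cf] haar_system_axioms half simple unfolding nm by blast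
  define h where "h = (\<lambda>t. f t - comb c t)"
  have "f + lincomb n \<phi> (\<lambda>i. - c i) \<in> ?W" by (intro fun_vs.span_add fun_vs.span_base) auto
  then have hW: "h \<in> ?W" by (simp add: h_def plus_fun_def lincomb_uminus)
  obtain a b where ab: "(f \<longlongrightarrow> a) (at_left 0)" "(f \<longlongrightarrow> b) (at_right 0)" "a \<noteq> b"
    using jump unfolding jumps_at_0_def by blast
  have fl: "(f \<longlongrightarrow> a) (at 0 within {-1..<0})" "(f \<longlongrightarrow> b) (at 0 within {0<..1})"
    by (rule tendsto_within_subset[OF ab(1)], force) (rule tendsto_within_subset[OF ab(2)], force)
  have "(comb c \<longlongrightarrow> comb c 0) (at 0 within {-1..1})"
    using continuous_lincomb[of c] unfolding continuous_on_def by simp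
  then have gl: "(comb c \<longlongrightarrow> comb c 0) (at 0 within {-1..<0})" "(comb c \<longlongrightarrow> comb c 0) (at 0 within {0<..1})"
    by (rule tendsto_within_subset, force)+
  have lims: "(h \<longlongrightarrow> a - comb c 0) (at 0 within {-1..<0})" "(h \<longlongrightarrow> b - comb c 0) (at 0 within {0<..1})"
    unfolding h_def by (intro tendsto_diff fl gl)+
  have nodes: "nodes {-1..<0} {0<..1} NL NR"
    using N by (auto simp: nodes_def halves_def)
  have "\<exists>\<eta>\<in>{1, -1}. (\<forall>t\<in>{-1..<0}. set_pattern NL 0 * set_pattern NL t * (\<eta> * h t) \<ge> 0) \<and>
      (\<forall>t\<in>{0<..1}. set_pattern NR 0 * set_pattern NR t * (\<eta> * h t) \<le> 0)"
    by (rule interpolation_error_sign[OF nodes hW _ lims]) (use int ab(3) in \<open>auto simp: h_def\<close>)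
  then obtain \<eta> where \<eta>: "\<eta> \<in> {1, -1}"
    "\<And>t. t \<in> {-1..<0} \<Longrightarrow> set_pattern NL 0 * set_pattern NL t * (\<eta> * h t) \<ge> 0"
    "\<And>t. t \<in> {0<..1} \<Longrightarrow> set_pattern NR 0 * set_pattern NR t * (\<eta> * h t) \<le> 0" by blast
  have L0: "set_pattern NL 0 = (-1) ^ m" using sign_pattern_all_le[of NL "\<lambda>z. z" 0] N by force
  have R0: "set_pattern NR 0 = 1" by (rule sign_pattern_all_greater) (use N in auto)
  have mm: "(-1 :: real) ^ m * (-1) ^ m = 1" by (simp flip: power_mult_distrib)
  have A: "finite (NL \<union> NR)" "0 \<notin> NL \<union> NR" using N by auto
  have parts: "(NL \<union> NR) \<inter> {..<0} = NL" "(NL \<union> NR) \<inter> {0<..} = NR" using N by force+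
  \<comment> \<open>To the left of 0 the global pattern is that of the nodes NL, equal to (-1) ^ m next to 0.\<close>
  define \<theta> where "\<theta> = (-1) ^ m * \<eta>"
  have \<theta>: "\<theta> = 1 \<or> \<theta> = -1" using \<eta>(1) by (cases "even m") (auto simp: \<theta>_def)
  show ?thesis
  proof (rule best_of_error_sign[OF f orth \<theta>])
    fix t :: real assume t: "t \<in> {-1..1} - {0}"
    show "\<theta> * set_pattern (insert 0 (NL \<union> NR)) t * (f t - comb c t) \<ge> 0"
    proof (cases "t < 0")
      case True
      have "\<theta> * set_pattern (insert 0 (NL \<union> NR)) t * (f t - comb c t) =
          set_pattern NL 0 * set_pattern NL t * (\<eta> * h t)"
        using pattern_halves(1)[OF A True] parts L0 by (simp add: \<theta>_def h_def mult_ac)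
      then show ?thesis using \<eta>(2)[of t] t True by auto
    next
      case False
      then have pos: "t > 0" using t by auto
      have "\<theta> * set_pattern (insert 0 (NL \<union> NR)) t * (f t - comb c t) =
          - (((-1) ^ m * (-1) ^ m) * set_pattern NR t * (\<eta> * h t))"
        using pattern_halves(2)[OF A pos] parts N(5) by (simp add: \<theta>_def h_def mult_ac)
      also have "\<dots> = - (set_pattern NR 0 * set_pattern NR t * (\<eta> * h t))" by (simp only: mm R0)
      finally show ?thesis using \<eta>(3)[of t] t pos by auto
    qed
  qed
qed

end

context charging_measure
begin

lemma canonical_approximation:
  assumes H: "haar_system \<phi> n (-1) 1" and Y: "Y = range (lincomb n \<phi>)" and nm: "n = 2 * m"
    and cp: "canonical_points \<nu> Y n \<alpha>" and f: "f \<in> J0"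
  shows "\<exists>!u. best_L1_approx \<nu> Y f u"
    and "jumps_at_0 f \<Longrightarrow> half_nondegenerate n (fun_vs.span (insert f Y)) \<Longrightarrow>
      \<forall>h\<in>fun_vs.span (insert f Y). finite (simple_zeros h) \<and> card (simple_zeros h) \<le> n \<Longrightarrow>
      u \<in> Y \<Longrightarrow> best_L1_approx \<nu> Y f u \<longleftrightarrow> (\<forall>i\<in>{- int m..int m} - {0}. u (\<alpha> i) = f (\<alpha> i))"
proof -
  interpret haar_system \<phi> n "-1" 1 by (rule H)
  interpret chebyshev_approximation \<nu> \<phi> n by unfold_locales auto
  define NL where "NL = \<alpha> ` {- int m..-1}"
  define NR where "NR = \<alpha> ` {1..int m}"
  note C = canonical_points_nodes[OF cp[unfolded nm], folded NL_def NR_def]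
  have fin: "finite NL" "finite NR" by (simp_all add: NL_def NR_def)
  have parts: "(NL \<union> NR) \<inter> {..<0} = NL" "(NL \<union> NR) \<inter> {0<..} = NR" using C(1,2) by force+
  have A: "finite (NL \<union> NR)" "NL \<union> NR \<subseteq> {-1<..<1} - {0}" using fin C(1,2) by force+
  have orth: "(LINT t|\<nu>. set_pattern (insert 0 (NL \<union> NR)) t * comb c t) = 0" for c
  proof -
    have "0 = (LINT t|\<nu>. canonical_sign n \<alpha> t * comb c t)"
      using cp Y by (auto simp: canonical_points_def)
    also have "\<dots> = (LINT t|\<nu>. (-1) ^ m * (set_pattern (insert 0 (NL \<union> NR)) t * comb c t))"
    proof (rule integral_cong_AE)
      show "(\<lambda>t. canonical_sign n \<alpha> t * comb c t) \<in> borel_measurable \<nu>"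
        by (intro borel_measurable_times comb_measurable measurable_borel borel_measurable_canonical_sign)
      show "(\<lambda>t. (-1) ^ m * (set_pattern (insert 0 (NL \<union> NR)) t * comb c t)) \<in> borel_measurable \<nu>"
        by (intro borel_measurable_integrable integrable_mult_right pattern_integrable)
      have "finite {-1, 0, 1 :: real}" by simp
      from AE_not_finite[OF this] AE_space
      show "AE t in \<nu>. canonical_sign n \<alpha> t * comb c t = (-1) ^ m * (set_pattern (insert 0 (NL \<union> NR)) t * comb c t)"
      proof eventually_elim
        case (elim t)
        then have "t \<in> {-1<..<1} - {0}" by auto
        then show ?case using C(5)[of t] nm by simp
      qed
    qed
    finally show ?thesis by simp
  qed
  have unique: "comb c1 = comb c2" if "\<And>d. err f c1 \<le> err f d" "\<And>d. err f c2 \<le> err f d" for c1 c2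
    by (rule best_approximation_unique[OF f nm A _ _ orth that]) (use parts C in auto)
  note iff = best_L1_approx_iff[OF Y, of f]
  show "\<exists>!u. best_L1_approx \<nu> Y f u"
  proof (rule ex_ex1I)
    obtain c where "\<forall>d. err f c \<le> err f d" using best_approximation_exists[OF J0_integrable[OF f]] by blast
    then have "best_L1_approx \<nu> Y f (comb c)" by (simp add: iff)
    then show "\<exists>u. best_L1_approx \<nu> Y f u" by blast
  next
    fix u v assume uv: "best_L1_approx \<nu> Y f u" "best_L1_approx \<nu> Y f v"
    then obtain c d where "u = comb c" "v = comb d" using Y unfolding best_L1_approx_def by blast
    then show "u = v" using uv unique[of c d] by (simp add: iff)
  qed
  show "best_L1_approx \<nu> Y f u \<longleftrightarrow> (\<forall>i\<in>{- int m..int m} - {0}. u (\<alpha> i) = f (\<alpha> i))"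
    if jump: "jumps_at_0 f" and half: "half_nondegenerate n (fun_vs.span (insert f Y))"
      and simple: "\<forall>h\<in>fun_vs.span (insert f Y). finite (simple_zeros h) \<and> card (simple_zeros h) \<le> n"
      and u: "u \<in> Y"
  proof (cases "m = 0")
    case True
    then have "n = 0" using nm by simp
    then have "Y = {\<lambda>_. 0}" unfolding Y by (auto simp: lincomb_def fun_eq_iff)
    then show ?thesis using True u by (auto simp: best_L1_approx_def)
  next
    case False
    then have m: "m > 0" by simp
    have index: "{- int m..int m} - {0} = {- int m..-1} \<union> {1..int m}" by auto
    have nodes: "(\<forall>i\<in>{- int m..int m} - {0}. v (\<alpha> i) = f (\<alpha> i)) \<longleftrightarrow> (\<forall>b\<in>NL \<union> NR. v b = f b)"
      for v :: "real \<Rightarrow> real"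
      unfolding index NL_def NR_def by blast
    have best: "err f c \<le> err f d" if "\<forall>b\<in>NL \<union> NR. comb c b = f b" for c d
      by (rule interpolant_best[OF nm m f jump half[unfolded Y] simple[unfolded Y] C(1,2) fin C(3,4) orth])
        (use that in auto)
    have "NL \<inter> NR = {}" using C(1,2) by force
    then have "card (NL \<union> NR) = n" using fin C(3,4) nm by (simp add: card_Un_disjoint)
    then obtain c0 where c0: "\<forall>b\<in>NL \<union> NR. comb c0 b = f b"
      using interpolation[of "NL \<union> NR" f] A by auto
    obtain c where c: "u = comb c" using u Y by blast
    show ?thesis
      unfolding nodes
    proof
      assume "best_L1_approx \<nu> Y f u"
      then have "\<forall>d. err f c \<le> err f d" using c iff by simp
      then have "comb c = comb c0" using unique[of c c0] best[OF c0] by blast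
      then show "\<forall>b\<in>NL \<union> NR. u b = f b" using c c0 by simp
    next
      assume "\<forall>b\<in>NL \<union> NR. u b = f b"
      then show "best_L1_approx \<nu> Y f u" using best[of c] c iff by simp
    qed
  qed
qed

end

theorem theorem3p1:
  fixes \<nu> :: "real measure" and n :: nat and Y :: "(real \<Rightarrow> real) set"
  assumes "finite_measure \<nu>" and "positive_measure_on_I \<nu>" and "non_atomic \<nu>"
    and "even n" and "chebyshev_space (-1) 1 n Y"
    and "fun_vs.dim (Y \<inter> even_functions) = n div 2"
  shows "(symmetric_measure \<nu> \<longrightarrow> (\<exists>!\<alpha>. canonical_points \<nu> Y n \<alpha>)) \<and>
    (\<forall>\<alpha>. canonical_points \<nu> Y n \<alpha> \<longrightarrow>
      (\<forall>f\<in>J0. \<exists>!g. best_L1_approx \<nu> Y f g) \<and>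
      (\<forall>f\<in>J0. jumps_at_0 f \<and> half_nondegenerate n (fun_vs.span (insert f Y)) \<and>
          (\<forall>h\<in>fun_vs.span (insert f Y). finite (simple_zeros h) \<and> card (simple_zeros h) \<le> n) \<longrightarrow>
        (\<forall>g\<in>Y. best_L1_approx \<nu> Y f g \<longleftrightarrow>
          (\<forall>i\<in>{- int (n div 2)..int (n div 2)} - {0}. g (\<alpha> i) = f (\<alpha> i)))))"
proof -
  interpret charging_measure \<nu> by (rule charging_measure.intro) (rule assms)+
  define m where "m = n div 2"
  have n: "n = 2 * m" using assms(4) by (simp add: m_def)
  have dim: "fun_vs.dim (Y \<inter> even_functions) = m" using assms(6) by (simp add: m_def)
  obtain \<phi> where \<phi>: "Y = range (lincomb n \<phi>)" "haar_system \<phi> n (-1) 1"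
    using chebyshev_basis[OF assms(5) n dim] by blast
  show ?thesis
    unfolding m_def[symmetric]
  proof (intro conjI impI allI ballI)
    assume "symmetric_measure \<nu>"
    then show "\<exists>!\<alpha>. canonical_points \<nu> Y n \<alpha>" by (rule ex1_canonical_points[OF assms(5) n dim])
  next
    fix \<alpha> f assume "canonical_points \<nu> Y n \<alpha>" "f \<in> J0"
    then show "\<exists>!g. best_L1_approx \<nu> Y f g" by (rule canonical_approximation(1)[OF \<phi>(2,1) n])
  next
    fix \<alpha> f g
    assume "canonical_points \<nu> Y n \<alpha>" "f \<in> J0"
      and "jumps_at_0 f \<and> half_nondegenerate n (fun_vs.span (insert f Y)) \<and>
        (\<forall>h\<in>fun_vs.span (insert f Y). finite (simple_zeros h) \<and> card (simple_zeros h) \<le> n)"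
      and "g \<in> Y"
    then show "best_L1_approx \<nu> Y f g \<longleftrightarrow> (\<forall>i\<in>{- int m..int m} - {0}. g (\<alpha> i) = f (\<alpha> i))"
      using canonical_approximation(2)[OF \<phi>(2,1) n, of \<alpha> f g] by blast
  qed
qed

end
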